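(* Let $G$ be a countable group. Consider the following three conditions. (1) $G$ has the strong topological Rokhlin property. (2) For every finite set $A$ with at least two elements, every subshift $X\subseteq A^G$ and every $\varepsilon>0$, there is a projectively isolated subshift $X'\subseteq A^G$ whose Hausdorff distance to $X$ is at most $\varepsilon$. (3) Shadowing is generic for continuous actions of $G$ on the Cantor space $\mathcal{C}$, i.e. the set of $\alpha\in\mathrm{Act}_G(\mathcal{C})$ having shadowing is comeager in $\mathrm{Act}_G(\mathcal{C})$. If $G$ is finitely generated, then (1), (2) and (3) are equivalent. For a general countable $G$, (1) and (2) are equivalent, and (3) implies (1) and (2).
   Context: $\mathcal{C}$ is the Cantor space and $\mathrm{Homeo}(\mathcal{C})$ is the topological group of its self-homeomorphisms with the uniform topology. For a countable group $G$, $\mathrm{Act}_G(\mathcal{C})$ is the Polish space of all continuous actions of $G$ on $\mathcal{C}$, identified with the set of homomorphisms $G\to\mathrm{Homeo}(\mathcal{C})$, a closed subset of $\mathrm{Homeo}(\mathcal{C})^G$ with the product topology. $\mathrm{Homeo}(\mathcal{C})$ acts on $\mathrm{Act}_G(\mathcal{C})$ by conjugation, $(\phi\alpha\phi^{-1})(g)=\phi\alpha(g)\phi^{-1}$. $G$ has the strong topological Rokhlin property if there is $\alpha\in\mathrm{Act}_G(\mathcal{C})$ whose conjugacy class $\{\phi\alpha\phi^{-1}:\phi\in\mathrm{Homeo}(\mathcal{C})\}$ is comeager in $\mathrm{Act}_G(\mathcal{C})$. For a finite set $A$, $G$ acts on $A^G$ (product topology) by $(gx)(h)=x(g^{-1}h)$.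 A subshift of $A^G$ is a non-empty closed $G$-invariant subset. For a subshift $X\subseteq A^G$ and finite $F\subseteq G$ put $X_F=\{x\upharpoonright F: x\in X\}\subseteq A^F$. $\mathcal{S}_G(A)$ is the compact space of all subshifts of $A^G$ with the Vietoris topology, equivalently the topology of the Hausdorff metric induced by a (fixed) compatible metric on $A^G$; basic open neighborhoods of $X$ are $\mathcal{N}_X^F=\{Y\in\mathcal{S}_G(A): Y_F=X_F\}$, $F\subseteq G$ finite. A subshift $X\in\mathcal{S}_G(A)$ is projectively isolated if there exist a finite set $B$, a subshift $Y\in\mathcal{S}_G(B)$, a finite set $F\subseteq G$ and a continuous $G$-equivariant map $\phi:Y\to X$, given by a local rule $\phi_0:Y_F\to A$ via $\phi(y)(g)=\phi_0(g^{-1}y\upharpoonright F)$ (so that the same rule defines $\phi$ on every $Z\in\mathcal{N}_Y^F$), such that the set $\{Z\in\mathcal{N}_Y^F:\phi[Z]=X\}$ contains an open neighborhood of $Y$. Shadowing: let $G$ act continuously on a compact metrizable space $X$ with compatible metric $d$. For $\delta>0$ and finite $S\subseteq G$, a family $(x_g)_{g\in G}\subseteq X$ is a $(\delta,S)$-pseudo-orbit if $d(s\cdot x_g,x_{sg})<\delta$ for all $g\in G$, $s\in S$. The action has shadowing if for every $\varepsilon>0$ there are $\delta>0$ and a finite $S\subseteq G$ such that for every $(\delta,S)$-pseudo-orbit $(x_g)_{g\in G}$ there is $x\in X$ with $d(x_g,g\cdot x)<\varepsilon$ for all $g\in G$. (This does not depend on the choice of $d$.) *)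

theory Defs
  imports "HOL-Analysis.Analysis" "HOL-Algebra.Generated_Groups"
begin

section \<open>Baire category in abstract topological spaces\<close>

definition nowhere_dense_in :: "'a topology \<Rightarrow> 'a set \<Rightarrow> bool" where
  "nowhere_dense_in X N \<longleftrightarrow> N \<subseteq> topspace X \<and> X interior_of (X closure_of N) = {}"

definition meager_in :: "'a topology \<Rightarrow> 'a set \<Rightarrow> bool" where
  "meager_in X S \<longleftrightarrow> (\<exists>\<N>. countable \<N> \<and> (\<forall>N\<in>\<N>. nowhere_dense_in X N) \<and> S = \<Union>\<N>)"

definition comeager_in :: "'a topology \<Rightarrow> 'a set \<Rightarrow> bool" where
  "comeager_in X S \<longleftrightarrow> S \<subseteq> topspace X \<and> meager_in X (topspace X - S)"


section \<open>The Cantor space and its homeomorphism group\<close>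

type_synonym cantor = "nat \<Rightarrow> bool"

definition cantor_space :: "cantor topology" where
  "cantor_space = product_topology (\<lambda>_. discrete_topology UNIV) UNIV"

definition cantor_dist :: "cantor \<Rightarrow> cantor \<Rightarrow> real" where
  "cantor_dist x y = (if x = y then 0 else (1/2) ^ (LEAST n. x n \<noteq> y n))"

definition cantor_metric :: "cantor metric" where
  "cantor_metric = metric (UNIV, cantor_dist)"

lemma cantor_dist_le_iff: "cantor_dist x y \<le> (1/2) ^ n \<longleftrightarrow> (\<forall>k<n. x k = y k)"
proof (cases "x = y")
  case False
  then obtain m where m: "x m \<noteq> y m" by blast
  define l where "l = (LEAST n. x n \<noteq> y n)"
  have l: "x l \<noteq> y l" unfolding l_def by (rule LeastI[of "\<lambda>n. x n \<noteq> y n", OF m])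
  have lt: "x k = y k" if "k < l" for k
    using not_less_Least[of k "\<lambda>n. x n \<noteq> y n"] that unfolding l_def by blast
  have "(1/2::real) ^ l \<le> (1/2) ^ n \<longleftrightarrow> n \<le> l" by simp
  also have "\<dots> \<longleftrightarrow> (\<forall>k<n. x k = y k)" using l lt by (meson le_less_trans linorder_not_le order_less_le_trans)
  finally show ?thesis using False by (simp add: cantor_dist_def l_def)
qed (simp add: cantor_dist_def)

lemma Metric_space_cantor_dist: "Metric_space UNIV cantor_dist"
proof
  fix x y z :: cantor
  show "0 \<le> cantor_dist x y" by (simp add: cantor_dist_def)
  show "cantor_dist x y = cantor_dist y x" by (auto simp: cantor_dist_def eq_commute)
  show "cantor_dist x y = 0 \<longleftrightarrow> x = y" by (simp add: cantor_dist_def)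
  have pow: "\<exists>n. cantor_dist u v = (1/2) ^ n" if "u \<noteq> v" for u v
    using that by (auto simp: cantor_dist_def)
  have nn: "0 \<le> cantor_dist u v" for u v by (simp add: cantor_dist_def)
  show "cantor_dist x z \<le> cantor_dist x y + cantor_dist y z"
  proof (cases "x = y \<or> y = z")
    case True
    then show ?thesis by (auto simp: cantor_dist_def)
  next
    case False
    then obtain m n where mn: "cantor_dist x y = (1/2) ^ m" "cantor_dist y z = (1/2) ^ n"
      using pow by metis
    then have "\<forall>k<m. x k = y k" "\<forall>k<n. y k = z k"
      by (metis cantor_dist_le_iff order_refl)+
    then have "\<forall>k<min m n. x k = z k" by simp
    then have "cantor_dist x z \<le> (1/2) ^ min m n" by (simp only: cantor_dist_le_iff)
    also have "\<dots> \<le> cantor_dist x y + cantor_dist y z"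
      using mn by (simp add: min_def)
    finally show ?thesis .
  qed
qed

lemma mtopology_of_cantor_metric: "mtopology_of cantor_metric = cantor_space"
proof -
  interpret Metric_space UNIV cantor_dist by (rule Metric_space_cantor_dist)
  have "openin mtopology U \<longleftrightarrow> openin cantor_space U" for U
  proof
    assume U: "openin mtopology U"
    show "openin cantor_space U"
      unfolding cantor_space_def openin_product_topology_alt
    proof (intro conjI ballI)
      fix x assume "x \<in> U"
      then obtain r where r: "r > 0" "mball x r \<subseteq> U" using U openin_mtopology by metis
      obtain n where n: "(1/2::real) ^ n < r" using real_arch_pow_inv[of r "1/2"] r by auto
      define V where "V = (\<lambda>k. if k < n then {x k} else (UNIV::bool set))"
      have "Pi\<^sub>E UNIV V \<subseteq> U"
      proof
        fix y assume "y \<in> Pi\<^sub>E UNIV V"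
        then have "y k \<in> V k" for k by auto
        then have "\<forall>k<n. x k = y k" by (metis V_def singletonD)
        then have "cantor_dist x y \<le> (1/2) ^ n" by (simp only: cantor_dist_le_iff)
        then show "y \<in> U" using n r by (auto simp: subset_iff)
      qed
      moreover have "{k \<in> UNIV. V k \<noteq> topspace (discrete_topology UNIV)} \<subseteq> {..<n}"
        by (auto simp: V_def)
      then have "finite {k \<in> UNIV. V k \<noteq> topspace (discrete_topology UNIV)}"
        using finite_subset by blast
      moreover have "x \<in> Pi\<^sub>E UNIV V" by (auto simp: V_def)
      ultimately show "\<exists>V. finite {i \<in> UNIV. V i \<noteq> topspace (discrete_topology UNIV)} \<and>
          (\<forall>i\<in>UNIV. openin (discrete_topology UNIV) (V i)) \<and> x \<in> Pi\<^sub>E UNIV V \<and> Pi\<^sub>E UNIV V \<subseteq> U"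
        by (intro exI[of _ V]) auto
    qed
  next
    assume U: "openin cantor_space U"
    show "openin mtopology U"
      unfolding openin_mtopology
    proof (intro conjI allI impI)
      fix x assume "x \<in> U"
      with U have "\<exists>V. finite {i \<in> UNIV. V i \<noteq> topspace (discrete_topology (UNIV::bool set))} \<and>
          (\<forall>i\<in>UNIV. openin (discrete_topology UNIV) (V i)) \<and> x \<in> Pi\<^sub>E UNIV V \<and> Pi\<^sub>E UNIV V \<subseteq> U"
        unfolding cantor_space_def openin_product_topology_alt by blast
      then obtain V where V: "finite {i. V i \<noteq> (UNIV::bool set)}" "x \<in> Pi\<^sub>E UNIV V"
          "Pi\<^sub>E UNIV V \<subseteq> U"
        by auto
      from V(1) obtain n where "{i. V i \<noteq> UNIV} \<subseteq> {..<n}"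
        using finite_nat_bounded by blast
      then have n: "V i = UNIV" if "\<not> i < n" for i
        using that by blast
      have "mball x ((1/2) ^ n) \<subseteq> U"
      proof
        fix y assume "y \<in> mball x ((1/2) ^ n)"
        then have "cantor_dist x y \<le> (1/2) ^ n" by auto
        then have eq: "\<forall>k<n. x k = y k" by (simp only: cantor_dist_le_iff)
        have "y k \<in> V k" for k
        proof (cases "k < n")
          case True
          then show ?thesis using eq PiE_mem[OF V(2), of k] by simp
        next
          case False
          then show ?thesis using n by simp
        qed
        then have "y \<in> Pi\<^sub>E UNIV V" by (intro PiE_I) auto
        then show "y \<in> U" using V by blast
      qed
      then show "\<exists>r>0. mball x r \<subseteq> U" by (intro exI[of _ "(1/2) ^ n"]) auto
    qed auto
  qed
  then show ?thesis by (simp add: cantor_metric_def topology_eq)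
qed

definition homeo_group :: "(cantor \<Rightarrow> cantor) monoid" where
  "homeo_group = \<lparr>carrier = {f. homeomorphic_map cantor_space cantor_space f},
                  monoid.mult = (\<circ>), one = id\<rparr>"

text \<open>\<^const>\<open>cfunspace\<close> carries the supremum metric, so this is the uniform topology.\<close>

definition homeo_topology :: "(cantor \<Rightarrow> cantor) topology" where
  "homeo_topology =
     subtopology (mtopology_of (cfunspace cantor_space cantor_metric)) (carrier homeo_group)"


section \<open>The space of actions and the strong topological Rokhlin property\<close>

definition actions :: "('g, 'b) monoid_scheme \<Rightarrow> ('g \<Rightarrow> cantor \<Rightarrow> cantor) set" where
  "actions G = hom G homeo_group \<inter> extensional (carrier G)"

definition action_topology :: "('g, 'b) monoid_scheme \<Rightarrow> ('g \<Rightarrow> cantor \<Rightarrow> cantor) topology" where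
  "action_topology G = subtopology (product_topology (\<lambda>_. homeo_topology) (carrier G)) (actions G)"

definition conj_action ::
  "('g, 'b) monoid_scheme \<Rightarrow> (cantor \<Rightarrow> cantor) \<Rightarrow> ('g \<Rightarrow> cantor \<Rightarrow> cantor) \<Rightarrow> 'g \<Rightarrow> cantor \<Rightarrow> cantor"
  where "conj_action G \<phi> \<alpha> = (\<lambda>g\<in>carrier G. \<phi> \<circ> \<alpha> g \<circ> inv_into UNIV \<phi>)"

definition strong_topological_Rokhlin :: "('g, 'b) monoid_scheme \<Rightarrow> bool" where
  "strong_topological_Rokhlin G \<longleftrightarrow>
     (\<exists>\<alpha>\<in>actions G.
        comeager_in (action_topology G) {conj_action G \<phi> \<alpha> | \<phi>. \<phi> \<in> carrier homeo_group})"

definition finitely_generated_group :: "('g, 'b) monoid_scheme \<Rightarrow> bool" where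
  "finitely_generated_group G \<longleftrightarrow>
     (\<exists>S. finite S \<and> S \<subseteq> carrier G \<and> generate G S = carrier G)"


section \<open>Subshifts\<close>

text \<open>Configurations and patterns are extensional functions, so that restriction to a set of
  group elements is \<^const>\<open>restrict\<close>.\<close>

definition full_shift :: "('g, 'b) monoid_scheme \<Rightarrow> 'a set \<Rightarrow> ('g \<Rightarrow> 'a) topology" where
  "full_shift G A = product_topology (\<lambda>_. discrete_topology A) (carrier G)"

definition shift :: "('g, 'b) monoid_scheme \<Rightarrow> 'g \<Rightarrow> ('g \<Rightarrow> 'a) \<Rightarrow> 'g \<Rightarrow> 'a" where
  "shift G g x = (\<lambda>h\<in>carrier G. x (inv\<^bsub>G\<^esub> g \<otimes>\<^bsub>G\<^esub> h))"

definition subshifts :: "('g, 'b) monoid_scheme \<Rightarrow> 'a set \<Rightarrow> ('g \<Rightarrow> 'a) set set" where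
  "subshifts G A = {X. closedin (full_shift G A) X \<and> X \<noteq> {} \<and>
                       (\<forall>g\<in>carrier G. shift G g ` X \<subseteq> X)}"

definition patterns :: "'g set \<Rightarrow> ('g \<Rightarrow> 'a) set \<Rightarrow> ('g \<Rightarrow> 'a) set" where
  "patterns F X = (\<lambda>x. restrict x F) ` X"

definition pattern_nbhd ::
  "('g, 'b) monoid_scheme \<Rightarrow> 'a set \<Rightarrow> 'g set \<Rightarrow> ('g \<Rightarrow> 'a) set \<Rightarrow> ('g \<Rightarrow> 'a) set set" where
  "pattern_nbhd G A F X = {Y \<in> subshifts G A. patterns F Y = patterns F X}"

definition vietoris_topology :: "'x topology \<Rightarrow> 'x set topology" where
  "vietoris_topology T =
     subtopology
       (topology_generated_by
          ({{K. K \<subseteq> U} | U. openin T U} \<union> {{K. K \<inter> U \<noteq> {}} | U. openin T U}))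
       {K. closedin T K \<and> K \<noteq> {}}"

definition subshift_topology ::
  "('g, 'b) monoid_scheme \<Rightarrow> 'a set \<Rightarrow> ('g \<Rightarrow> 'a) set topology" where
  "subshift_topology G A = subtopology (vietoris_topology (full_shift G A)) (subshifts G A)"

definition block_map ::
  "('g, 'b) monoid_scheme \<Rightarrow> 'g set \<Rightarrow> (('g \<Rightarrow> 'c) \<Rightarrow> 'a) \<Rightarrow> ('g \<Rightarrow> 'c) \<Rightarrow> 'g \<Rightarrow> 'a" where
  "block_map G F \<phi>\<^sub>0 y = (\<lambda>g\<in>carrier G. \<phi>\<^sub>0 (restrict (shift G (inv\<^bsub>G\<^esub> g) y) F))"

text \<open>The auxiliary finite alphabet \<open>B\<close> ranges over the finite sets of natural numbers, which
  represent all finite sets up to bijection.\<close>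

definition projectively_isolated ::
  "('g, 'b) monoid_scheme \<Rightarrow> 'a set \<Rightarrow> ('g \<Rightarrow> 'a) set \<Rightarrow> bool" where
  "projectively_isolated G A X \<longleftrightarrow>
     X \<in> subshifts G A \<and>
     (\<exists>(B :: nat set) Y F \<phi>\<^sub>0.
        finite B \<and> Y \<in> subshifts G B \<and> finite F \<and> F \<subseteq> carrier G \<and>
        \<phi>\<^sub>0 \<in> patterns F Y \<rightarrow> A \<and>
        continuous_map (subtopology (full_shift G B) Y) (subtopology (full_shift G A) X)
          (block_map G F \<phi>\<^sub>0) \<and>
        (\<forall>g\<in>carrier G. \<forall>y\<in>Y. block_map G F \<phi>\<^sub>0 (shift G g y) = shift G g (block_map G F \<phi>\<^sub>0 y)) \<and>
        (\<exists>U. openin (subshift_topology G B) U \<and> Y \<in> U \<and>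
             U \<subseteq> {Z \<in> pattern_nbhd G B F Y. block_map G F \<phi>\<^sub>0 ` Z = X}))"

definition hausdorff_dist :: "'x metric \<Rightarrow> 'x set \<Rightarrow> 'x set \<Rightarrow> real" where
  "hausdorff_dist m S T =
     max (SUP x\<in>S. INF y\<in>T. mdist m x y) (SUP y\<in>T. INF x\<in>S. mdist m x y)"

lemma full_shift_metrizable:
  assumes "countable (carrier G)"
  shows "\<exists>m. mtopology_of m = full_shift G A"
proof -
  have "metrizable_space (full_shift G A)"
    unfolding full_shift_def metrizable_space_product_topology
    using assms by (auto intro: countable_subset metrizable_space_discrete_topology)
  then show ?thesis
    unfolding metrizable_space_def by (metis Metric_space.mtopology_of)
qed

text \<open>As for \<open>B\<close> above, alphabets are finite sets of natural numbers; \<open>d A\<close> is the metric chosen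
  on the full shift with alphabet \<open>A\<close>.\<close>

definition projectively_isolated_dense ::
  "('g, 'b) monoid_scheme \<Rightarrow> (nat set \<Rightarrow> ('g \<Rightarrow> nat) metric) \<Rightarrow> bool" where
  "projectively_isolated_dense G d \<longleftrightarrow>
     (\<forall>A. finite A \<and> card A \<ge> 2 \<longrightarrow>
        (\<forall>X\<in>subshifts G A. \<forall>\<epsilon>>0.
           \<exists>X'. projectively_isolated G A X' \<and> hausdorff_dist (d A) X X' \<le> \<epsilon>))"


section \<open>Shadowing\<close>

definition pseudo_orbit ::
  "('g, 'b) monoid_scheme \<Rightarrow> 'x metric \<Rightarrow> ('g \<Rightarrow> 'x \<Rightarrow> 'x) \<Rightarrow> real \<Rightarrow> 'g set \<Rightarrow> ('g \<Rightarrow> 'x) \<Rightarrow> bool" where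
  "pseudo_orbit G m \<alpha> \<delta> S x \<longleftrightarrow>
     x \<in> carrier G \<rightarrow> mspace m \<and>
     (\<forall>g\<in>carrier G. \<forall>s\<in>S. mdist m (\<alpha> s (x g)) (x (s \<otimes>\<^bsub>G\<^esub> g)) < \<delta>)"

definition has_shadowing ::
  "('g, 'b) monoid_scheme \<Rightarrow> 'x metric \<Rightarrow> ('g \<Rightarrow> 'x \<Rightarrow> 'x) \<Rightarrow> bool" where
  "has_shadowing G m \<alpha> \<longleftrightarrow>
     (\<forall>\<epsilon>>0. \<exists>\<delta>>0. \<exists>S. finite S \<and> S \<subseteq> carrier G \<and>
        (\<forall>x. pseudo_orbit G m \<alpha> \<delta> S x \<longrightarrow>
             (\<exists>z\<in>mspace m. \<forall>g\<in>carrier G. mdist m (x g) (\<alpha> g z) < \<epsilon>)))"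

definition shadowing_generic :: "('g, 'b) monoid_scheme \<Rightarrow> cantor metric \<Rightarrow> bool" where
  "shadowing_generic G \<rho> \<longleftrightarrow>
     comeager_in (action_topology G) {\<alpha> \<in> actions G. has_shadowing G \<rho> \<alpha>}"

end

theory Submission
  imports Defs
begin

text \<open>
  A labelling \<open>p\<close> of the Cantor space, that is, a map that depends on finitely many bits, turns an
  action \<open>\<alpha>\<close> into a subshift \<open>factor \<alpha> p\<close>: the point \<open>x\<close> is sent to the configuration
  \<open>g \<mapsto> p (\<alpha> (inv g) x)\<close>. Call \<open>\<alpha>\<close> stable at \<open>p\<close> if this subshift is the same for all actions
  near \<open>\<alpha>\<close>. The theorem holds because each of the three conditions is equivalent to
  \<open>stable_dense\<close>: for every \<open>p\<close>, the actions that are stable at \<open>p\<close> are dense.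

  Questions about nearby actions become questions about subshifts by \<open>realization\<close>: a subshift
  \<open>Z\<close> that has the same patterns as \<open>factor \<alpha> t\<close> on a finite window is a factor of an action that
  agrees with \<open>\<alpha>\<close> on this window, up to the precision of \<open>t\<close>. The shift on the product of \<open>Z\<close> and a
  Cantor space is an action on a Cantor space. The nonempty clopen pieces of Cantor spaces are all
  homeomorphic, so that action can be conjugated into the prescribed position. Consequently, if
  \<open>\<alpha>\<close> is stable at \<open>p\<close>, there are a refinement \<open>q\<close> of \<open>p\<close> and a window such that every subshift with
  the patterns of \<open>factor \<alpha> q\<close> on the window projects onto \<open>factor \<alpha> p\<close> (\<open>stable_witness\<close>). This
  makes \<open>factor \<alpha> p\<close> projectively isolated. Applied to the largest subshift with these patterns,
  whose points are the pseudo-orbits as seen by \<open>q\<close>, it says that pseudo-orbits are shadowed as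
  seen by \<open>p\<close>. So density of stable actions implies that projectively isolated subshifts are dense
  and that shadowing is generic.

  The Rokhlin property and genericity of shadowing give density of stable actions by counting. The
  sets of actions with a prescribed \<open>factor \<alpha> p\<close> are closed, and the space of actions is completely
  metrizable. If only countably many subshifts \<open>factor \<alpha> p\<close> arise from the actions in a comeager
  set, then by Baire category the interiors of these closed sets have a dense union, which consists of
  stable actions (\<open>stable_dense_if_countably_many_factors\<close>). On a conjugacy class the factors given
  by \<open>p\<close> are those of one action given by the countably many labellings \<open>p \<circ> \<phi>\<close>. Under shadowing,
  \<open>factor \<alpha> p\<close> is the image of a subshift of finite type by a letter map, and there are countably
  many of those (\<open>factor_eq_image_finite_type\<close>).

  Density of projectively isolated subshifts gives density of stable actions as follows.
  Approximate \<open>factor \<alpha> t\<close> by a projectively isolated subshift, the image of an isolating \<open>Y\<close> under a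
  block map, and realise the graph of the block map near \<open>\<alpha>\<close>. Actions near the resulting one have a
  factor that is close to \<open>Y\<close>, so its image is unchanged.

  Finally, density of stable actions gives the Rokhlin property by a back and forth argument
  (\<open>generic_forth\<close>, \<open>generic_actions_conjugate\<close>). Suppose that two actions are stable at every
  labelling and satisfy a further condition that holds on a comeager set, and that
  \<open>factor \<alpha> p = factor \<beta> p'\<close>. Then every refinement of \<open>p\<close> can be matched by a refinement of \<open>p'\<close> with
  the same factor: genericity matches patterns on a finite window, and stability turns the match
  into an equality. In the limit the two actions are inverse limits of the same tower of subshifts
  and hence conjugate.
\<close>

section \<open>Baire category\<close>

lemma meager_in_subset:
  assumes "meager_in X S" "T \<subseteq> S"
  shows "meager_in X T"
proof -
  obtain \<N> where \<N>: "countable \<N>" "\<forall>N\<in>\<N>. nowhere_dense_in X N" "S = \<Union>\<N>"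
    using assms(1) unfolding meager_in_def by blast
  have "nowhere_dense_in X (N \<inter> T)" if "N \<in> \<N>" for N
  proof -
    have "X interior_of (X closure_of (N \<inter> T)) \<subseteq> X interior_of (X closure_of N)"
      by (intro interior_of_mono closure_of_mono) blast
    then show ?thesis
      using \<N>(2) that unfolding nowhere_dense_in_def by blast
  qed
  then have "\<forall>N\<in>(\<lambda>N. N \<inter> T) ` \<N>. nowhere_dense_in X N"
    by blast
  moreover have "T = \<Union>((\<lambda>N. N \<inter> T) ` \<N>)"
    using \<N>(3) assms(2) by blast
  ultimately show ?thesis
    unfolding meager_in_def using \<N>(1) by blast
qed

lemma comeager_in_mono:
  assumes "comeager_in X S" "S \<subseteq> T" "T \<subseteq> topspace X"
  shows "comeager_in X T"
  using assms meager_in_subset[of X "topspace X - S" "topspace X - T"]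
  unfolding comeager_in_def by blast

lemma comeager_in_Inter_open_dense:
  assumes "countable \<D>" and D: "\<And>D. D \<in> \<D> \<Longrightarrow> openin X D \<and> X closure_of D = topspace X"
  shows "comeager_in X (topspace X \<inter> \<Inter>\<D>)"
proof -
  have "nowhere_dense_in X (topspace X - D)" if "D \<in> \<D>" for D
  proof -
    have "closedin X (topspace X - D)"
      using D[OF that] by blast
    then show ?thesis
      using D[OF that] unfolding nowhere_dense_in_def
      by (simp add: closure_of_closedin interior_of_complement)
  qed
  then have "\<forall>N\<in>(\<lambda>D. topspace X - D) ` \<D>. nowhere_dense_in X N"
    by blast
  moreover have "topspace X - topspace X \<inter> \<Inter>\<D> = \<Union>((\<lambda>D. topspace X - D) ` \<D>)"
    by blast
  ultimately show ?thesis
    unfolding comeager_in_def meager_in_def using assms(1) by blast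
qed

text \<open>A closed set minus its interior is closed with empty interior. So if some nonempty open set
  missed all the interiors, it would be covered by countably many nowhere dense sets: these
  differences and the ones making up the complement of \<open>S\<close>. The Baire category theorem forbids
  that.\<close>

lemma comeager_in_countable_closed_cover:
  assumes X: "completely_metrizable_space X" and S: "comeager_in X S"
    and "countable \<E>" and cl: "\<And>E. E \<in> \<E> \<Longrightarrow> closedin X E" and cov: "S \<subseteq> \<Union>\<E>"
  shows "X closure_of (\<Union>E\<in>\<E>. X interior_of E) = topspace X"
proof -
  obtain \<N> where \<N>: "countable \<N>" "\<forall>N\<in>\<N>. nowhere_dense_in X N" "topspace X - S = \<Union>\<N>"
    using S unfolding comeager_in_def meager_in_def by (elim conjE exE)
  define \<G> where "\<G> = (\<lambda>N. X closure_of N) ` \<N> \<union> (\<lambda>E. E - X interior_of E) ` \<E>"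
  have "X interior_of \<Union>\<G> = {}"
  proof (rule Baire_category_alt)
    show "completely_metrizable_space X \<or> locally_compact_space X \<and> regular_space X"
      using X by blast
    show "countable \<G>"
      using \<N>(1) \<open>countable \<E>\<close> by (simp add: \<G>_def)
    show "closedin X T \<and> X interior_of T = {}" if "T \<in> \<G>" for T
      using that unfolding \<G>_def
    proof
      assume "T \<in> (\<lambda>N. X closure_of N) ` \<N>"
      then show ?thesis
        using \<N>(2) unfolding nowhere_dense_in_def by auto
    next
      assume "T \<in> (\<lambda>E. E - X interior_of E) ` \<E>"
      then obtain E where E: "E \<in> \<E>" "T = E - X interior_of E"
        by blast
      have "X interior_of T \<subseteq> X interior_of E"
        using E(2) by (simp add: interior_of_mono)
      moreover have "X interior_of T \<subseteq> T"
        by (rule interior_of_subset)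
      ultimately show ?thesis
        using E cl[OF E(1)] by (auto simp: closedin_diff)
    qed
  qed
  moreover have "topspace X - (\<Union>E\<in>\<E>. X interior_of E) \<subseteq> \<Union>\<G>"
  proof
    fix x assume x: "x \<in> topspace X - (\<Union>E\<in>\<E>. X interior_of E)"
    show "x \<in> \<Union>\<G>"
    proof (cases "x \<in> S")
      case True
      then obtain E where E: "E \<in> \<E>" "x \<in> E" using cov by blast
      then have "x \<in> E - X interior_of E" using x by blast
      moreover have "E - X interior_of E \<in> \<G>" using E(1) by (simp add: \<G>_def)
      ultimately show ?thesis by blast
    next
      case False
      then have "x \<in> \<Union>\<N>"
        unfolding \<N>(3)[symmetric] using x by simp
      then obtain N where N: "N \<in> \<N>" "x \<in> N" by (rule UnionE)
      have "N \<subseteq> topspace X"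
        using \<N>(2) N(1) by (simp add: nowhere_dense_in_def)
      then have "x \<in> X closure_of N"
        using closure_of_subset N(2) by (metis subsetD)
      moreover have "X closure_of N \<in> \<G>"
        using N(1) by (simp add: \<G>_def)
      ultimately show ?thesis by blast
    qed
  qed
  ultimately have "X interior_of (topspace X - (\<Union>E\<in>\<E>. X interior_of E)) = {}"
    by (metis interior_of_mono subset_empty)
  then show ?thesis
    using closure_of_subset_topspace[of X "\<Union>E\<in>\<E>. X interior_of E"]
    by (simp add: interior_of_complement subset_antisym)
qed


section \<open>Powers of a discrete space\<close>

lemma openin_discrete_power_iff:
  "openin (product_topology (\<lambda>_. discrete_topology A) I) U \<longleftrightarrow>
     U \<subseteq> I \<rightarrow>\<^sub>E A \<and>
     (\<forall>x\<in>U. \<exists>K. finite K \<and> K \<subseteq> I \<and> (\<forall>y\<in>I \<rightarrow>\<^sub>E A. (\<forall>k\<in>K. y k = x k) \<longrightarrow> y \<in> U))"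
  (is "?L \<longleftrightarrow> ?R")
proof
  assume L: ?L
  have "\<exists>K. finite K \<and> K \<subseteq> I \<and> (\<forall>y\<in>I \<rightarrow>\<^sub>E A. (\<forall>k\<in>K. y k = x k) \<longrightarrow> y \<in> U)" if x: "x \<in> U" for x
  proof -
    obtain V where V: "finite {i \<in> I. V i \<noteq> A}" "x \<in> Pi\<^sub>E I V" "Pi\<^sub>E I V \<subseteq> U"
      using L x unfolding openin_product_topology_alt by fastforce
    have "y \<in> U" if "y \<in> I \<rightarrow>\<^sub>E A" "\<forall>k\<in>{i \<in> I. V i \<noteq> A}. y k = x k" for y
    proof -
      have "y \<in> Pi\<^sub>E I V"
      proof (rule PiE_I)
        fix i assume "i \<in> I"
        then show "y i \<in> V i"
          using that V(2) by (cases "V i = A") (auto simp: PiE_iff)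
      qed (use that in auto)
      then show ?thesis using V(3) by blast
    qed
    then show ?thesis
      using V(1) by (intro exI[of _ "{i \<in> I. V i \<noteq> A}"]) auto
  qed
  then show ?R
    using openin_subset[OF L] by simp
next
  assume R: ?R
  show ?L
    unfolding openin_product_topology_alt
  proof
    fix x assume x: "x \<in> U"
    then obtain K where K: "finite K" "K \<subseteq> I" "\<forall>y\<in>I \<rightarrow>\<^sub>E A. (\<forall>k\<in>K. y k = x k) \<longrightarrow> y \<in> U"
      using R by blast
    define V where "V = (\<lambda>k. if k \<in> K then {x k} else A)"
    have xA: "x \<in> I \<rightarrow>\<^sub>E A" using R x by blast
    have sub: "Pi\<^sub>E I V \<subseteq> U"
    proof
      fix y assume y: "y \<in> Pi\<^sub>E I V"
      have "y \<in> I \<rightarrow>\<^sub>E A"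
        using y xA by (auto simp: V_def PiE_iff split: if_splits)
      moreover have "\<forall>k\<in>K. y k = x k"
        using y K(2) by (auto simp: V_def PiE_iff split: if_splits)
      ultimately show "y \<in> U" using K(3) by blast
    qed
    have fin: "finite {i \<in> I. V i \<noteq> topspace (discrete_topology A)}"
      by (rule finite_subset[OF _ K(1)]) (auto simp: V_def)
    have op: "\<forall>i\<in>I. openin (discrete_topology A) (V i)"
      using xA by (auto simp: V_def)
    have "x \<in> Pi\<^sub>E I V"
      using xA by (auto simp: V_def)
    with fin op sub show "\<exists>V. finite {i \<in> I. V i \<noteq> topspace (discrete_topology A)} \<and>
        (\<forall>i\<in>I. openin (discrete_topology A) (V i)) \<and> x \<in> Pi\<^sub>E I V \<and> Pi\<^sub>E I V \<subseteq> U"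
      by blast
  qed
qed

lemma closedin_discrete_power_iff:
  "closedin (product_topology (\<lambda>_. discrete_topology A) I) X \<longleftrightarrow>
     X \<subseteq> I \<rightarrow>\<^sub>E A \<and>
     (\<forall>x\<in>I \<rightarrow>\<^sub>E A. (\<forall>K. finite K \<and> K \<subseteq> I \<longrightarrow> (\<exists>y\<in>X. \<forall>k\<in>K. y k = x k)) \<longrightarrow> x \<in> X)"
  (is "?L \<longleftrightarrow> ?R")
proof
  assume L: ?L
  then have X: "X \<subseteq> I \<rightarrow>\<^sub>E A"
    using closedin_subset by fastforce
  have "x \<in> X" if x: "x \<in> I \<rightarrow>\<^sub>E A"
    and H: "\<forall>K. finite K \<and> K \<subseteq> I \<longrightarrow> (\<exists>y\<in>X. \<forall>k\<in>K. y k = x k)" for x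
  proof (rule ccontr)
    assume "x \<notin> X"
    then have x': "x \<in> (I \<rightarrow>\<^sub>E A) - X"
      using x by simp
    have "openin (product_topology (\<lambda>_. discrete_topology A) I) ((I \<rightarrow>\<^sub>E A) - X)"
      using L by (simp add: closedin_def)
    then obtain K where K: "finite K" "K \<subseteq> I"
        "\<forall>y\<in>I \<rightarrow>\<^sub>E A. (\<forall>k\<in>K. y k = x k) \<longrightarrow> y \<in> (I \<rightarrow>\<^sub>E A) - X"
      using x' unfolding openin_discrete_power_iff by meson
    then obtain y where "y \<in> X" "\<forall>k\<in>K. y k = x k"
      using H by meson
    then show False using K(3) X by blast
  qed
  with X show ?R by simp
next
  assume R: ?R
  have "\<exists>K. finite K \<and> K \<subseteq> I \<and> (\<forall>y\<in>I \<rightarrow>\<^sub>E A. (\<forall>k\<in>K. y k = x k) \<longrightarrow> y \<in> (I \<rightarrow>\<^sub>E A) - X)"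
    if "x \<in> (I \<rightarrow>\<^sub>E A) - X" for x
  proof -
    obtain K where "finite K" "K \<subseteq> I" "\<not> (\<exists>y\<in>X. \<forall>k\<in>K. y k = x k)"
      using R \<open>x \<in> (I \<rightarrow>\<^sub>E A) - X\<close> by (metis DiffE)
    then show ?thesis by (intro exI[of _ K]) auto
  qed
  then have "openin (product_topology (\<lambda>_. discrete_topology A) I) ((I \<rightarrow>\<^sub>E A) - X)"
    unfolding openin_discrete_power_iff by (meson Diff_subset)
  then show ?L
    using R by (simp add: closedin_def)
qed

lemma openin_cylinder:
  assumes "finite K" "K \<subseteq> I"
  shows "openin (product_topology (\<lambda>_. discrete_topology A) I) {y \<in> I \<rightarrow>\<^sub>E A. \<forall>k\<in>K. y k = x k}"
  unfolding openin_discrete_power_iff using assms by auto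

lemma compact_space_discrete_power:
  "finite A \<Longrightarrow> compact_space (product_topology (\<lambda>_. discrete_topology A) I)"
  by (simp add: compact_space_product_topology compact_space_discrete_topology)

lemma Hausdorff_space_discrete_power:
  "Hausdorff_space (product_topology (\<lambda>_. discrete_topology A) I)"
  by (simp add: Hausdorff_space_product_topology)

text \<open>A Lebesgue number lemma in which closeness is agreement on a finite set of coordinates, and so
  does not depend on a metric: finitely many cylinders, each contained in a member of the cover,
  already cover the space, and \<open>K\<close> collects the coordinates that define them.\<close>

lemma cylinder_refines_open_cover:
  fixes I :: "'i set" and A :: "'a set"
  defines "T \<equiv> product_topology (\<lambda>_. discrete_topology A) I"
  assumes "finite A" and op: "\<And>U. U \<in> \<C> \<Longrightarrow> openin T U" and cov: "I \<rightarrow>\<^sub>E A \<subseteq> \<Union>\<C>"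
  shows "\<exists>K. finite K \<and> K \<subseteq> I \<and>
           (\<forall>x\<in>I \<rightarrow>\<^sub>E A. \<exists>U\<in>\<C>. \<forall>y\<in>I \<rightarrow>\<^sub>E A. (\<forall>k\<in>K. y k = x k) \<longrightarrow> y \<in> U)"
proof -
  have "\<exists>U K. U \<in> \<C> \<and> finite K \<and> K \<subseteq> I \<and> (\<forall>y\<in>I \<rightarrow>\<^sub>E A. (\<forall>k\<in>K. y k = x k) \<longrightarrow> y \<in> U)"
    if x: "x \<in> I \<rightarrow>\<^sub>E A" for x
  proof -
    obtain U where "U \<in> \<C>" "x \<in> U" using cov x by blast
    then show ?thesis
      using op[of U] unfolding T_def openin_discrete_power_iff by blast
  qed
  then obtain U K where UK: "\<And>x. x \<in> I \<rightarrow>\<^sub>E A \<Longrightarrow> U x \<in> \<C> \<and> finite (K x) \<and> K x \<subseteq> I \<and>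
      (\<forall>y\<in>I \<rightarrow>\<^sub>E A. (\<forall>k\<in>K x. y k = x k) \<longrightarrow> y \<in> U x)"
    by metis
  define cyl where "cyl = (\<lambda>x. {y \<in> I \<rightarrow>\<^sub>E A. \<forall>k\<in>K x. y k = x k})"
  have "compactin T (I \<rightarrow>\<^sub>E A)"
    using compact_space_discrete_power[OF \<open>finite A\<close>, of I]
    unfolding compact_space_def T_def by simp
  moreover have "openin T (cyl x)" if "x \<in> I \<rightarrow>\<^sub>E A" for x
    using UK[OF that] unfolding T_def cyl_def by (simp add: openin_cylinder)
  then have "\<forall>W\<in>cyl ` (I \<rightarrow>\<^sub>E A). openin T W"
    by simp
  moreover have "x \<in> cyl x" if "x \<in> I \<rightarrow>\<^sub>E A" for x
    using that by (simp add: cyl_def)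
  then have "I \<rightarrow>\<^sub>E A \<subseteq> \<Union>(cyl ` (I \<rightarrow>\<^sub>E A))"
    by (meson UN_I subsetI)
  ultimately have "\<exists>\<F>. finite \<F> \<and> \<F> \<subseteq> cyl ` (I \<rightarrow>\<^sub>E A) \<and> I \<rightarrow>\<^sub>E A \<subseteq> \<Union>\<F>"
    unfolding compactin_def by simp
  then obtain \<F> where "finite \<F>" "\<F> \<subseteq> cyl ` (I \<rightarrow>\<^sub>E A)" "I \<rightarrow>\<^sub>E A \<subseteq> \<Union>\<F>"
    by (elim exE conjE)
  then obtain D where D: "finite D" "D \<subseteq> I \<rightarrow>\<^sub>E A" "I \<rightarrow>\<^sub>E A \<subseteq> \<Union>(cyl ` D)"
    by (metis finite_subset_image)
  show ?thesis
  proof (intro exI[of _ "\<Union>(K ` D)"] conjI ballI)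
    show "finite (\<Union>(K ` D))"
      using D(1,2) UK by (simp add: subset_iff)
    show "\<Union>(K ` D) \<subseteq> I"
    proof (rule UN_least)
      fix x assume "x \<in> D"
      then show "K x \<subseteq> I" using UK[OF subsetD[OF D(2)]] by simp
    qed
    fix x assume x: "x \<in> I \<rightarrow>\<^sub>E A"
    then obtain c where c: "c \<in> D" "\<forall>k\<in>K c. x k = c k"
      using D(3) unfolding cyl_def by auto
    have UKc: "U c \<in> \<C>" "\<forall>y\<in>I \<rightarrow>\<^sub>E A. (\<forall>k\<in>K c. y k = c k) \<longrightarrow> y \<in> U c"
      using UK[of c] c(1) D(2) by auto
    have "y \<in> U c" if "y \<in> I \<rightarrow>\<^sub>E A" "\<forall>k\<in>\<Union>(K ` D). y k = x k" for y
    proof -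
      have "\<forall>k\<in>K c. y k = c k" using that(2) c by auto
      then show ?thesis using UKc(2) that(1) by simp
    qed
    then show "\<exists>U\<in>\<C>. \<forall>y\<in>I \<rightarrow>\<^sub>E A. (\<forall>k\<in>\<Union>(K ` D). y k = x k) \<longrightarrow> y \<in> U"
      using UKc(1) by (intro bexI[of _ "U c"]) simp
  qed
qed

text \<open>This lemma and the next one say that every compatible metric induces the uniformity of
  agreement on finite sets of coordinates. They turn the metric notions of the theorem (Hausdorff
  distance, pseudo-orbits, shadowing) into statements about finitely many coordinates, whatever
  the metric is.\<close>

lemma discrete_power_metric_small_if_agree:
  assumes m: "mtopology_of m = product_topology (\<lambda>_. discrete_topology A) I"
    and "finite A" "\<epsilon> > 0"
  shows "\<exists>K. finite K \<and> K \<subseteq> I \<and>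
           (\<forall>x\<in>I \<rightarrow>\<^sub>E A. \<forall>y\<in>I \<rightarrow>\<^sub>E A. (\<forall>k\<in>K. x k = y k) \<longrightarrow> mdist m x y < \<epsilon>)"
proof -
  interpret m: Metric_space "mspace m" "mdist m" by simp
  have ms: "mspace m = I \<rightarrow>\<^sub>E A"
    using arg_cong[OF m, of topspace] by simp
  define \<C> where "\<C> = (\<lambda>x. m.mball x (\<epsilon>/2)) ` (I \<rightarrow>\<^sub>E A)"
  have "openin (product_topology (\<lambda>_. discrete_topology A) I) U" if "U \<in> \<C>" for U
    using that unfolding \<C>_def m[symmetric] mtopology_of_def by auto
  moreover have "I \<rightarrow>\<^sub>E A \<subseteq> \<Union>\<C>"
    using \<open>\<epsilon> > 0\<close> unfolding \<C>_def ms[symmetric] by force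
  ultimately obtain K where K: "finite K" "K \<subseteq> I"
      "\<forall>x\<in>I \<rightarrow>\<^sub>E A. \<exists>U\<in>\<C>. \<forall>y\<in>I \<rightarrow>\<^sub>E A. (\<forall>k\<in>K. y k = x k) \<longrightarrow> y \<in> U"
    using cylinder_refines_open_cover[OF \<open>finite A\<close>, of \<C> I] by blast
  have "mdist m x y < \<epsilon>" if xy: "x \<in> I \<rightarrow>\<^sub>E A" "y \<in> I \<rightarrow>\<^sub>E A" "\<forall>k\<in>K. x k = y k" for x y
  proof -
    obtain c where "x \<in> m.mball c (\<epsilon>/2)" "y \<in> m.mball c (\<epsilon>/2)"
      using K(3) xy unfolding \<C>_def by (metis (no_types, lifting) imageE)
    then show ?thesis
      using m.triangle[of x c y] m.commute[of x c] by simp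
  qed
  with K(1,2) show ?thesis by (intro exI[of _ K]) simp
qed

lemma discrete_power_metric_agree_if_small:
  assumes m: "mtopology_of m = product_topology (\<lambda>_. discrete_topology A) I"
    and "finite A" "finite K" "K \<subseteq> I"
  shows "\<exists>\<delta>>0. \<forall>x\<in>I \<rightarrow>\<^sub>E A. \<forall>y\<in>I \<rightarrow>\<^sub>E A. mdist m x y < \<delta> \<longrightarrow> (\<forall>k\<in>K. x k = y k)"
proof -
  interpret m: Metric_space "mspace m" "mdist m" by simp
  have ms: "mspace m = I \<rightarrow>\<^sub>E A"
    using arg_cong[OF m, of topspace] by simp
  define \<C> where "\<C> = (\<lambda>x. {y \<in> I \<rightarrow>\<^sub>E A. \<forall>k\<in>K. y k = x k}) ` (I \<rightarrow>\<^sub>E A)"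
  have op: "openin m.mtopology U" if "U \<in> \<C>" for U
    using that openin_cylinder[OF assms(3,4), of A] unfolding \<C>_def m[unfolded mtopology_of_def] by auto
  have cpt: "compactin m.mtopology (I \<rightarrow>\<^sub>E A)"
    using compact_space_discrete_power[OF \<open>finite A\<close>, of I]
    unfolding compact_space_def m[unfolded mtopology_of_def] by simp
  have "I \<rightarrow>\<^sub>E A \<subseteq> \<Union>\<C>" unfolding \<C>_def by blast
  from m.lebesgue_number[OF cpt this op] obtain \<delta>
    where \<delta>: "\<delta> > 0" "\<forall>x\<in>I \<rightarrow>\<^sub>E A. \<exists>U\<in>\<C>. m.mball x \<delta> \<subseteq> U" by blast
  have "\<forall>k\<in>K. x k = y k" if xy: "x \<in> I \<rightarrow>\<^sub>E A" "y \<in> I \<rightarrow>\<^sub>E A" "mdist m x y < \<delta>" for x y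
  proof -
    obtain U where U: "U \<in> \<C>" "m.mball x \<delta> \<subseteq> U" using \<delta>(2) xy(1) by blast
    have "x \<in> m.mball x \<delta>" "y \<in> m.mball x \<delta>"
      using xy \<delta>(1) unfolding ms[symmetric] by auto
    then have "x \<in> U" "y \<in> U" using U(2) by blast+
    then show ?thesis using U(1) unfolding \<C>_def by auto
  qed
  then show ?thesis using \<delta>(1) by (intro exI[of _ \<delta>]) simp
qed


section \<open>The Cantor space\<close>

definition agree :: "nat \<Rightarrow> cantor \<Rightarrow> cantor \<Rightarrow> bool" where
  "agree n x y \<longleftrightarrow> (\<forall>k<n. x k = y k)"

lemma agree_refl [simp]: "agree n x x"
  by (simp add: agree_def)

lemma agree_sym: "agree n x y \<Longrightarrow> agree n y x"
  by (simp add: agree_def)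

lemma agree_trans: "agree n x y \<Longrightarrow> agree n y z \<Longrightarrow> agree n x z"
  by (simp add: agree_def)

lemma agree_mono: "agree n x y \<Longrightarrow> m \<le> n \<Longrightarrow> agree m x y"
  by (simp add: agree_def)

lemma eq_if_agree: "(\<And>n. agree n x y) \<Longrightarrow> x = y"
  unfolding agree_def by (rule ext) (meson lessI)

lemma topspace_cantor_space [simp]: "topspace cantor_space = UNIV"
  by (simp add: cantor_space_def PiE_UNIV_domain)

lemma compact_space_cantor: "compact_space cantor_space"
  unfolding cantor_space_def by (rule compact_space_discrete_power) simp

lemma Hausdorff_space_cantor: "Hausdorff_space cantor_space"
  unfolding cantor_space_def by (rule Hausdorff_space_discrete_power)

lemma finite_nat_subset_lessThan: "finite (K :: nat set) \<Longrightarrow> \<exists>n. \<forall>k\<in>K. k < n"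
  by (meson finite_nat_set_iff_bounded)

lemma openin_cantor_iff:
  "openin cantor_space U \<longleftrightarrow> (\<forall>x\<in>U. \<exists>n. \<forall>y. agree n x y \<longrightarrow> y \<in> U)"
proof -
  have "(\<exists>K. finite K \<and> (\<forall>y. (\<forall>k\<in>K. y k = x k) \<longrightarrow> y \<in> U)) \<longleftrightarrow>
        (\<exists>n. \<forall>y. agree n x y \<longrightarrow> y \<in> U)" for x :: cantor
  proof
    assume "\<exists>K. finite K \<and> (\<forall>y. (\<forall>k\<in>K. y k = x k) \<longrightarrow> y \<in> U)"
    then obtain K where K: "finite K" "\<And>y. \<forall>k\<in>K. y k = x k \<Longrightarrow> y \<in> U"
      by blast
    obtain n where n: "\<forall>k\<in>K. k < n"
      using finite_nat_subset_lessThan[OF K(1)] by blast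
    have "y \<in> U" if "agree n x y" for y
      by (rule K(2)) (use that n in \<open>simp add: agree_def\<close>)
    then show "\<exists>n. \<forall>y. agree n x y \<longrightarrow> y \<in> U" by blast
  next
    assume "\<exists>n. \<forall>y. agree n x y \<longrightarrow> y \<in> U"
    then obtain n where "\<forall>y. agree n x y \<longrightarrow> y \<in> U" by blast
    then show "\<exists>K. finite K \<and> (\<forall>y. (\<forall>k\<in>K. y k = x k) \<longrightarrow> y \<in> U)"
      by (intro exI[of _ "{..<n}"]) (simp add: agree_def)
  qed
  then show ?thesis
    unfolding cantor_space_def openin_discrete_power_iff by (simp add: PiE_UNIV_domain)
qed

lemma closedin_cantor_iff:
  "closedin cantor_space E \<longleftrightarrow> (\<forall>x. (\<forall>n. \<exists>y\<in>E. agree n x y) \<longrightarrow> x \<in> E)"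
proof -
  have "closedin cantor_space E \<longleftrightarrow> openin cantor_space (- E)"
    by (simp add: closedin_def Compl_eq_Diff_UNIV)
  also have "\<dots> \<longleftrightarrow> (\<forall>x. (\<forall>n. \<exists>y\<in>E. agree n x y) \<longrightarrow> x \<in> E)"
    unfolding openin_cantor_iff by (simp add: Ball_def Bex_def) metis
  finally show ?thesis .
qed

text \<open>By compactness a map from the Cantor space to a discrete space is continuous iff it depends on
  an initial segment of bits only. Such maps, called labellings here, play the role of finite
  clopen partitions.\<close>

definition labelling :: "(cantor \<Rightarrow> 'v) \<Rightarrow> bool" where
  "labelling p \<longleftrightarrow> (\<exists>n. \<forall>x y. agree n x y \<longrightarrow> p x = p y)"

lemma continuous_map_discrete_iff_labelling:
  "continuous_map cantor_space (discrete_topology UNIV) p \<longleftrightarrow> labelling p"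
proof
  assume cont: "continuous_map cantor_space (discrete_topology UNIV) p"
  define \<C> where "\<C> = range (\<lambda>v. {x. p x = v})"
  have op: "openin (product_topology (\<lambda>_. discrete_topology UNIV) UNIV) U" if U: "U \<in> \<C>" for U
  proof -
    obtain v where v: "U = {x. p x = v}"
      using U unfolding \<C>_def by blast
    show ?thesis
      using openin_continuous_map_preimage[OF cont, of "{v}"] v by (simp add: cantor_space_def)
  qed
  have cov: "UNIV \<rightarrow>\<^sub>E UNIV \<subseteq> \<Union>\<C>"
    unfolding \<C>_def by blast
  have "\<exists>K. finite K \<and> K \<subseteq> (UNIV :: nat set) \<and>
      (\<forall>x\<in>UNIV \<rightarrow>\<^sub>E UNIV. \<exists>U\<in>\<C>. \<forall>y\<in>UNIV \<rightarrow>\<^sub>E UNIV. (\<forall>k\<in>K. y k = x k) \<longrightarrow> y \<in> U)"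
    by (rule cylinder_refines_open_cover[OF finite_class.finite_UNIV op cov])
  then obtain K :: "nat set" where K: "finite K"
      "\<forall>x\<in>UNIV \<rightarrow>\<^sub>E UNIV. \<exists>U\<in>\<C>. \<forall>y\<in>UNIV \<rightarrow>\<^sub>E UNIV. (\<forall>k\<in>K. y k = x k) \<longrightarrow> y \<in> U"
    by (elim exE conjE)
  obtain n where n: "\<forall>k\<in>K. k < n"
    using finite_nat_subset_lessThan[OF K(1)] by blast
  have "p x = p y" if "agree n x y" for x y
  proof -
    obtain U where U: "U \<in> \<C>" "\<And>y. (\<forall>k\<in>K. y k = x k) \<Longrightarrow> y \<in> U"
      using K(2) by (auto simp: PiE_UNIV_domain)
    have "x \<in> U" "y \<in> U"
      using that n by (auto intro!: U(2) simp: agree_def)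
    then show ?thesis using U(1) by (auto simp: \<C>_def)
  qed
  then show "labelling p"
    unfolding labelling_def by blast
next
  assume "labelling p"
  then obtain n where n: "\<And>x y. agree n x y \<Longrightarrow> p x = p y"
    unfolding labelling_def by blast
  have "openin cantor_space {x. p x \<in> U}" for U
    unfolding openin_cantor_iff using n by fastforce
  then show "continuous_map cantor_space (discrete_topology UNIV) p"
    by (simp add: continuous_map)
qed

lemma continuous_map_into_cantor_iff:
  "continuous_map X cantor_space f \<longleftrightarrow>
     (\<forall>k. continuous_map X (discrete_topology UNIV) (\<lambda>x. f x k))"
  unfolding cantor_space_def by (rule continuous_map_componentwise_UNIV)

lemma labelling_compose:
  assumes "continuous_map cantor_space cantor_space f" "labelling p"
  shows "labelling (p \<circ> f)"
  using assms continuous_map_compose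
  unfolding continuous_map_discrete_iff_labelling[symmetric] by blast

lemma labelling_map: "labelling p \<Longrightarrow> labelling (\<lambda>x. h (p x))"
  unfolding labelling_def by metis

lemma labelling_Pair:
  assumes "labelling p" "labelling q"
  shows "labelling (\<lambda>x. (p x, q x))"
proof -
  obtain m n where "\<And>x y. agree m x y \<Longrightarrow> p x = p y" "\<And>x y. agree n x y \<Longrightarrow> q x = q y"
    using assms unfolding labelling_def by blast
  then have "(p x, q x) = (p y, q y)" if "agree (max m n) x y" for x y
    using agree_mono[OF that, of m] agree_mono[OF that, of n] by simp
  then show ?thesis
    unfolding labelling_def by blast
qed

lemma labelling_restrict:
  assumes "finite K" "\<And>k. k \<in> K \<Longrightarrow> labelling (\<lambda>x. c x k)"
  shows "labelling (\<lambda>x. restrict (c x) K)"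
  using assms
proof (induction K)
  case empty
  then show ?case by (simp add: labelling_def)
next
  case (insert k K)
  have "labelling (\<lambda>x. (restrict (c x) K, c x k))"
    using insert by (intro labelling_Pair) (auto simp del: restrict_apply)
  then have "labelling (\<lambda>x. (\<lambda>(r, v). r(k := v)) (restrict (c x) K, c x k))"
    by (rule labelling_map)
  moreover have "(\<lambda>x. (\<lambda>(r, v). r(k := v)) (restrict (c x) K, c x k)) = (\<lambda>x. restrict (c x) (insert k K))"
    by (auto simp: fun_eq_iff)
  ultimately show ?case by (simp only:)
qed

text \<open>The word of the first \<open>n\<close> bits, as a number, so that it can be used as a label like any other.\<close>

definition prefix :: "nat \<Rightarrow> cantor \<Rightarrow> nat" where
  "prefix n x = to_nat (map x [0..<n])"

lemma prefix_eq_iff: "prefix n x = prefix n y \<longleftrightarrow> agree n x y"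
  by (auto simp: prefix_def agree_def)

lemma labelling_prefix: "labelling (prefix n)"
  unfolding labelling_def using prefix_eq_iff by blast

lemma finite_range_labelling:
  assumes "labelling p"
  shows "finite (range p)"
proof -
  have "compactin (discrete_topology UNIV) (p ` UNIV)"
    using assms image_compactin[of cantor_space UNIV] compact_space_cantor
    unfolding continuous_map_discrete_iff_labelling[symmetric] compact_space_def
    by simp
  then show ?thesis by (simp add: compactin_discrete_topology)
qed

text \<open>A labelling that depends on \<open>n\<close> bits is a finite table indexed by the words of length \<open>n\<close>, and
  there are only countably many finite tables. All applications of Baire category rest on this.\<close>

lemma countable_labelling: "countable {p :: cantor \<Rightarrow> nat. labelling p}"
proof -
  define decode where "decode = (\<lambda>(n :: nat, t) (x :: cantor). the (map_of t (map x [0..<n])) :: nat)"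
  have "p \<in> range decode" if fd: "labelling p" for p
  proof -
    obtain n where n: "\<And>x y. agree n x y \<Longrightarrow> p x = p y"
      using fd unfolding labelling_def by blast
    define f where "f = (\<lambda>w. p (\<lambda>k. if k < n then w ! k else False))"
    have fin: "finite {w :: bool list. length w = n}"
      using finite_lists_length_eq[of "UNIV :: bool set" n] by simp
    obtain ws where ws: "set ws = {w :: bool list. length w = n}"
      using finite_list[OF fin] by blast
    have "p x = decode (n, map (\<lambda>w. (w, f w)) ws) x" for x
    proof -
      have "map x [0..<n] \<in> set ws" by (simp add: ws)
      then have "map_of (map (\<lambda>w. (w, f w)) ws) (map x [0..<n]) = Some (f (map x [0..<n]))"
        by (simp add: map_of_map_restrict)
      moreover have "f (map x [0..<n]) = p x"
        unfolding f_def by (rule n) (simp add: agree_def)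
      ultimately show ?thesis by (simp add: decode_def)
    qed
    then show ?thesis by blast
  qed
  then have "{p. labelling p} \<subseteq> range decode" by blast
  then show ?thesis by (rule countable_subset) simp
qed


section \<open>Perfect subsets of the Cantor space\<close>

lemma card_below_enumerate:
  fixes S :: "nat set"
  assumes "infinite S"
  shows "card {k \<in> S. k < enumerate S i} = i"
proof -
  have "{k \<in> S. k < enumerate S i} = enumerate S ` {..<i}"
  proof (intro equalityI subsetI)
    fix k assume "k \<in> {k \<in> S. k < enumerate S i}"
    then obtain l where "enumerate S l = k" "enumerate S l < enumerate S i"
      using enumerate_Ex[OF assms, of k] by auto
    then show "k \<in> enumerate S ` {..<i}"
      using enumerate_mono_iff[OF assms] by blast
  qed (use assms in \<open>auto simp: enumerate_in_set\<close>)
  then show ?thesis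
    using inj_enumerate[OF assms] by (simp add: card_image inj_on_subset)
qed

lemma enumerate_eqI:
  fixes S :: "nat set"
  assumes "infinite S" "m \<in> S" "card {k \<in> S. k < m} = i"
  shows "enumerate S i = m"
  using enumerate_Ex[OF assms(1,2)] card_below_enumerate[OF assms(1)] assms(3) by metis

lemma enumerate_cong_below:
  fixes S T :: "nat set"
  assumes "infinite S" "infinite T" and eq: "\<And>k. k \<le> n \<Longrightarrow> k \<in> S \<longleftrightarrow> k \<in> T"
    and le: "enumerate S i \<le> n"
  shows "enumerate T i = enumerate S i"
proof (rule enumerate_eqI[OF assms(2)])
  show "enumerate S i \<in> T"
    using eq[OF le] enumerate_in_set[OF assms(1)] by simp
  have "{k \<in> T. k < enumerate S i} = {k \<in> S. k < enumerate S i}"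
    using eq le by auto
  then show "card {k \<in> T. k < enumerate S i} = i"
    using card_below_enumerate[OF assms(1)] by simp
qed

text \<open>The positions at which the bits before them do not determine the bit, among the points of \<open>E\<close>.\<close>

definition branching :: "cantor set \<Rightarrow> cantor \<Rightarrow> nat set" where
  "branching E x = {n. \<exists>y\<in>E. agree n x y \<and> y n \<noteq> x n}"

text \<open>Only the bits at branching positions are kept. All others are forced by the bits before them, so
  no information is lost, and at a branching position both values occur, so every sequence of bits
  is reached. Hence this map identifies \<open>E\<close> with the whole Cantor space.\<close>

definition branching_bits :: "cantor set \<Rightarrow> cantor \<Rightarrow> cantor" where
  "branching_bits E x = (\<lambda>k. x (enumerate (branching E x) k))"

lemma first_difference:
  fixes x y :: cantor
  assumes "x \<noteq> y"
  obtains m where "agree m x y" "x m \<noteq> y m"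
proof -
  obtain l where "x l \<noteq> y l" using assms by blast
  then show ?thesis
    using that[of "LEAST l. x l \<noteq> y l"] LeastI[of "\<lambda>l. x l \<noteq> y l" l]
      not_less_Least[of _ "\<lambda>l. x l \<noteq> y l"]
    unfolding agree_def by blast
qed

locale perfect_subset =
  fixes E :: "cantor set"
  assumes closed: "closedin cantor_space E"
    and ne: "E \<noteq> {}"
    and perfect: "\<And>x n. x \<in> E \<Longrightarrow> \<exists>y\<in>E. y \<noteq> x \<and> agree n x y"
begin

lemma infinite_branching:
  assumes "x \<in> E"
  shows "infinite (branching E x)"
  unfolding infinite_nat_iff_unbounded_le
proof
  fix n
  obtain y where y: "y \<in> E" "y \<noteq> x" "agree n x y"
    using perfect[OF assms] by blast
  obtain m where m: "agree m x y" "x m \<noteq> y m"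
    using y(2) by (metis first_difference)
  have "n \<le> m"
    using y(3) m(2) unfolding agree_def by (metis not_less)
  moreover have "m \<in> branching E x"
    using y(1) m unfolding branching_def by auto
  ultimately show "\<exists>m\<ge>n. m \<in> branching E x" by blast
qed

text \<open>At \<open>n\<close> itself the two points may differ, but then each of them shows that \<open>n\<close> is branching for the
  other. This boundary case makes \<^const>\<open>branching_bits\<close> injective.\<close>

lemma branching_cong:
  assumes "x \<in> E" "y \<in> E" "agree n x y" "k \<le> n"
  shows "k \<in> branching E x \<longleftrightarrow> k \<in> branching E y"
proof -
  have "k \<in> branching E v" if uv: "u \<in> E" "agree n u v" and k: "k \<in> branching E u" for u v
  proof -
    obtain z where z: "z \<in> E" "agree k u z" "z k \<noteq> u k"
      using k unfolding branching_def by blast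
    have vu: "agree k v u"
      using uv(2) assms(4) by (meson agree_mono agree_sym)
    show ?thesis
    proof (cases "v k = u k")
      case True
      then have "agree k v z" "z k \<noteq> v k"
        using z(3) agree_trans[OF vu z(2)] by simp_all
      then show ?thesis
        using z(1) unfolding branching_def by blast
    next
      case False
      then show ?thesis
        using uv(1) vu unfolding branching_def by auto
    qed
  qed
  from this[OF assms(1,3)] this[OF assms(2) agree_sym[OF assms(3)]] show ?thesis
    by (rule iffI)
qed

lemma enumerate_branching_cong:
  assumes "x \<in> E" "y \<in> E" "agree n x y" "enumerate (branching E x) i \<le> n"
  shows "enumerate (branching E y) i = enumerate (branching E x) i"
  by (rule enumerate_cong_below[OF infinite_branching[OF assms(1)] infinite_branching[OF assms(2)]
        branching_cong[OF assms(1-3)] assms(4)])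

lemma continuous_map_branching_bits:
  "continuous_map (subtopology cantor_space E) cantor_space (branching_bits E)"
  unfolding continuous_map_into_cantor_iff
proof
  fix k
  define f where "f = (\<lambda>x. branching_bits E x k)"
  have "openin (subtopology cantor_space E) {x \<in> E. f x \<in> U}" for U
  proof -
    define W where "W = {z. \<exists>x\<in>E. f x \<in> U \<and> agree (Suc (enumerate (branching E x) k)) x z}"
    have "openin cantor_space W"
      unfolding openin_cantor_iff W_def using agree_trans by blast
    moreover have "f z \<in> U" if "z \<in> E" "z \<in> W" for z
    proof -
      obtain x where x: "x \<in> E" "f x \<in> U" "agree (Suc (enumerate (branching E x) k)) x z"
        using \<open>z \<in> W\<close> unfolding W_def by blast
      have "enumerate (branching E z) k = enumerate (branching E x) k"
        using enumerate_branching_cong[OF x(1) that(1) x(3)] by simp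
      then have "f z = f x"
        using x(3) by (simp add: f_def branching_bits_def agree_def)
      then show ?thesis using x(2) by simp
    qed
    then have "{x \<in> E. f x \<in> U} = W \<inter> E"
      unfolding W_def by force
    ultimately show ?thesis
      by (auto simp: openin_subtopology)
  qed
  then show "continuous_map (subtopology cantor_space E) (discrete_topology UNIV)
               (\<lambda>x. branching_bits E x k)"
    unfolding f_def[symmetric] by (simp add: continuous_map vimage_def Int_def conj_commute)
qed

lemma inj_on_branching_bits: "inj_on (branching_bits E) E"
proof (rule inj_onI, rule ccontr)
  fix x y assume xy: "x \<in> E" "y \<in> E" "branching_bits E x = branching_bits E y" "x \<noteq> y"
  obtain m where m: "agree m x y" "x m \<noteq> y m"
    using xy(4) by (metis first_difference)
  have "m \<in> branching E x"
    using xy(2) m unfolding branching_def by auto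
  then obtain i where i: "enumerate (branching E x) i = m"
    using enumerate_Ex[OF infinite_branching[OF xy(1)]] by blast
  then have "enumerate (branching E y) i = m"
    using enumerate_branching_cong[OF xy(1,2) m(1), of i] by simp
  then have "branching_bits E x i \<noteq> branching_bits E y i"
    using i m(2) by (simp add: branching_bits_def)
  then show False using xy(3) by simp
qed

text \<open>If the next bit that is read off has the wrong value, a witness of branching at that position
  has the right one and still has the same earlier branching positions.\<close>

lemma branching_bits_dense: "\<exists>x\<in>E. agree n (branching_bits E x) c"
proof (induction n)
  case 0
  then show ?case using ne by (auto simp: agree_def)
next
  case (Suc n)
  then obtain x where x: "x \<in> E" "agree n (branching_bits E x) c" by blast
  define m where "m = enumerate (branching E x) n"
  show ?case
  proof (cases "x m = c n")
    case True
    then have "agree (Suc n) (branching_bits E x) c"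
      using x(2) by (auto simp: agree_def branching_bits_def m_def less_Suc_eq)
    then show ?thesis using x(1) by blast
  next
    case False
    have "m \<in> branching E x"
      unfolding m_def using enumerate_in_set[OF infinite_branching[OF x(1)]] .
    then obtain y where y: "y \<in> E" "agree m x y" "y m \<noteq> x m"
      unfolding branching_def by blast
    have eq: "enumerate (branching E y) i = enumerate (branching E x) i" if "i \<le> n" for i
    proof (rule enumerate_branching_cong[OF x(1) y(1,2)])
      show "enumerate (branching E x) i \<le> m"
        unfolding m_def using that enumerate_mono_le_iff[OF infinite_branching[OF x(1)]] by blast
    qed
    have "branching_bits E y i = c i" if "i < Suc n" for i
    proof (cases "i = n")
      case True
      then show ?thesis
        using eq[of n] y(3) False unfolding branching_bits_def by (auto simp: m_def)
    next
      case i: False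
      then have "enumerate (branching E x) i < m"
        unfolding m_def using that enumerate_mono_iff[OF infinite_branching[OF x(1)]] by simp
      then have "y (enumerate (branching E x) i) = x (enumerate (branching E x) i)"
        using y(2) by (simp add: agree_def)
      then show ?thesis
        using eq[of i] x(2) i that by (simp add: branching_bits_def agree_def)
    qed
    then show ?thesis using y(1) unfolding agree_def by blast
  qed
qed

lemma homeomorphic_space_cantor: "subtopology cantor_space E homeomorphic_space cantor_space"
proof -
  have cpt: "compact_space (subtopology cantor_space E)"
    using closedin_compact_space[OF compact_space_cantor closed] compact_space_subtopology by blast
  have "compactin cantor_space (branching_bits E ` E)"
    using image_compactin[OF _ continuous_map_branching_bits] cpt closedin_subset[OF closed]
    by (metis compact_space_def inf.absorb_iff2 topspace_subtopology)
  then have "closedin cantor_space (branching_bits E ` E)"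
    using Hausdorff_space_cantor compactin_imp_closedin by blast
  moreover have "\<exists>y\<in>branching_bits E ` E. agree n c y" for n c
    using branching_bits_dense[of n c] agree_sym by blast
  ultimately have "branching_bits E ` E = UNIV"
    unfolding closedin_cantor_iff by blast
  then have "homeomorphic_map (subtopology cantor_space E) cantor_space (branching_bits E)"
    using continuous_map_branching_bits cpt Hausdorff_space_cantor inj_on_branching_bits
    by (intro continuous_imp_homeomorphic_map) auto
  then show ?thesis
    by (rule homeomorphic_map_imp_homeomorphic_space)
qed

end

text \<open>Flipping a bit that the labelling does not see stays inside the piece, so the piece is perfect.\<close>

lemma clopen_piece_homeomorphic_cantor:
  assumes "labelling u" "w \<in> range u"
  shows "subtopology cantor_space {x. u x = w} homeomorphic_space cantor_space"
proof -
  obtain N where N: "\<And>x y. agree N x y \<Longrightarrow> u x = u y"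
    using assms(1) unfolding labelling_def by blast
  have "perfect_subset {x. u x = w}"
  proof
    have "closedin cantor_space {x \<in> topspace cantor_space. u x \<in> {w}}"
      using assms(1) unfolding continuous_map_discrete_iff_labelling[symmetric]
      by (rule closedin_continuous_map_preimage) simp
    then show "closedin cantor_space {x. u x = w}" by simp
    show "{x. u x = w} \<noteq> {}" using assms(2) by auto
    fix x n assume x: "x \<in> {x. u x = w}"
    define y where "y = x(max n N := \<not> x (max n N))"
    have "agree (max n N) x y" by (simp add: y_def agree_def)
    then have "agree n x y" "u y = u x"
      using agree_mono[of "max n N" x y] N[of x y] by simp_all
    moreover have "y \<noteq> x" by (auto simp: y_def fun_eq_iff)
    ultimately show "\<exists>y\<in>{x. u x = w}. y \<noteq> x \<and> agree n x y"
      using x by auto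
  qed
  then show ?thesis by (rule perfect_subset.homeomorphic_space_cantor)
qed

text \<open>Each nonempty piece \<open>{x. u x = w}\<close> and \<open>{x. v x = w}\<close> is itself a Cantor space, so corresponding
  pieces are homeomorphic, and finitely many clopen pieces can be glued. This homogeneity of the
  Cantor space lets an abstract model of an action be moved next to a given action.\<close>

lemma homeomorphism_matching_labels:
  assumes u: "labelling u" and v: "labelling v" and "range u = range v"
  shows "\<exists>\<phi>. homeomorphic_map cantor_space cantor_space \<phi> \<and> v \<circ> \<phi> = u"
proof -
  define U where "U = (\<lambda>w. {x. u x = w})"
  define V where "V = (\<lambda>w. {x. v x = w})"
  have "\<exists>h. homeomorphic_map (subtopology cantor_space (U w)) (subtopology cantor_space (V w)) h"
    if "w \<in> range u" for w
    using clopen_piece_homeomorphic_cantor[OF u that] clopen_piece_homeomorphic_cantor[OF v, of w]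
      that assms(3) homeomorphic_space_trans homeomorphic_space_sym
    unfolding U_def V_def by (metis homeomorphic_space)
  then obtain h where h: "\<And>w. w \<in> range u \<Longrightarrow>
      homeomorphic_map (subtopology cantor_space (U w)) (subtopology cantor_space (V w)) (h w)"
    by metis
  have hb: "bij_betw (h w) (U w) (V w)" if "w \<in> range u" for w
    using homeomorphic_imp_injective_map[OF h[OF that]] homeomorphic_imp_surjective_map[OF h[OF that]]
    by (simp add: bij_betw_def)
  define \<phi> where "\<phi> = (\<lambda>x. h (u x) x)"
  have v\<phi>: "v (\<phi> x) = u x" for x
    using hb[of "u x"] unfolding bij_betw_def U_def V_def \<phi>_def by blast
  have "continuous_map cantor_space cantor_space \<phi>"
    unfolding continuous_map
  proof (intro conjI allI impI)
    fix W assume W: "openin cantor_space W"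
    have "openin cantor_space {x \<in> U w. h w x \<in> W}" if "w \<in> range u" for w
    proof -
      have "openin (subtopology cantor_space (U w)) {x \<in> U w. h w x \<in> W \<inter> V w}"
        using openin_continuous_map_preimage[OF homeomorphic_imp_continuous_map[OF h[OF that]],
            of "W \<inter> V w"] W
        by (simp add: openin_subtopology_Int)
      moreover have "openin cantor_space (U w)"
      proof -
        have "openin cantor_space {x \<in> topspace cantor_space. u x \<in> {w}}"
          using u unfolding continuous_map_discrete_iff_labelling[symmetric]
          by (rule openin_continuous_map_preimage) simp
        then show ?thesis by (simp add: U_def)
      qed
      moreover have "{x \<in> U w. h w x \<in> W \<inter> V w} = {x \<in> U w. h w x \<in> W}"
        using hb[OF that] unfolding bij_betw_def by blast
      ultimately show ?thesis
        by (metis (no_types, lifting) openin_trans_full)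
    qed
    then have "openin cantor_space (\<Union>w\<in>range u. {x \<in> U w. h w x \<in> W})"
      by blast
    moreover have "{x \<in> topspace cantor_space. \<phi> x \<in> W} = (\<Union>w\<in>range u. {x \<in> U w. h w x \<in> W})"
      by (auto simp: U_def \<phi>_def)
    ultimately show "openin cantor_space {x \<in> topspace cantor_space. \<phi> x \<in> W}" by simp
  qed simp
  moreover have "inj \<phi>"
  proof (rule injI)
    fix x y assume eq: "\<phi> x = \<phi> y"
    then have "u x = u y" by (metis v\<phi>)
    moreover from this have "h (u x) x = h (u x) y" using eq by (simp add: \<phi>_def)
    ultimately show "x = y"
      using hb[of "u x"] unfolding bij_betw_def inj_on_def U_def by auto
  qed
  moreover have "surj \<phi>"
    unfolding surj_def
  proof
    fix y
    have "v y \<in> range u" using assms(3) by simp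
    then have "y \<in> h (v y) ` U (v y)"
      using hb[of "v y"] unfolding bij_betw_def V_def by simp
    then obtain x where "u x = v y" "y = h (v y) x" unfolding U_def by blast
    then have "y = \<phi> x" by (simp add: \<phi>_def)
    then show "\<exists>x. y = \<phi> x" by blast
  qed
  ultimately have "homeomorphic_map cantor_space cantor_space \<phi>"
    using compact_space_cantor Hausdorff_space_cantor
    by (intro continuous_imp_homeomorphic_map) auto
  then show ?thesis using v\<phi> by (intro exI[of _ \<phi>]) auto
qed

text \<open>The bits of \<open>e t\<close> and of \<open>c\<close> are interleaved. The image is perfect because the bits of \<open>c\<close> at the
  odd positions are free.\<close>

lemma prod_cantor_homeomorphic_cantor:
  assumes "compact_space T" "topspace T \<noteq> {}"
    and e: "continuous_map T cantor_space e" "inj_on e (topspace T)"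
  shows "prod_topology T cantor_space homeomorphic_space cantor_space"
proof -
  define f where "f = (\<lambda>(t, c) n. if even n then e t (n div 2) else c (n div 2))"
  define E where "E = f ` (topspace T \<times> UNIV)"
  have cont: "continuous_map (prod_topology T cantor_space) cantor_space f"
    unfolding continuous_map_into_cantor_iff
  proof
    fix n
    have 1: "continuous_map (prod_topology T cantor_space) (discrete_topology UNIV) (\<lambda>x. e (fst x) (n div 2))"
      using continuous_map_compose[OF continuous_map_fst e(1), of cantor_space]
      unfolding continuous_map_into_cantor_iff by (simp add: o_def)
    have 2: "continuous_map (prod_topology T cantor_space) (discrete_topology UNIV) (\<lambda>x. snd x (n div 2))"
      using continuous_map_snd[of T cantor_space] unfolding continuous_map_into_cantor_iff by simp
    show "continuous_map (prod_topology T cantor_space) (discrete_topology UNIV) (\<lambda>x. f x n)"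
      using 1 2 by (cases "even n") (simp_all add: f_def case_prod_beta')
  qed
  have inj: "inj_on f (topspace T \<times> UNIV)"
  proof (rule inj_onI)
    fix a b assume ab: "a \<in> topspace T \<times> UNIV" "b \<in> topspace T \<times> UNIV" "f a = f b"
    have "e (fst a) k = e (fst b) k" "snd a k = snd b k" for k
      using fun_cong[OF ab(3), of "2 * k"] fun_cong[OF ab(3), of "2 * k + 1"]
      by (simp_all add: f_def case_prod_beta')
    then have eq: "e (fst a) = e (fst b)" "snd a = snd b" by blast+
    have "fst a = fst b"
      using inj_onD[OF e(2) eq(1)] ab(1,2) by (simp add: mem_Times_iff)
    then show "a = b"
      using eq(2) by (rule prod_eqI)
  qed
  have cpt: "compact_space (prod_topology T cantor_space)"
    using assms(1) compact_space_cantor by (simp add: compact_space_prod_topology)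
  have "compactin cantor_space E"
    using image_compactin[OF _ cont] cpt unfolding compact_space_def E_def by simp
  then have closed: "closedin cantor_space E"
    using Hausdorff_space_cantor compactin_imp_closedin by blast
  interpret perfect_subset E
  proof
    show "E \<noteq> {}" using assms(2) by (simp add: E_def)
    fix x n assume "x \<in> E"
    then obtain t c where tc: "t \<in> topspace T" "x = f (t, c)" unfolding E_def by blast
    define y where "y = f (t, c(n := \<not> c n))"
    have "agree n x y" by (auto simp: y_def tc(2) f_def agree_def)
    moreover have "y (2 * n + 1) \<noteq> x (2 * n + 1)" by (simp add: y_def tc(2) f_def)
    then have "y \<noteq> x" by blast
    moreover have "y \<in> E" using tc(1) by (simp add: y_def E_def)
    ultimately show "\<exists>y\<in>E. y \<noteq> x \<and> agree n x y" by blast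
  qed (rule closed)
  have "homeomorphic_map (prod_topology T cantor_space) (subtopology cantor_space E) f"
  proof (rule continuous_imp_homeomorphic_map)
    show "continuous_map (prod_topology T cantor_space) (subtopology cantor_space E) f"
      using cont by (simp add: continuous_map_in_subtopology E_def image_subset_iff_funcset)
    show "Hausdorff_space (subtopology cantor_space E)"
      using Hausdorff_space_cantor by (rule Hausdorff_space_subtopology)
  qed (use cpt inj in \<open>auto simp: E_def\<close>)
  then show ?thesis
    using homeomorphic_space_cantor homeomorphic_space_trans homeomorphic_map_imp_homeomorphic_space
    by blast
qed


section \<open>The space of actions\<close>

lemma cantor_dist_le_iff_agree: "cantor_dist x y \<le> (1/2) ^ n \<longleftrightarrow> agree n x y"
  unfolding agree_def by (rule cantor_dist_le_iff)

lemma mspace_cantor_metric [simp]: "mspace cantor_metric = UNIV"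
  and mdist_cantor_metric [simp]: "mdist cantor_metric = cantor_dist"
  unfolding cantor_metric_def
  using Metric_space.mspace_metric[OF Metric_space_cantor_dist]
    Metric_space.mdist_metric[OF Metric_space_cantor_dist] by blast+

abbreviation cantor_maps :: "(cantor \<Rightarrow> cantor) metric" where
  "cantor_maps \<equiv> cfunspace cantor_space cantor_metric"

lemma mem_cantor_maps: "f \<in> mspace cantor_maps \<longleftrightarrow> continuous_map cantor_space cantor_space f"
proof -
  have "Metric_space.mbounded UNIV cantor_dist S" for S
    unfolding Metric_space.mbounded_def[OF Metric_space_cantor_dist]
      Metric_space.mcball_def[OF Metric_space_cantor_dist]
    using cantor_dist_le_iff_agree[of _ _ 0] by (auto simp: agree_def intro!: exI[of _ 1])
  then show ?thesis
    by (simp add: mtopology_of_cantor_metric)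
qed

lemma mcomplete_cantor: "Metric_space.mcomplete UNIV cantor_dist"
  using Metric_space.compact_space_imp_mcomplete[OF Metric_space_cantor_dist]
    compact_space_cantor mtopology_of_cantor_metric
  by (simp add: mtopology_of_def)

lemma completely_metrizable_cantor_maps: "completely_metrizable_space (mtopology_of cantor_maps)"
proof -
  have "mcomplete_of cantor_maps"
    using Metric_space.mcomplete_cfunspace[OF Metric_space_cantor_dist mcomplete_cantor, of cantor_space]
    by (simp add: cantor_metric_def Metric_space.Self_def[OF Metric_space_cantor_dist])
  then show ?thesis
    unfolding mtopology_of_def mcomplete_of_def
    using Metric_space.completely_metrizable_space_mtopology[OF Metric_space_mspace_mdist] by blast
qed

lemma openin_cantor_maps_agree:
  "openin (mtopology_of cantor_maps) {h \<in> mspace cantor_maps. \<forall>x. agree n (h x) (f x)}" (is "openin _ ?T")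
proof -
  interpret C: Metric_space "mspace cantor_maps" "mdist cantor_maps"
    by (rule Metric_space_mspace_mdist)
  have "C.mball h ((1/2) ^ n) \<subseteq> ?T" if h: "h \<in> ?T" for h
  proof
    fix k assume "k \<in> C.mball h ((1/2) ^ n)"
    then have k: "k \<in> mspace cantor_maps" "h \<in> mspace cantor_maps" "mdist cantor_maps h k \<le> (1/2) ^ n"
      unfolding C.in_mball by auto
    have "agree n (h x) (k x)" for x
      using mdist_cfunspace_imp_mdist_le[OF k(2,1,3), of x] by (simp add: cantor_dist_le_iff_agree)
    then show "k \<in> ?T"
      using k(1) h agree_trans agree_sym by blast
  qed
  then have "openin C.mtopology ?T"
    unfolding C.openin_mtopology
    by (intro conjI ballI allI impI exI[of _ "(1/2) ^ n"]) auto
  then show ?thesis by (simp only: mtopology_of_def)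
qed

lemma cantor_maps_agree_basis:
  assumes "openin (mtopology_of cantor_maps) U" "f \<in> U"
  shows "\<exists>n. \<forall>h\<in>mspace cantor_maps. (\<forall>x. agree n (h x) (f x)) \<longrightarrow> h \<in> U"
proof -
  interpret C: Metric_space "mspace cantor_maps" "mdist cantor_maps"
    by (rule Metric_space_mspace_mdist)
  obtain r where r: "r > 0" "C.mball f r \<subseteq> U" "U \<subseteq> mspace cantor_maps"
    using assms unfolding mtopology_of_def C.openin_mtopology by blast
  obtain n where n: "(1/2::real) ^ n < r"
    using real_arch_pow_inv[of r "1/2"] r by auto
  have "h \<in> U" if "h \<in> mspace cantor_maps" "\<forall>x. agree n (h x) (f x)" for h
  proof -
    have "mdist cantor_maps f h \<le> (1/2) ^ n"
    proof (rule mdist_cfunspace_le)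
      show "mdist cantor_metric (f x) (h x) \<le> (1/2) ^ n" for x
        using agree_sym that(2) by (simp add: cantor_dist_le_iff_agree)
    qed simp
    then have "h \<in> C.mball f r"
      unfolding C.in_mball using that(1) assms(2) r(3) n by auto
    then show ?thesis using r(2) by blast
  qed
  then show ?thesis by blast
qed

locale countable_group = group G for G :: "('g, 'b) monoid_scheme" (structure) +
  assumes countable_carrier: "countable (carrier G)"
begin

abbreviation Act :: "('g \<Rightarrow> cantor \<Rightarrow> cantor) topology" where
  "Act \<equiv> action_topology G"

lemma actions_iff:
  "\<alpha> \<in> actions G \<longleftrightarrow>
     \<alpha> \<in> extensional (carrier G) \<and>
     (\<forall>g\<in>carrier G. continuous_map cantor_space cantor_space (\<alpha> g)) \<and>
     (\<forall>x. \<alpha> \<one> x = x) \<and>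
     (\<forall>g\<in>carrier G. \<forall>h\<in>carrier G. \<forall>x. \<alpha> (g \<otimes> h) x = \<alpha> g (\<alpha> h x))"
  (is "?L \<longleftrightarrow> ?R")
proof
  assume L: ?L
  have hom: "homeomorphic_map cantor_space cantor_space (\<alpha> g)" if "g \<in> carrier G" for g
    using L that by (auto simp: actions_def hom_def homeo_group_def Pi_iff)
  have mult: "\<alpha> (g \<otimes> h) x = \<alpha> g (\<alpha> h x)" if "g \<in> carrier G" "h \<in> carrier G" for g h x
    using L that by (simp add: actions_def hom_def homeo_group_def)
  have "inj (\<alpha> \<one>)"
    using homeomorphic_imp_injective_map[OF hom[OF one_closed]] by simp
  then have "\<alpha> \<one> x = x" for x
    using mult[of \<one> \<one> x] by (simp add: inj_eq)
  then show ?R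
    using L hom mult by (simp add: actions_def homeomorphic_imp_continuous_map)
next
  assume R: ?R
  have "homeomorphic_maps cantor_space cantor_space (\<alpha> g) (\<alpha> (inv g))" if "g \<in> carrier G" for g
    using R that unfolding homeomorphic_maps_def by (metis inv_closed l_inv r_inv)
  then have "homeomorphic_map cantor_space cantor_space (\<alpha> g)" if "g \<in> carrier G" for g
    using that homeomorphic_maps_map by blast
  then show ?L
    using R by (auto simp: actions_def hom_def homeo_group_def)
qed

lemma action_continuous:
  "\<alpha> \<in> actions G \<Longrightarrow> g \<in> carrier G \<Longrightarrow> continuous_map cantor_space cantor_space (\<alpha> g)"
  and action_one: "\<alpha> \<in> actions G \<Longrightarrow> \<alpha> \<one> x = x"
  and action_mult:
  "\<alpha> \<in> actions G \<Longrightarrow> g \<in> carrier G \<Longrightarrow> h \<in> carrier G \<Longrightarrow> \<alpha> (g \<otimes> h) x = \<alpha> g (\<alpha> h x)"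
  by (auto simp: actions_iff)

abbreviation map_families :: "('g \<Rightarrow> cantor \<Rightarrow> cantor) topology" where
  "map_families \<equiv> product_topology (\<lambda>_. mtopology_of cantor_maps) (carrier G)"

lemma topspace_map_families:
  "topspace map_families = carrier G \<rightarrow>\<^sub>E {f. continuous_map cantor_space cantor_space f}"
  using mem_cantor_maps by (auto simp: PiE_iff)

lemma actions_subset_map_families: "actions G \<subseteq> topspace map_families"
  unfolding topspace_map_families by (auto simp: actions_iff PiE_iff extensional_def)

lemma action_topology_eq: "Act = subtopology map_families (actions G)"
proof -
  have "actions G \<subseteq> carrier G \<rightarrow>\<^sub>E carrier homeo_group"
    by (auto simp: actions_def hom_def PiE_iff extensional_def)
  then have "(carrier G \<rightarrow>\<^sub>E carrier homeo_group) \<inter> actions G = actions G"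
    by blast
  then show ?thesis
    unfolding action_topology_def homeo_topology_def
    by (simp add: subtopology_product_topology[symmetric] subtopology_subtopology)
qed

lemma topspace_action_topology [simp]: "topspace Act = actions G"
  unfolding action_topology_eq using actions_subset_map_families by auto

lemma openin_map_families_agree:
  assumes "finite K" "K \<subseteq> carrier G"
  shows "openin map_families {f \<in> topspace map_families. \<forall>k\<in>K. \<forall>x. agree n (f k x) (f\<^sub>0 k x)}"
    (is "openin _ ?T")
  unfolding openin_product_topology_alt
proof
  fix f assume f: "f \<in> ?T"
  define U where "U = (\<lambda>k. if k \<in> K then {h \<in> mspace cantor_maps. \<forall>x. agree n (h x) (f\<^sub>0 k x)}
                            else mspace cantor_maps)"
  have fm: "f k \<in> mspace cantor_maps" if "k \<in> carrier G" for k
    using f that unfolding topspace_product_topology topspace_mtopology_of by (auto simp: PiE_iff)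
  have "finite {i \<in> carrier G. U i \<noteq> topspace (mtopology_of cantor_maps)}"
    by (rule finite_subset[OF _ assms(1)]) (auto simp: U_def)
  moreover have "\<forall>i\<in>carrier G. openin (mtopology_of cantor_maps) (U i)"
    using openin_cantor_maps_agree openin_topspace[of "mtopology_of cantor_maps"]
    by (simp add: U_def del: mspace_cfunspace)
  moreover have "f \<in> Pi\<^sub>E (carrier G) U"
    using f fm by (auto simp: U_def PiE_iff simp del: mspace_cfunspace)
  moreover have "Pi\<^sub>E (carrier G) U \<subseteq> ?T"
  proof
    fix h assume h: "h \<in> Pi\<^sub>E (carrier G) U"
    have "h k \<in> mspace cantor_maps" if "k \<in> carrier G" for k
      using PiE_mem[OF h that] by (auto simp: U_def split: if_splits simp del: mspace_cfunspace)
    then have "h \<in> topspace map_families"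
      using h by (simp add: PiE_iff del: mspace_cfunspace)
    moreover have "\<forall>k\<in>K. \<forall>x. agree n (h k x) (f\<^sub>0 k x)"
    proof
      fix k assume "k \<in> K"
      then show "\<forall>x. agree n (h k x) (f\<^sub>0 k x)"
        using PiE_mem[OF h, of k] assms(2) by (auto simp: U_def simp del: mspace_cfunspace)
    qed
    ultimately show "h \<in> ?T" by simp
  qed
  ultimately show "\<exists>U. finite {i \<in> carrier G. U i \<noteq> topspace (mtopology_of cantor_maps)} \<and>
      (\<forall>i\<in>carrier G. openin (mtopology_of cantor_maps) (U i)) \<and>
      f \<in> Pi\<^sub>E (carrier G) U \<and> Pi\<^sub>E (carrier G) U \<subseteq> ?T"
    by (intro exI[of _ U] conjI)
qed

lemma map_families_agree_basis:
  assumes "openin map_families U" "f\<^sub>0 \<in> U"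
  shows "\<exists>K n. finite K \<and> K \<subseteq> carrier G \<and>
           (\<forall>f\<in>topspace map_families. (\<forall>k\<in>K. \<forall>x. agree n (f k x) (f\<^sub>0 k x)) \<longrightarrow> f \<in> U)"
proof -
  have "\<exists>V. finite {i \<in> carrier G. V i \<noteq> topspace (mtopology_of cantor_maps)} \<and>
      (\<forall>i\<in>carrier G. openin (mtopology_of cantor_maps) (V i)) \<and>
      f\<^sub>0 \<in> Pi\<^sub>E (carrier G) V \<and> Pi\<^sub>E (carrier G) V \<subseteq> U"
    using assms unfolding openin_product_topology_alt by (rule bspec)
  then obtain V where V: "finite {i \<in> carrier G. V i \<noteq> mspace cantor_maps}"
      "\<forall>i\<in>carrier G. openin (mtopology_of cantor_maps) (V i)"
      "f\<^sub>0 \<in> Pi\<^sub>E (carrier G) V" "Pi\<^sub>E (carrier G) V \<subseteq> U"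
    unfolding topspace_mtopology_of by (elim exE conjE)
  define K where "K = {i \<in> carrier G. V i \<noteq> mspace cantor_maps}"
  have "\<exists>n. \<forall>h\<in>mspace cantor_maps. (\<forall>x. agree n (h x) (f\<^sub>0 k x)) \<longrightarrow> h \<in> V k" if "k \<in> K" for k
    by (rule cantor_maps_agree_basis) (use V that in \<open>auto simp: K_def simp del: mspace_cfunspace\<close>)
  then obtain n where n: "\<And>k h. k \<in> K \<Longrightarrow> h \<in> mspace cantor_maps \<Longrightarrow>
      (\<forall>x. agree (n k) (h x) (f\<^sub>0 k x)) \<Longrightarrow> h \<in> V k"
    by metis
  \<comment> \<open>\<open>0\<close> keeps the maximum defined when \<open>K\<close> is empty.\<close>
  define N where "N = Max (insert 0 (n ` K))"
  have N: "n k \<le> N" if "k \<in> K" for k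
    using V(1) that unfolding N_def K_def[symmetric] by (intro Max_ge) auto
  have "f \<in> U" if f: "f \<in> topspace map_families" "\<forall>k\<in>K. \<forall>x. agree N (f k x) (f\<^sub>0 k x)" for f
  proof -
    have fm: "f k \<in> mspace cantor_maps" if "k \<in> carrier G" for k
      using f(1) that unfolding topspace_product_topology topspace_mtopology_of by (auto simp: PiE_iff)
    have "f \<in> Pi\<^sub>E (carrier G) V"
    proof (rule PiE_I)
      fix k assume k: "k \<in> carrier G"
      show "f k \<in> V k"
      proof (cases "k \<in> K")
        case True
        then show ?thesis
          using n[OF True fm[OF k]] f(2) agree_mono[OF _ N[OF True]] by blast
      next
        case False
        then show ?thesis using fm[OF k] k by (simp add: K_def del: mspace_cfunspace)
      qed
    next
      fix k assume "k \<notin> carrier G"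
      then show "f k = undefined"
        using f(1) by (auto simp: PiE_iff extensional_def)
    qed
    then show ?thesis using V(4) by blast
  qed
  moreover have "finite K" "K \<subseteq> carrier G"
    using V(1) by (auto simp: K_def)
  ultimately show ?thesis by blast
qed

lemma continuous_cantor_modulus:
  assumes "continuous_map cantor_space cantor_space f"
  shows "\<exists>m. \<forall>x y. agree m x y \<longrightarrow> agree n (f x) (f y)"
  using labelling_compose[OF assms labelling_prefix[of n]]
  by (simp add: labelling_def prefix_eq_iff)

text \<open>Being an action is a family of equations between continuous maps, and these survive uniform
  limits. No invertibility has to be passed to the limit: it comes from
  \<open>\<alpha> (inv g)\<close> being the inverse of \<open>\<alpha> g\<close>. Therefore the space of actions, though built from the
  non-closed set of homeomorphisms, is closed in a complete space.\<close>

lemma closedin_actions: "closedin map_families (actions G)"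
proof -
  have "f \<in> actions G" if f: "f \<in> map_families closure_of (actions G)" for f
  proof -
    have top: "f \<in> topspace map_families"
      using f by (simp add: in_closure_of)
    have approx: "\<exists>\<alpha>\<in>actions G. \<forall>k\<in>K. \<forall>x. agree n (\<alpha> k x) (f k x)"
      if "finite K" "K \<subseteq> carrier G" for K n
    proof -
      let ?T = "{h \<in> topspace map_families. \<forall>k\<in>K. \<forall>x. agree n (h k x) (f k x)}"
      have "f \<in> ?T \<and> openin map_families ?T"
        using top openin_map_families_agree[OF that] by simp
      then obtain \<alpha> where "\<alpha> \<in> actions G" "\<alpha> \<in> ?T"
        using f unfolding in_closure_of by meson
      then show ?thesis by (intro bexI[of _ \<alpha>]) simp_all
    qed
    have cont: "continuous_map cantor_space cantor_space (f g)" if "g \<in> carrier G" for g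
      using top that unfolding topspace_map_families by auto
    have "f \<one> x = x" for x
    proof (rule eq_if_agree)
      fix n
      obtain \<alpha> where "\<alpha> \<in> actions G" "\<forall>k\<in>{\<one>}. \<forall>x. agree n (\<alpha> k x) (f k x)"
        using approx[of "{\<one>}" n] by auto
      then show "agree n (f \<one> x) x"
        using action_one[of \<alpha> x] agree_sym by (metis insertI1)
    qed
    moreover have "f (g \<otimes> h) x = f g (f h x)" if gh: "g \<in> carrier G" "h \<in> carrier G" for g h x
    proof (rule eq_if_agree)
      fix n
      obtain m where m: "\<And>x y. agree m x y \<Longrightarrow> agree n (f g x) (f g y)"
        using continuous_cantor_modulus[OF cont[OF gh(1)]] by blast
      obtain \<alpha> where \<alpha>: "\<alpha> \<in> actions G"
          "\<forall>k\<in>{g \<otimes> h, g, h}. \<forall>x. agree (max m n) (\<alpha> k x) (f k x)"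
        using approx[of "{g \<otimes> h, g, h}" "max m n"] gh by auto
      have app: "agree l (\<alpha> k x) (f k x)" if "k \<in> {g \<otimes> h, g, h}" "l \<le> max m n" for k l x
        using \<alpha>(2) that agree_mono by blast
      have "agree n (f (g \<otimes> h) x) (\<alpha> (g \<otimes> h) x)"
        by (rule agree_sym, rule app) auto
      moreover have "\<alpha> (g \<otimes> h) x = \<alpha> g (\<alpha> h x)"
        by (rule action_mult[OF \<alpha>(1) gh])
      moreover have "agree n (\<alpha> g (\<alpha> h x)) (f g (\<alpha> h x))"
        by (rule app) auto
      moreover have "agree n (f g (\<alpha> h x)) (f g (f h x))"
        by (rule m, rule app) auto
      ultimately show "agree n (f (g \<otimes> h) x) (f g (f h x))"
        by (metis agree_trans)
    qed
    moreover have "f \<in> extensional (carrier G)"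
      using top by (auto simp: PiE_iff)
    ultimately show ?thesis
      using cont unfolding actions_iff by simp
  qed
  then have "map_families closure_of (actions G) = actions G"
    using closure_of_subset[OF actions_subset_map_families] by blast
  then show ?thesis
    by (simp only: closure_of_eq)
qed

lemma completely_metrizable_action_topology: "completely_metrizable_space Act"
proof -
  have "completely_metrizable_space map_families"
    unfolding completely_metrizable_space_product_topology
    using completely_metrizable_cantor_maps countable_carrier
    by (auto intro: countable_subset[OF _ countable_carrier])
  then show ?thesis
    unfolding action_topology_eq using closedin_actions by (rule completely_metrizable_space_closedin)
qed


section \<open>Codings of actions by labellings\<close>

text \<open>The inverse makes the map \<open>coding \<alpha> p\<close> from the Cantor space to the shift equivariant.\<close>

definition coding :: "('g \<Rightarrow> cantor \<Rightarrow> cantor) \<Rightarrow> (cantor \<Rightarrow> 'v) \<Rightarrow> cantor \<Rightarrow> 'g \<Rightarrow> 'v" where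
  "coding \<alpha> p x = (\<lambda>g\<in>carrier G. p (\<alpha> (inv g) x))"

definition factor :: "('g \<Rightarrow> cantor \<Rightarrow> cantor) \<Rightarrow> (cantor \<Rightarrow> 'v) \<Rightarrow> ('g \<Rightarrow> 'v) set" where
  "factor \<alpha> p = range (coding \<alpha> p)"

definition letter_map :: "('v \<Rightarrow> 'w) \<Rightarrow> ('g \<Rightarrow> 'v) \<Rightarrow> 'g \<Rightarrow> 'w" where
  "letter_map f z = (\<lambda>g\<in>carrier G. f (z g))"

lemma coding_one: "\<alpha> \<in> actions G \<Longrightarrow> coding \<alpha> p x \<one> = p x"
  by (simp add: coding_def action_one)

lemma coding_shift:
  assumes "\<alpha> \<in> actions G" "g \<in> carrier G"
  shows "coding \<alpha> p (\<alpha> g x) = shift G g (coding \<alpha> p x)"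
proof
  fix h
  have "\<alpha> (inv h) (\<alpha> g x) = \<alpha> (inv (inv g \<otimes> h)) x" if "h \<in> carrier G"
    using assms that action_mult[OF assms(1), of "inv h" g x] by (simp add: inv_mult_group)
  then show "coding \<alpha> p (\<alpha> g x) h = shift G g (coding \<alpha> p x) h"
    using assms by (simp add: coding_def shift_def)
qed

lemma coding_letter_map: "letter_map f (coding \<alpha> p x) = coding \<alpha> (\<lambda>x. f (p x)) x"
  by (auto simp: letter_map_def coding_def fun_eq_iff)

lemma factor_letter_map: "letter_map f ` factor \<alpha> p = factor \<alpha> (\<lambda>x. f (p x))"
  by (auto simp: factor_def image_image coding_letter_map)

lemma labelling_coding:
  assumes "\<alpha> \<in> actions G" "labelling p"
  shows "labelling (\<lambda>x. coding \<alpha> p x g)"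
proof (cases "g \<in> carrier G")
  case True
  then show ?thesis
    using labelling_compose[OF action_continuous[OF assms(1) inv_closed[OF True]] assms(2)]
    by (simp add: coding_def o_def)
qed (simp add: coding_def labelling_def)

lemma closedin_full_shift_iff:
  "closedin (full_shift G A) X \<longleftrightarrow>
     X \<subseteq> carrier G \<rightarrow>\<^sub>E A \<and>
     (\<forall>x\<in>carrier G \<rightarrow>\<^sub>E A. (\<forall>K. finite K \<and> K \<subseteq> carrier G \<longrightarrow> (\<exists>y\<in>X. \<forall>k\<in>K. y k = x k)) \<longrightarrow> x \<in> X)"
  unfolding full_shift_def by (rule closedin_discrete_power_iff)

lemma shift_apply: "h \<in> carrier G \<Longrightarrow> shift G g x h = x (inv g \<otimes> h)"
  by (simp add: shift_def)

lemma shift_inv_apply: "g \<in> carrier G \<Longrightarrow> h \<in> carrier G \<Longrightarrow> shift G (inv g) x h = x (g \<otimes> h)"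
  by (simp add: shift_def)

lemma factor_subshift:
  assumes \<alpha>: "\<alpha> \<in> actions G" and p: "labelling p" and A: "range p \<subseteq> A"
  shows "factor \<alpha> p \<in> subshifts G A"
proof -
  have "continuous_map cantor_space (full_shift G A) (coding \<alpha> p)"
    unfolding full_shift_def continuous_map_componentwise
  proof (intro conjI ballI)
    show "coding \<alpha> p ` topspace cantor_space \<subseteq> extensional (carrier G)"
      by (auto simp: coding_def)
    fix g assume g: "g \<in> carrier G"
    have "continuous_map cantor_space (discrete_topology UNIV) (\<lambda>x. coding \<alpha> p x g)"
      using labelling_coding[OF \<alpha> p]
      by (simp add: continuous_map_discrete_iff_labelling)
    moreover have "coding \<alpha> p x g \<in> A" for x
      using A g by (auto simp: coding_def)
    ultimately show "continuous_map cantor_space (discrete_topology A) (\<lambda>x. coding \<alpha> p x g)"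
      by (auto simp: continuous_map)
  qed
  then have "compactin (full_shift G A) (factor \<alpha> p)"
    using image_compactin[of cantor_space UNIV] compact_space_cantor
    unfolding factor_def compact_space_def by fastforce
  then have "closedin (full_shift G A) (factor \<alpha> p)"
    using Hausdorff_space_discrete_power compactin_imp_closedin unfolding full_shift_def by blast
  moreover have "shift G g ` factor \<alpha> p \<subseteq> factor \<alpha> p" if "g \<in> carrier G" for g
    by (auto simp: factor_def coding_shift[OF \<alpha> that, symmetric])
  ultimately show ?thesis
    by (simp add: subshifts_def factor_def)
qed

lemma patterns_iff: "restrict x F \<in> patterns F X \<longleftrightarrow> (\<exists>y\<in>X. \<forall>k\<in>F. y k = x k)"
proof -
  have "restrict x F = restrict y F \<longleftrightarrow> (\<forall>k\<in>F. y k = x k)" for y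
    by (auto simp: fun_eq_iff)
  then show ?thesis by (auto simp: patterns_def image_iff)
qed

lemma patterns_mono:
  fixes X Y :: "('g \<Rightarrow> 'v) set"
  assumes "patterns F X = patterns F Y" "F' \<subseteq> F"
  shows "patterns F' X = patterns F' Y"
proof -
  have "patterns F' Z = (\<lambda>w. restrict w F') ` patterns F Z" for Z :: "('g \<Rightarrow> 'v) set"
    using assms(2) by (simp add: patterns_def image_image Int_absorb1)
  then show ?thesis using assms(1) by simp
qed

lemma patterns_eqD:
  assumes "patterns F X = patterns F Y" "x \<in> X"
  shows "\<exists>y\<in>Y. \<forall>k\<in>F. y k = x k"
  using assms patterns_iff[of x F Y] by (auto simp: patterns_def)

lemma subshift_eqI:
  assumes X: "X \<in> subshifts G A" and Y: "Y \<in> subshifts G B"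
    and eq: "\<And>F. finite F \<Longrightarrow> F \<subseteq> carrier G \<Longrightarrow> patterns F X = patterns F Y"
  shows "X = Y"
proof -
  have "X' \<subseteq> Y'" if X': "X' \<in> subshifts G A'" and Y': "Y' \<in> subshifts G B'"
    and eq': "\<And>F. finite F \<Longrightarrow> F \<subseteq> carrier G \<Longrightarrow> patterns F X' = patterns F Y'" for X' Y' A' B'
  proof
    fix x assume x: "x \<in> X'"
    have Yc: "closedin (full_shift G B') Y'"
      using Y' by (simp add: subshifts_def)
    have xA: "x \<in> carrier G \<rightarrow>\<^sub>E A'"
      using X' x by (auto simp: subshifts_def closedin_full_shift_iff)
    have ex: "\<exists>y\<in>Y'. \<forall>k\<in>F. y k = x k" if "finite F" "F \<subseteq> carrier G" for F
      using patterns_eqD[OF eq'[OF that] x] .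
    have "x \<in> carrier G \<rightarrow>\<^sub>E B'"
    proof (rule PiE_I)
      fix g assume g: "g \<in> carrier G"
      then obtain y where "y \<in> Y'" "y g = x g"
        using ex[of "{g}"] by auto
      then show "x g \<in> B'"
        using Yc g unfolding closedin_full_shift_iff by (metis PiE_mem subsetD)
    qed (use xA in auto)
    then show "x \<in> Y'"
      using Yc ex unfolding closedin_full_shift_iff by blast
  qed
  from this[OF X Y eq] this[OF Y X eq[symmetric]] show ?thesis by blast
qed

text \<open>The actions that cannot be told from \<open>\<alpha>\<close> on the window \<open>F\<close> through the labelling \<open>t\<close>. They form a
  basis of neighbourhoods in which only patterns of subshifts matter.\<close>

definition coding_nhd ::
  "('g \<Rightarrow> cantor \<Rightarrow> cantor) \<Rightarrow> 'g set \<Rightarrow> (cantor \<Rightarrow> 'v) \<Rightarrow> ('g \<Rightarrow> cantor \<Rightarrow> cantor) set" where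
  "coding_nhd \<alpha> F t = {\<beta> \<in> actions G. \<forall>x. \<forall>g\<in>F. coding \<beta> t x g = coding \<alpha> t x g}"

lemma coding_nhd_refl: "\<alpha> \<in> actions G \<Longrightarrow> \<alpha> \<in> coding_nhd \<alpha> F t"
  by (simp add: coding_nhd_def)

lemma coding_nhd_patterns:
  assumes "\<beta> \<in> coding_nhd \<alpha> F t"
  shows "patterns F (factor \<beta> t) = patterns F (factor \<alpha> t)"
proof -
  have "restrict (coding \<beta> t x) F = restrict (coding \<alpha> t x) F" for x
    using assms by (auto simp: coding_nhd_def fun_eq_iff)
  then show ?thesis by (simp add: patterns_def factor_def image_image)
qed

lemma openin_coding_nhd:
  assumes "finite F" "F \<subseteq> carrier G" "labelling t"
  shows "openin Act (coding_nhd \<alpha> F t)"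
proof (subst openin_subopen, rule ballI)
  fix \<beta> assume \<beta>: "\<beta> \<in> coding_nhd \<alpha> F t"
  obtain n where n: "\<And>x y. agree n x y \<Longrightarrow> t x = t y"
    using assms(3) unfolding labelling_def by blast
  let ?K = "(\<lambda>g. inv g) ` F"
  let ?T = "{f \<in> topspace map_families. \<forall>k\<in>?K. \<forall>x. agree n (f k x) (\<beta> k x)}"
  have "openin map_families ?T"
    by (rule openin_map_families_agree) (use assms in auto)
  then have "openin Act (?T \<inter> actions G)"
    unfolding action_topology_eq by (auto simp: openin_subtopology)
  moreover have "\<beta> \<in> ?T \<inter> actions G"
    using \<beta> actions_subset_map_families by (auto simp: coding_nhd_def)
  moreover have "?T \<inter> actions G \<subseteq> coding_nhd \<alpha> F t"
  proof
    fix \<gamma> assume \<gamma>: "\<gamma> \<in> ?T \<inter> actions G"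
    have "coding \<gamma> t x g = coding \<alpha> t x g" if "g \<in> F" for x g
    proof -
      have "t (\<gamma> (inv g) x) = t (\<beta> (inv g) x)"
        using \<gamma> that by (intro n) auto
      then have "coding \<gamma> t x g = coding \<beta> t x g"
        using that assms(2) by (auto simp: coding_def)
      then show ?thesis
        using \<beta> that by (simp add: coding_nhd_def)
    qed
    then show "\<gamma> \<in> coding_nhd \<alpha> F t"
      using \<gamma> by (simp add: coding_nhd_def)
  qed
  ultimately show "\<exists>T. openin Act T \<and> \<beta> \<in> T \<and> T \<subseteq> coding_nhd \<alpha> F t"
    by (intro exI[of _ "?T \<inter> actions G"] conjI)
qed

lemma coding_nhd_basis:
  assumes "openin Act U" "\<alpha> \<in> U"
  shows "\<exists>F n. finite F \<and> F \<subseteq> carrier G \<and> coding_nhd \<alpha> F (prefix n) \<subseteq> U"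
proof -
  obtain T where T: "openin map_families T" "U = T \<inter> actions G"
    using assms(1) unfolding action_topology_eq openin_subtopology by blast
  have "\<alpha> \<in> T" using T(2) assms(2) by blast
  obtain K n where K: "finite K" "K \<subseteq> carrier G"
      "\<And>f. f \<in> topspace map_families \<Longrightarrow> (\<forall>k\<in>K. \<forall>x. agree n (f k x) (\<alpha> k x)) \<Longrightarrow> f \<in> T"
    using map_families_agree_basis[OF T(1) \<open>\<alpha> \<in> T\<close>] by metis
  define F where "F = (\<lambda>g. inv g) ` K"
  have "coding_nhd \<alpha> F (prefix n) \<subseteq> U"
  proof
    fix \<beta> assume \<beta>: "\<beta> \<in> coding_nhd \<alpha> F (prefix n)"
    have "agree n (\<beta> k x) (\<alpha> k x)" if "k \<in> K" for k x
    proof -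
      have "inv k \<in> F" "inv k \<in> carrier G" "inv (inv k) = k"
        using that K(2) by (auto simp: F_def)
      moreover from this have "coding \<beta> (prefix n) x (inv k) = coding \<alpha> (prefix n) x (inv k)"
        using \<beta> by (simp add: coding_nhd_def)
      ultimately show ?thesis
        by (simp add: coding_def prefix_eq_iff)
    qed
    then have "\<beta> \<in> T"
      using \<beta> actions_subset_map_families by (intro K(3)) (auto simp: coding_nhd_def)
    then show "\<beta> \<in> U" using \<beta> T(2) by (simp add: coding_nhd_def)
  qed
  moreover have "finite F" "F \<subseteq> carrier G"
    using K by (auto simp: F_def)
  ultimately show ?thesis by blast
qed

text \<open>Two different subshifts differ on some finite window, and the patterns of \<open>factor \<beta> p\<close> on a
  finite window are locally constant in \<open>\<beta>\<close>.\<close>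

lemma closedin_factor_fibre:
  assumes "labelling p" and X: "X \<in> subshifts G A"
  shows "closedin Act {\<beta> \<in> actions G. factor \<beta> p = X}"
proof -
  let ?C = "{\<beta> \<in> actions G. factor \<beta> p \<noteq> X}"
  have "openin Act ?C"
  proof (subst openin_subopen, rule ballI)
    fix \<beta> assume \<beta>: "\<beta> \<in> ?C"
    then have "factor \<beta> p \<in> subshifts G (range p)" "factor \<beta> p \<noteq> X"
      using factor_subshift[OF _ assms(1) order_refl] by simp_all
    then obtain F where F: "finite F" "F \<subseteq> carrier G" "patterns F (factor \<beta> p) \<noteq> patterns F X"
      using subshift_eqI[OF _ X] by metis
    have "coding_nhd \<beta> F p \<subseteq> ?C"
      using F(3) coding_nhd_patterns[of _ \<beta> F p] by (auto simp: coding_nhd_def)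
    then show "\<exists>T. openin Act T \<and> \<beta> \<in> T \<and> T \<subseteq> ?C"
      using openin_coding_nhd[OF F(1,2) assms(1)] coding_nhd_refl[of \<beta>] \<beta>
      by (intro exI[of _ "coding_nhd \<beta> F p"]) simp
  qed
  moreover have "actions G - {\<beta> \<in> actions G. factor \<beta> p = X} = ?C" by blast
  ultimately show ?thesis by (simp add: closedin_def)
qed


section \<open>Constructing subshifts\<close>

lemma subshift_extensional: "X \<in> subshifts G A \<Longrightarrow> x \<in> X \<Longrightarrow> x \<in> carrier G \<rightarrow>\<^sub>E A"
  by (auto simp: subshifts_def closedin_full_shift_iff)

lemma subshift_shift: "X \<in> subshifts G A \<Longrightarrow> x \<in> X \<Longrightarrow> g \<in> carrier G \<Longrightarrow> shift G g x \<in> X"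
  by (auto simp: subshifts_def)

lemma shift_one: "x \<in> extensional (carrier G) \<Longrightarrow> shift G \<one> x = x"
  by (auto simp: shift_def extensional_def fun_eq_iff)

lemma shift_mult:
  assumes "g \<in> carrier G" "h \<in> carrier G"
  shows "shift G (g \<otimes> h) x = shift G g (shift G h x)"
  using assms by (auto simp: shift_def fun_eq_iff inv_mult_group m_assoc)

lemma subshiftI_closed_invariant:
  assumes "closedin (full_shift G A) X" "X \<noteq> {}" "\<And>g z. g \<in> carrier G \<Longrightarrow> z \<in> X \<Longrightarrow> shift G g z \<in> X"
  shows "X \<in> subshifts G A"
  using assms by (auto simp: subshifts_def)

lemma shift_in: "x \<in> carrier G \<rightarrow>\<^sub>E A \<Longrightarrow> g \<in> carrier G \<Longrightarrow> shift G g x \<in> carrier G \<rightarrow>\<^sub>E A"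
  by (auto simp: shift_def PiE_iff)

lemma letter_map_shift: "g \<in> carrier G \<Longrightarrow> letter_map c (shift G g z) = shift G g (letter_map c z)"
  by (auto simp: letter_map_def shift_def fun_eq_iff)

text \<open>Each instance of \<open>P\<close> reads finitely many coordinates, so these sets are closed, and it is imposed at
  every \<open>g\<close>, so they are shift-invariant.\<close>

definition local_rule :: "'v set \<Rightarrow> 'g set \<Rightarrow> (('g \<Rightarrow> 'v) \<Rightarrow> bool) \<Rightarrow> ('g \<Rightarrow> 'v) set" where
  "local_rule A F P = {z \<in> carrier G \<rightarrow>\<^sub>E A. \<forall>g\<in>carrier G. P (restrict (\<lambda>f. z (g \<otimes> f)) F)}"

lemma closedin_local_rule:
  assumes F: "finite F" "F \<subseteq> carrier G"
  shows "closedin (full_shift G A) (local_rule A F P)"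
  unfolding closedin_full_shift_iff
proof (intro conjI ballI impI)
  fix x assume x: "x \<in> carrier G \<rightarrow>\<^sub>E A"
    and app: "\<forall>K. finite K \<and> K \<subseteq> carrier G \<longrightarrow> (\<exists>z\<in>local_rule A F P. \<forall>k\<in>K. z k = x k)"
  have "P (restrict (\<lambda>f. x (g \<otimes> f)) F)" if g: "g \<in> carrier G" for g
  proof -
    obtain z where z: "z \<in> local_rule A F P" "\<forall>k\<in>(\<lambda>f. g \<otimes> f) ` F. z k = x k"
      using spec[OF app, of "(\<lambda>f. g \<otimes> f) ` F"] F g by auto
    have "restrict (\<lambda>f. z (g \<otimes> f)) F = restrict (\<lambda>f. x (g \<otimes> f)) F"
      using z(2) by (auto simp: fun_eq_iff)
    then show ?thesis using z(1) g unfolding local_rule_def by force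
  qed
  then show "x \<in> local_rule A F P" using x by (simp add: local_rule_def)
qed (auto simp: local_rule_def)

lemma shift_local_rule:
  assumes z: "z \<in> local_rule A F P" and F: "F \<subseteq> carrier G" and h: "h \<in> carrier G"
  shows "shift G h z \<in> local_rule A F P"
proof -
  have "restrict (\<lambda>f. shift G h z (g \<otimes> f)) F = restrict (\<lambda>f. z ((inv h \<otimes> g) \<otimes> f)) F" if "g \<in> carrier G" for g
    using F h that by (auto simp: fun_eq_iff shift_apply m_assoc subsetD)
  then show ?thesis
    using z h shift_in[of z A h] by (simp add: local_rule_def)
qed

lemma closedin_letter_map_preimage:
  assumes Y: "Y \<in> subshifts G B" and c: "c ` A \<subseteq> B"
  shows "closedin (full_shift G A) {z \<in> carrier G \<rightarrow>\<^sub>E A. letter_map c z \<in> Y}"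
  unfolding closedin_full_shift_iff
proof (intro conjI ballI impI)
  fix x assume x: "x \<in> carrier G \<rightarrow>\<^sub>E A"
    and app: "\<forall>K. finite K \<and> K \<subseteq> carrier G \<longrightarrow>
                (\<exists>z\<in>{z \<in> carrier G \<rightarrow>\<^sub>E A. letter_map c z \<in> Y}. \<forall>k\<in>K. z k = x k)"
  have "\<exists>y\<in>Y. \<forall>k\<in>K. y k = letter_map c x k" if "finite K \<and> K \<subseteq> carrier G" for K
  proof -
    obtain z where "letter_map c z \<in> Y" "\<forall>k\<in>K. z k = x k"
      using app \<open>finite K \<and> K \<subseteq> carrier G\<close> by blast
    then show ?thesis by (intro bexI[of _ "letter_map c z"]) (simp_all add: letter_map_def)
  qed
  moreover have "letter_map c x \<in> carrier G \<rightarrow>\<^sub>E B"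
    using x c by (auto simp: letter_map_def PiE_iff)
  moreover have "closedin (full_shift G B) Y" using Y by (simp add: subshifts_def)
  ultimately have "letter_map c x \<in> Y" unfolding closedin_full_shift_iff by simp
  then show "x \<in> {z \<in> carrier G \<rightarrow>\<^sub>E A. letter_map c z \<in> Y}" using x by simp
qed blast

text \<open>Graphs of block maps and fibre products of subshifts are cut out by such constraints.\<close>

lemma subshift_from_constraints:
  assumes F: "finite F" "F \<subseteq> carrier G" and T: "T \<in> subshifts G A" "a ` C \<subseteq> A" and Y: "Y \<in> subshifts G B" "b ` C \<subseteq> B"
    and ne: "X \<noteq> {}"
    and X: "\<And>z. z \<in> X \<longleftrightarrow> z \<in> local_rule C F P \<and> letter_map a z \<in> T \<and> letter_map b z \<in> Y"
  shows "X \<in> subshifts G C"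
proof (rule subshiftI_closed_invariant[OF _ ne])
  have eq: "X = local_rule C F P \<inter> {z \<in> carrier G \<rightarrow>\<^sub>E C. letter_map a z \<in> T} \<inter> {z \<in> carrier G \<rightarrow>\<^sub>E C. letter_map b z \<in> Y}"
    using X by (auto simp: local_rule_def)
  show "closedin (full_shift G C) X"
    unfolding eq
    by (intro closedin_Int closedin_local_rule[OF F] closedin_letter_map_preimage[OF T]
        closedin_letter_map_preimage[OF Y])
  show "shift G g z \<in> X" if "g \<in> carrier G" "z \<in> X" for g z
    using that shift_local_rule[of z C F P, OF _ F(2) that(1)] subshift_shift[OF T(1) _ that(1)] subshift_shift[OF Y(1) _ that(1)]
    by (simp add: X letter_map_shift)
qed


section \<open>Realising subshifts by actions on the Cantor space\<close>

lemma continuous_map_shift: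
  assumes "X \<in> subshifts G A" "g \<in> carrier G"
  shows "continuous_map (subtopology (full_shift G A) X) (subtopology (full_shift G A) X) (shift G g)"
  unfolding continuous_map_in_subtopology
proof
  have "continuous_map (full_shift G A) (full_shift G A) (shift G g)"
    unfolding full_shift_def continuous_map_componentwise
  proof (intro conjI ballI)
    fix h assume h: "h \<in> carrier G"
    have "continuous_map (product_topology (\<lambda>_. discrete_topology A) (carrier G)) (discrete_topology A)
            (\<lambda>x. x (inv g \<otimes> h))"
      using assms h by (intro continuous_map_product_projection) auto
    then show "continuous_map (product_topology (\<lambda>_. discrete_topology A) (carrier G)) (discrete_topology A)
            (\<lambda>x. shift G g x h)"
      using h by (simp add: shift_def)
  qed (auto simp: shift_def)
  then show "continuous_map (subtopology (full_shift G A) X) (full_shift G A) (shift G g)"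
    by (rule continuous_map_from_subtopology)
  show "shift G g \<in> topspace (subtopology (full_shift G A) X) \<rightarrow> X"
    using subshift_shift[OF assms(1) _ assms(2)] by auto
qed

text \<open>\<open>G\<close> acts on \<open>Z\<close> by shifts and trivially on a second factor, a Cantor space. That factor only serves
  to make the product a Cantor space. The letter at the identity is the required labelling.\<close>

lemma subshift_is_factor:
  fixes B :: "nat set"
  assumes "finite B" and Z: "Z \<in> subshifts G B"
  shows "\<exists>\<alpha>\<in>actions G. \<exists>q. labelling q \<and> factor \<alpha> q = Z"
proof -
  define T where "T = subtopology (full_shift G B) Z"
  have Zc: "closedin (full_shift G B) Z" and ne: "Z \<noteq> {}"
    using Z by (auto simp: subshifts_def)
  have top: "topspace T = Z"
    unfolding T_def using closedin_subset[OF Zc] by auto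
  have "compactin (full_shift G B) Z"
    using closedin_compact_space[OF _ Zc] compact_space_discrete_power[OF assms(1)]
    unfolding full_shift_def by blast
  then have cpt: "compact_space T"
    unfolding T_def by (rule compact_space_subtopology)
  have proj: "continuous_map T (discrete_topology B) (\<lambda>z. z g)" if "g \<in> carrier G" for g
    unfolding T_def full_shift_def
    using that by (intro continuous_map_from_subtopology continuous_map_product_projection)
  \<comment> \<open>Bit \<open>n\<close>, for the code \<open>n\<close> of a pair \<open>(i, b)\<close>, says whether \<open>z\<close> has letter \<open>b\<close> at the \<open>i\<close>-th element of \<open>G\<close>.\<close>
  define e where "e = (\<lambda>z n. z (from_nat_into (carrier G) (fst (prod_decode n))) = snd (prod_decode n))"
  have fn: "from_nat_into (carrier G) i \<in> carrier G" for i
    by (rule from_nat_into) auto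
  have cont_e: "continuous_map T cantor_space e"
    unfolding continuous_map_into_cantor_iff
  proof
    fix n
    show "continuous_map T (discrete_topology UNIV) (\<lambda>z. e z n)"
      unfolding e_def
      by (rule continuous_map_compose[OF proj[OF fn], of "discrete_topology UNIV"
            "\<lambda>b. b = snd (prod_decode n)", unfolded o_def]) (simp add: continuous_map)
  qed
  have inj_e: "inj_on e (topspace T)"
  proof (rule inj_onI)
    fix y z assume yz: "y \<in> topspace T" "z \<in> topspace T" "e y = e z"
    have "y g = z g" if g: "g \<in> carrier G" for g
    proof -
      obtain i where i: "from_nat_into (carrier G) i = g"
        using from_nat_into_surj[OF countable_carrier g] by blast
      show ?thesis
        using fun_cong[OF yz(3), of "prod_encode (i, z g)"] by (simp add: e_def i)
    qed
    moreover have "y \<in> carrier G \<rightarrow>\<^sub>E B" "z \<in> carrier G \<rightarrow>\<^sub>E B"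
      using yz(1,2) subshift_extensional[OF Z] unfolding top by blast+
    ultimately show "y = z"
      by (metis PiE_ext)
  qed
  have "prod_topology T cantor_space homeomorphic_space cantor_space"
    using prod_cantor_homeomorphic_cantor[OF cpt _ cont_e inj_e] ne top by simp
  then obtain h h' where hh: "homeomorphic_maps (prod_topology T cantor_space) cantor_space h h'"
    unfolding homeomorphic_space_def by blast
  have conth: "continuous_map (prod_topology T cantor_space) cantor_space h"
    and conth': "continuous_map cantor_space (prod_topology T cantor_space) h'"
    using hh by (auto simp: homeomorphic_maps_def)
  have hh'[simp]: "h (h' x) = x" for x
    using hh by (auto simp: homeomorphic_maps_def)
  have h'h: "h' (h (z, c)) = (z, c)" if "z \<in> Z" for z c
    using hh that by (auto simp: homeomorphic_maps_def top)
  have h'Z: "fst (h' x) \<in> Z" for x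
  proof -
    have "h' x \<in> topspace (prod_topology T cantor_space)"
      using continuous_map_funspace[OF conth'] by auto
    then show ?thesis by (auto simp: top)
  qed
  define \<alpha> where "\<alpha> = (\<lambda>g\<in>carrier G. \<lambda>x. h (shift G g (fst (h' x)), snd (h' x)))"
  define q where "q = (\<lambda>x. fst (h' x) \<one>)"
  have \<alpha>_h': "h' (\<alpha> g x) = (shift G g (fst (h' x)), snd (h' x))" if "g \<in> carrier G" for g x
    using that h'h[OF subshift_shift[OF Z h'Z that]] by (simp add: \<alpha>_def)
  have \<alpha>: "\<alpha> \<in> actions G"
    unfolding actions_iff
  proof (intro conjI ballI allI)
    show "\<alpha> \<in> extensional (carrier G)" by (simp add: \<alpha>_def)
    show "continuous_map cantor_space cantor_space (\<alpha> g)" if g: "g \<in> carrier G" for g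
    proof -
      have "continuous_map (prod_topology T cantor_space) (prod_topology T cantor_space)
              (\<lambda>(z, c). (shift G g z, c))"
        using continuous_map_shift[OF Z g] unfolding T_def[symmetric]
        by (simp add: continuous_map_prod_top)
      then have "continuous_map cantor_space cantor_space (h \<circ> ((\<lambda>(z, c). (shift G g z, c)) \<circ> h'))"
        by (intro continuous_map_compose[OF continuous_map_compose[OF conth'] conth])
      moreover have "h \<circ> ((\<lambda>(z, c). (shift G g z, c)) \<circ> h') = \<alpha> g"
        using g by (auto simp: \<alpha>_def fun_eq_iff case_prod_beta')
      ultimately show ?thesis by simp
    qed
    show "\<alpha> \<one> x = x" for x
    proof -
      have "fst (h' x) \<in> extensional (carrier G)"
        using subshift_extensional[OF Z h'Z, of x] by (simp add: PiE_iff)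
      then show ?thesis by (simp add: \<alpha>_def shift_one)
    qed
    show "\<alpha> (g \<otimes> k) x = \<alpha> g (\<alpha> k x)" if gk: "g \<in> carrier G" "k \<in> carrier G" for g k x
      using gk \<alpha>_h'[OF gk(2)] by (simp add: \<alpha>_def shift_mult)
  qed
  have coding: "coding \<alpha> q x = fst (h' x)" for x
  proof
    fix g
    show "coding \<alpha> q x g = fst (h' x) g"
    proof (cases "g \<in> carrier G")
      case True
      then show ?thesis
        by (simp add: coding_def q_def \<alpha>_h' shift_inv_apply)
    next
      case False
      then show ?thesis
        using subshift_extensional[OF Z h'Z, of x] by (auto simp: coding_def extensional_def PiE_iff)
    qed
  qed
  have "factor \<alpha> q = Z"
  proof
    show "factor \<alpha> q \<subseteq> Z"
      using h'Z by (auto simp: factor_def coding)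
    show "Z \<subseteq> factor \<alpha> q"
    proof
      fix z assume "z \<in> Z"
      then have "z = coding \<alpha> q (h (z, undefined))"
        by (simp add: coding h'h)
      then show "z \<in> factor \<alpha> q" unfolding factor_def by blast
    qed
  qed
  moreover have "continuous_map cantor_space (discrete_topology UNIV) q"
  proof -
    have "continuous_map cantor_space (discrete_topology B) ((\<lambda>z. z \<one>) \<circ> (fst \<circ> h'))"
      by (intro continuous_map_compose[OF continuous_map_compose[OF conth' continuous_map_fst] proj]) simp
    then have "continuous_map cantor_space (discrete_topology UNIV) (id \<circ> ((\<lambda>z. z \<one>) \<circ> (fst \<circ> h')))"
      by (rule continuous_map_compose) (simp add: continuous_map)
    then show ?thesis by (simp add: q_def o_def)
  qed
  then have "labelling q"
    by (simp add: continuous_map_discrete_iff_labelling)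
  ultimately show ?thesis using \<alpha> by blast
qed

lemma homeomorphism_bij:
  assumes "\<phi> \<in> carrier homeo_group"
  shows "inv_into UNIV \<phi> (\<phi> x) = x" "\<phi> (inv_into UNIV \<phi> x) = x"
proof -
  have "inj \<phi>" "surj \<phi>"
    using assms homeomorphic_imp_injective_map[of cantor_space cantor_space \<phi>]
      homeomorphic_imp_surjective_map[of cantor_space cantor_space \<phi>]
    by (auto simp: homeo_group_def)
  then show "inv_into UNIV \<phi> (\<phi> x) = x" "\<phi> (inv_into UNIV \<phi> x) = x"
    by (simp_all add: surj_f_inv_f)
qed

lemma homeomorphism_inv:
  assumes "\<phi> \<in> carrier homeo_group"
  shows "inv_into UNIV \<phi> \<in> carrier homeo_group"
proof -
  obtain \<psi> where \<psi>: "homeomorphic_maps cantor_space cantor_space \<phi> \<psi>"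
    using assms by (auto simp: homeo_group_def homeomorphic_map_maps)
  have "\<psi> x = inv_into UNIV \<phi> x" for x
    using \<psi> homeomorphism_bij[OF assms] by (metis homeomorphic_maps_def UNIV_I topspace_cantor_space)
  then have "\<psi> = inv_into UNIV \<phi>" by blast
  moreover have "homeomorphic_map cantor_space cantor_space \<psi>"
    using \<psi> homeomorphic_maps_sym homeomorphic_maps_imp_map by blast
  ultimately show ?thesis
    by (simp add: homeo_group_def)
qed

lemma conj_action_in_actions:
  assumes \<phi>: "\<phi> \<in> carrier homeo_group" and \<alpha>: "\<alpha> \<in> actions G"
  shows "conj_action G \<phi> \<alpha> \<in> actions G"
  unfolding actions_iff
proof (intro conjI ballI allI)
  have cont: "continuous_map cantor_space cantor_space \<psi>" if "\<psi> \<in> carrier homeo_group" for \<psi>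
    using that by (auto simp: homeo_group_def dest: homeomorphic_imp_continuous_map)
  show "continuous_map cantor_space cantor_space (conj_action G \<phi> \<alpha> g)" if "g \<in> carrier G" for g
  proof -
    have "continuous_map cantor_space cantor_space (\<phi> \<circ> \<alpha> g \<circ> inv_into UNIV \<phi>)"
      by (intro continuous_map_compose[OF cont[OF homeomorphism_inv[OF \<phi>]]]
          continuous_map_compose[OF action_continuous[OF \<alpha> that]] cont[OF \<phi>])
    then show ?thesis using that by (simp add: conj_action_def)
  qed
qed (use \<alpha> homeomorphism_bij[OF \<phi>] in \<open>simp_all add: conj_action_def action_one action_mult\<close>)

lemma coding_conj_action:
  assumes "\<phi> \<in> carrier homeo_group"
  shows "coding (conj_action G \<phi> \<alpha>) p (\<phi> x) = coding \<alpha> (\<lambda>x. p (\<phi> x)) x"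
proof
  fix g
  show "coding (conj_action G \<phi> \<alpha>) p (\<phi> x) g = coding \<alpha> (\<lambda>x. p (\<phi> x)) x g"
    using homeomorphism_bij(1)[OF assms] by (simp add: coding_def conj_action_def)
qed

text \<open>Conjugating an action has the same effect on factors as moving the labelling.\<close>

lemma factor_conj_action:
  assumes "\<phi> \<in> carrier homeo_group"
  shows "factor (conj_action G \<phi> \<alpha>) p = factor \<alpha> (\<lambda>x. p (\<phi> x))"
proof -
  have "range \<phi> = UNIV"
    using homeomorphism_bij(2)[OF assms] by (metis surjI)
  then have "factor (conj_action G \<phi> \<alpha>) p = (\<lambda>x. coding (conj_action G \<phi> \<alpha>) p (\<phi> x)) ` UNIV"
    unfolding factor_def by (metis image_image)
  then show ?thesis
    by (simp add: coding_conj_action[OF assms] factor_def)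
qed

lemma coding_nhd_coarsen:
  assumes "F' \<subseteq> F" "\<And>x. f (t x) = s x"
  shows "coding_nhd \<alpha> F t \<subseteq> coding_nhd \<alpha> F' s"
proof -
  have "coding \<gamma> s x g = (if g \<in> carrier G then f (coding \<gamma> t x g) else undefined)" for \<gamma> x g
    by (simp add: coding_def assms(2))
  then show ?thesis
    using assms(1) unfolding coding_nhd_def by auto
qed

text \<open>The bridge from subshifts to actions: a subshift that looks like \<open>factor \<alpha> t\<close> on the window \<open>K\<close>, up
  to the letter map \<open>\<psi>\<close>, is a factor of an action that looks like \<open>\<alpha>\<close> on \<open>K\<close>. Take any action with
  factor \<open>Z\<close>. The labellings by patterns on \<open>K\<close>, of that action after \<open>\<psi>\<close> and of \<open>\<alpha>\<close>, have the same range,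
  so a homeomorphism matches them. Conjugation by it gives \<open>\<beta>\<close>.\<close>

lemma realization:
  fixes B :: "nat set"
  assumes \<alpha>: "\<alpha> \<in> actions G" and t: "labelling t"
    and K: "finite K" "K \<subseteq> carrier G" "\<one> \<in> K"
    and Z: "finite B" "Z \<in> subshifts G B"
    and pat: "patterns K (letter_map \<psi> ` Z) = patterns K (factor \<alpha> t)"
  shows "\<exists>\<beta>\<in>coding_nhd \<alpha> K t. \<exists>q. labelling q \<and> factor \<beta> q = Z \<and> (\<forall>x. \<psi> (q x) = t x)"
proof -
  obtain \<beta>\<^sub>0 q\<^sub>0 where \<beta>\<^sub>0: "\<beta>\<^sub>0 \<in> actions G" "labelling q\<^sub>0" "factor \<beta>\<^sub>0 q\<^sub>0 = Z"
    using subshift_is_factor[OF Z] by blast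
  define u where "u = (\<lambda>x. restrict (coding \<alpha> t x) K)"
  define v where "v = (\<lambda>x. restrict (coding \<beta>\<^sub>0 (\<lambda>y. \<psi> (q\<^sub>0 y)) x) K)"
  have "labelling u"
    unfolding u_def by (intro labelling_restrict K(1) labelling_coding[OF \<alpha> t])
  moreover have "labelling v"
  proof -
    have "labelling (\<lambda>y. \<psi> (q\<^sub>0 y))"
      using \<beta>\<^sub>0(2) by (rule labelling_map)
    then show ?thesis
      unfolding v_def by (rule labelling_restrict[OF K(1) labelling_coding[OF \<beta>\<^sub>0(1)]])
  qed
  moreover have "range u = range v"
  proof -
    have "range u = patterns K (factor \<alpha> t)"
      by (simp add: u_def patterns_def factor_def image_image)
    also have "\<dots> = patterns K (factor \<beta>\<^sub>0 (\<lambda>y. \<psi> (q\<^sub>0 y)))"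
      using pat \<beta>\<^sub>0(3) factor_letter_map by metis
    also have "\<dots> = range v"
      by (simp add: v_def patterns_def factor_def image_image)
    finally show ?thesis .
  qed
  ultimately obtain \<phi> where \<phi>: "homeomorphic_map cantor_space cantor_space \<phi>" "v \<circ> \<phi> = u"
    using homeomorphism_matching_labels by blast
  then have \<phi>c: "\<phi> \<in> carrier homeo_group" by (simp add: homeo_group_def)
  define \<phi>' where "\<phi>' = inv_into UNIV \<phi>"
  have \<phi>': "\<phi>' \<in> carrier homeo_group" and inv: "\<And>x. \<phi> (\<phi>' x) = x" "\<And>x. \<phi>' (\<phi> x) = x"
    using homeomorphism_inv[OF \<phi>c] homeomorphism_bij[OF \<phi>c] by (simp_all add: \<phi>'_def)
  define \<beta> where "\<beta> = conj_action G \<phi>' \<beta>\<^sub>0"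
  define q where "q = q\<^sub>0 \<circ> \<phi>"
  have \<beta>: "\<beta> \<in> actions G"
    unfolding \<beta>_def by (rule conj_action_in_actions[OF \<phi>' \<beta>\<^sub>0(1)])
  have "labelling q"
    unfolding q_def using labelling_compose[OF homeomorphic_imp_continuous_map[OF \<phi>(1)] \<beta>\<^sub>0(2)] .
  moreover have fac: "factor \<beta> q = Z"
    unfolding \<beta>_def factor_conj_action[OF \<phi>'] q_def using inv \<beta>\<^sub>0(3) by simp
  moreover have cod: "coding \<beta> (\<lambda>y. \<psi> (q y)) x k = coding \<alpha> t x k" if k: "k \<in> K" for x k
  proof -
    have "coding \<beta> (\<lambda>y. \<psi> (q y)) x = coding \<beta>\<^sub>0 (\<lambda>y. \<psi> (q\<^sub>0 y)) (\<phi> x)"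
      using coding_conj_action[OF \<phi>', of \<beta>\<^sub>0 "\<lambda>y. \<psi> (q y)" "\<phi> x"] by (simp add: \<beta>_def inv q_def)
    moreover have "v (\<phi> x) k = u x k"
      using fun_cong[OF \<phi>(2), of x] by simp
    ultimately show ?thesis
      using k by (simp add: u_def v_def)
  qed
  moreover have \<psi>q: "\<psi> (q x) = t x" for x
    using cod[OF K(3), of x] by (simp add: coding_one[OF \<beta>] coding_one[OF \<alpha>])
  moreover have "\<beta> \<in> coding_nhd \<alpha> K t"
    using \<beta> cod by (simp add: coding_nhd_def \<psi>q)
  ultimately show ?thesis by blast
qed


section \<open>Stable factors\<close>

text \<open>Pairs of labels are coded as numbers. A refinement of a labelling is then again a labelling by
  numbers, and the map that forgets the refinement is \<open>pfst\<close> in all cases, so that it need not be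
  quantified over.\<close>

definition pfst :: "nat \<Rightarrow> nat" where "pfst c = fst (prod_decode c)"
definition psnd :: "nat \<Rightarrow> nat" where "psnd c = snd (prod_decode c)"

lemma pfst_encode [simp]: "pfst (prod_encode (a, b)) = a"
  and psnd_encode [simp]: "psnd (prod_encode (a, b)) = b"
  by (simp_all add: pfst_def psnd_def)

lemma prod_encode_pfst_psnd: "prod_encode (pfst c, psnd c) = c"
  by (simp add: pfst_def psnd_def)

definition pair :: "(cantor \<Rightarrow> nat) \<Rightarrow> (cantor \<Rightarrow> nat) \<Rightarrow> cantor \<Rightarrow> nat" where
  "pair p q x = prod_encode (p x, q x)"

lemma pfst_pair [simp]: "pfst (pair p q x) = p x"
  and psnd_pair [simp]: "psnd (pair p q x) = q x"
  by (simp_all add: pair_def)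

lemma labelling_pair:
  "labelling p \<Longrightarrow> labelling q \<Longrightarrow> labelling (pair p q)"
  using labelling_map[OF labelling_Pair, of p q prod_encode]
  by (simp add: pair_def[abs_def])

definition stable :: "(cantor \<Rightarrow> nat) \<Rightarrow> ('g \<Rightarrow> cantor \<Rightarrow> cantor) set" where
  "stable p = {\<alpha>. \<exists>U. openin Act U \<and> \<alpha> \<in> U \<and> (\<forall>\<beta>\<in>U. factor \<beta> p = factor \<alpha> p)}"

lemma openin_stable: "openin Act (stable p)"
proof (subst openin_subopen, rule ballI)
  fix \<alpha> assume "\<alpha> \<in> stable p"
  then obtain U where U: "openin Act U" "\<alpha> \<in> U" "\<forall>\<beta>\<in>U. factor \<beta> p = factor \<alpha> p"
    unfolding stable_def by blast
  have "U \<subseteq> stable p"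
    using U(1,3) by (auto simp: stable_def intro!: exI[of _ U])
  then show "\<exists>T. openin Act T \<and> \<alpha> \<in> T \<and> T \<subseteq> stable p"
    using U(1,2) by blast
qed

lemma letter_map_id:
  assumes "Z \<subseteq> extensional (carrier G)"
  shows "letter_map (\<lambda>a. a) ` Z = Z"
proof -
  have "letter_map (\<lambda>a. a) z = z" if "z \<in> Z" for z
    using assms that by (auto simp: letter_map_def extensional_def fun_eq_iff)
  then show ?thesis by simp
qed

text \<open>Stability expressed by subshifts alone. A neighbourhood on which the factor is constant contains
  some \<open>coding_nhd \<alpha> F q\<close> with \<open>q\<close> finer than \<open>p\<close>. Every subshift \<open>Z\<close> with the patterns of \<open>factor \<alpha> q\<close>
  on \<open>F\<close> is realised by an action in it, with labelling \<open>q\<close> itself, so the image of \<open>Z\<close> is the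
  constant value.\<close>

lemma stable_witness:
  assumes st: "\<alpha> \<in> stable p" and \<alpha>: "\<alpha> \<in> actions G" and p: "labelling p"
  shows "\<exists>q F. labelling q \<and> finite F \<and> F \<subseteq> carrier G \<and> \<one> \<in> F \<and> (\<forall>x. pfst (q x) = p x) \<and>
           (\<forall>B Z. finite B \<and> Z \<in> subshifts G B \<and> patterns F Z = patterns F (factor \<alpha> q) \<longrightarrow>
                  letter_map pfst ` Z = factor \<alpha> p)"
proof -
  obtain U where U: "openin Act U" "\<alpha> \<in> U" "\<And>\<beta>. \<beta> \<in> U \<Longrightarrow> factor \<beta> p = factor \<alpha> p"
    using st unfolding stable_def by blast
  obtain F\<^sub>0 n where F\<^sub>0: "finite F\<^sub>0" "F\<^sub>0 \<subseteq> carrier G" "coding_nhd \<alpha> F\<^sub>0 (prefix n) \<subseteq> U"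
    using coding_nhd_basis[OF U(1,2)] by blast
  define q where "q = pair p (prefix n)"
  define F where "F = insert \<one> F\<^sub>0"
  have q: "labelling q"
    unfolding q_def by (intro labelling_pair p labelling_prefix)
  have wit: "letter_map pfst ` Z = factor \<alpha> p"
    if Z: "finite B" "Z \<in> subshifts G B" and pat: "patterns F Z = patterns F (factor \<alpha> q)" for B Z
  proof -
    have "Z \<subseteq> extensional (carrier G)"
      using subshift_extensional[OF Z(2)] by (auto simp: PiE_iff)
    then have "patterns F (letter_map (\<lambda>a. a) ` Z) = patterns F (factor \<alpha> q)"
      using pat by (simp add: letter_map_id)
    then obtain \<beta> q' where \<beta>: "\<beta> \<in> coding_nhd \<alpha> F q" "factor \<beta> q' = Z" "\<forall>x. q' x = q x"
      using realization[OF \<alpha> q _ _ _ Z, of F "\<lambda>a. a"] F\<^sub>0(1,2) unfolding F_def by auto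
    have "q' = q" using \<beta>(3) by blast
    have "coding_nhd \<alpha> F q \<subseteq> coding_nhd \<alpha> F\<^sub>0 (prefix n)"
      by (rule coding_nhd_coarsen[of _ _ psnd]) (auto simp: F_def q_def)
    then have "factor \<beta> p = factor \<alpha> p"
      using \<beta>(1) F\<^sub>0(3) by (intro U(3)) blast
    moreover have "letter_map pfst ` Z = factor \<beta> p"
      using \<beta>(2) \<open>q' = q\<close> factor_letter_map[of pfst \<beta> q] by (simp add: q_def)
    ultimately show ?thesis by simp
  qed
  have "\<forall>B Z. finite B \<and> Z \<in> subshifts G B \<and> patterns F Z = patterns F (factor \<alpha> q) \<longrightarrow>
      letter_map pfst ` Z = factor \<alpha> p"
    by (intro allI impI, elim conjE) (rule wit)
  moreover have "\<forall>x. pfst (q x) = p x" by (simp add: q_def)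
  moreover have "finite F" "F \<subseteq> carrier G" "\<one> \<in> F"
    using F\<^sub>0(1,2) by (auto simp: F_def)
  ultimately show ?thesis
    using q by (intro exI[of _ q] exI[of _ F] conjI)
qed


section \<open>The topology on the space of subshifts\<close>

text \<open>Together with the next lemma: the pattern neighbourhoods are a basis of neighbourhoods in the
  Vietoris topology. A subshift inside an open set \<open>V\<close> is covered by cylinders over one finite window that
  lie in \<open>V\<close>.\<close>

lemma pattern_nbhd_basis:
  assumes "finite B" and U: "openin (subshift_topology G B) U" "Y \<in> U"
  shows "\<exists>F. finite F \<and> F \<subseteq> carrier G \<and> pattern_nbhd G B F Y \<subseteq> U"
proof -
  define \<S> where "\<S> = {{K. K \<subseteq> V} | V. openin (full_shift G B) V} \<union>
                       {{K. K \<inter> V \<noteq> {}} | V. openin (full_shift G B) V}"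
  obtain W where W: "openin (topology_generated_by \<S>) W"
      "U = W \<inter> {K. closedin (full_shift G B) K \<and> K \<noteq> {}} \<inter> subshifts G B"
    using U(1) unfolding subshift_topology_def vietoris_topology_def \<S>_def[symmetric] openin_subtopology
    by auto
  have "\<forall>Y\<in>subshifts G B \<inter> W. \<exists>F. finite F \<and> F \<subseteq> carrier G \<and> pattern_nbhd G B F Y \<subseteq> W"
    using openin_topology_generated_by[OF W(1)]
  proof (induction rule: generate_topology_on.induct)
    case Empty
    then show ?case by simp
  next
    case (Int a b)
    show ?case
    proof
      fix Y assume Y: "Y \<in> subshifts G B \<inter> (a \<inter> b)"
      obtain F where F: "finite F" "F \<subseteq> carrier G" "pattern_nbhd G B F Y \<subseteq> a"
        using bspec[OF Int.IH(1), of Y] Y by auto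
      obtain F' where F': "finite F'" "F' \<subseteq> carrier G" "pattern_nbhd G B F' Y \<subseteq> b"
        using bspec[OF Int.IH(2), of Y] Y by auto
      have "pattern_nbhd G B (F \<union> F') Y \<subseteq> pattern_nbhd G B F'' Y" if sub: "F'' \<subseteq> F \<union> F'" for F''
      proof
        fix Z assume "Z \<in> pattern_nbhd G B (F \<union> F') Y"
        then show "Z \<in> pattern_nbhd G B F'' Y"
          using patterns_mono[of "F \<union> F'" Z Y F''] sub by (simp add: pattern_nbhd_def)
      qed
      then have "pattern_nbhd G B (F \<union> F') Y \<subseteq> pattern_nbhd G B F Y \<inter> pattern_nbhd G B F' Y"
        by simp
      then show "\<exists>F. finite F \<and> F \<subseteq> carrier G \<and> pattern_nbhd G B F Y \<subseteq> a \<inter> b"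
        using F F' by (intro exI[of _ "F \<union> F'"]) auto
    qed
  next
    case (UN K)
    show ?case
    proof
      fix Y assume "Y \<in> subshifts G B \<inter> \<Union>K"
      then obtain k where k: "k \<in> K" "Y \<in> subshifts G B \<inter> k" by blast
      then obtain F where "finite F" "F \<subseteq> carrier G" "pattern_nbhd G B F Y \<subseteq> k"
        using UN.IH by meson
      then show "\<exists>F. finite F \<and> F \<subseteq> carrier G \<and> pattern_nbhd G B F Y \<subseteq> \<Union>K"
        using k(1) by (intro exI[of _ F]) auto
    qed
  next
    case (Basis s)
    then consider V where "s = {K. K \<subseteq> V}" "openin (full_shift G B) V"
      | V where "s = {K. K \<inter> V \<noteq> {}}" "openin (full_shift G B) V"
      unfolding \<S>_def by auto
    then show ?case
    proof cases
      case 1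
      show ?thesis
      proof
        fix Y assume Y: "Y \<in> subshifts G B \<inter> s"
        then have YV: "Y \<subseteq> V" "closedin (full_shift G B) Y"
          using 1 by (auto simp: subshifts_def)
        let ?top = "carrier G \<rightarrow>\<^sub>E B"
        have op: "openin (product_topology (\<lambda>_. discrete_topology B) (carrier G)) C"
          if "C \<in> {V, ?top - Y}" for C
          using that 1(2) YV(2) by (auto simp: full_shift_def closedin_def)
        have cov: "?top \<subseteq> \<Union>{V, ?top - Y}" using YV(1) by blast
        have "\<exists>K. finite K \<and> K \<subseteq> carrier G \<and>
            (\<forall>x\<in>?top. \<exists>C\<in>{V, ?top - Y}. \<forall>y\<in>?top. (\<forall>k\<in>K. y k = x k) \<longrightarrow> y \<in> C)"
          by (rule cylinder_refines_open_cover[OF assms(1) op cov])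
        then obtain K where K: "finite K" "K \<subseteq> carrier G"
            "\<forall>x\<in>?top. \<exists>C\<in>{V, ?top - Y}. \<forall>y\<in>?top. (\<forall>k\<in>K. y k = x k) \<longrightarrow> y \<in> C"
          by (elim exE conjE)
        have "Z \<subseteq> V" if Z: "Z \<in> pattern_nbhd G B K Y" for Z
        proof
          fix z assume z: "z \<in> Z"
          obtain y where y: "y \<in> Y" "\<forall>k\<in>K. y k = z k"
            using patterns_eqD[of K Z Y z] Z z by (auto simp: pattern_nbhd_def)
          have zt: "z \<in> ?top"
            using Z z subshift_extensional[of Z B z] by (auto simp: pattern_nbhd_def)
          have yt: "y \<in> ?top"
            using Y y(1) subshift_extensional[of Y B y] by auto
          obtain C where C: "C \<in> {V, ?top - Y}" "\<forall>y'\<in>?top. (\<forall>k\<in>K. y' k = y k) \<longrightarrow> y' \<in> C"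
            using bspec[OF K(3) yt] by blast
          have "y \<in> C" "z \<in> C" using C(2) yt zt y(2) by auto
          then show "z \<in> V" using C(1) y(1) by blast
        qed
        then have "pattern_nbhd G B K Y \<subseteq> s" using 1(1) by blast
        then show "\<exists>F. finite F \<and> F \<subseteq> carrier G \<and> pattern_nbhd G B F Y \<subseteq> s"
          using K(1,2) by blast
      qed
    next
      case 2
      show ?thesis
      proof
        fix Y assume Y: "Y \<in> subshifts G B \<inter> s"
        then obtain y where y: "y \<in> Y" "y \<in> V" using 2(1) by blast
        obtain K where K: "finite K" "K \<subseteq> carrier G"
            "\<forall>z\<in>carrier G \<rightarrow>\<^sub>E B. (\<forall>k\<in>K. z k = y k) \<longrightarrow> z \<in> V"
          using 2(2) y(2) unfolding full_shift_def openin_discrete_power_iff by meson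
        have "Z \<inter> V \<noteq> {}" if Z: "Z \<in> pattern_nbhd G B K Y" for Z
        proof -
          obtain z where z: "z \<in> Z" "\<forall>k\<in>K. z k = y k"
            using patterns_eqD[of K Y Z y] Z y(1) by (auto simp: pattern_nbhd_def)
          have "z \<in> carrier G \<rightarrow>\<^sub>E B"
            using Z z(1) subshift_extensional[of Z B z] by (auto simp: pattern_nbhd_def)
          then show ?thesis using K(3) z by auto
        qed
        then have "pattern_nbhd G B K Y \<subseteq> s" using 2(1) by blast
        then show "\<exists>F. finite F \<and> F \<subseteq> carrier G \<and> pattern_nbhd G B F Y \<subseteq> s"
          using K(1,2) by blast
      qed
    qed
  qed
  moreover have "Y \<in> subshifts G B \<inter> W" using U(2) W(2) by blast
  ultimately obtain F where F: "finite F" "F \<subseteq> carrier G" "pattern_nbhd G B F Y \<subseteq> W" by meson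
  have "pattern_nbhd G B F Y \<subseteq> U"
    using F(3) unfolding W(2) by (auto simp: pattern_nbhd_def subshifts_def)
  then show ?thesis using F(1,2) by blast
qed

lemma openin_pattern_nbhd:
  assumes "finite B" "finite F" "F \<subseteq> carrier G" and Y: "Y \<in> subshifts G B"
  shows "openin (subshift_topology G B) (pattern_nbhd G B F Y)"
proof -
  define \<S> where "\<S> = {{K. K \<subseteq> V} | V. openin (full_shift G B) V} \<union>
                       {{K. K \<inter> V \<noteq> {}} | V. openin (full_shift G B) V}"
  define cyl where "cyl = (\<lambda>P. {z \<in> carrier G \<rightarrow>\<^sub>E B. restrict z F \<in> P})"
  have op: "openin (full_shift G B) (cyl P)" for P
    unfolding full_shift_def openin_discrete_power_iff
  proof (intro conjI ballI)
    fix x assume x: "x \<in> cyl P"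
    have "y \<in> cyl P" if "y \<in> carrier G \<rightarrow>\<^sub>E B" "\<forall>k\<in>F. y k = x k" for y
    proof -
      have "restrict y F = restrict x F" using that(2) by (auto simp: fun_eq_iff)
      then show ?thesis using x that(1) by (simp add: cyl_def)
    qed
    then show "\<exists>K. finite K \<and> K \<subseteq> carrier G \<and> (\<forall>y\<in>carrier G \<rightarrow>\<^sub>E B. (\<forall>k\<in>K. y k = x k) \<longrightarrow> y \<in> cyl P)"
      using assms(2,3) by (intro exI[of _ F]) auto
  qed (auto simp: cyl_def)
  define \<O> where "\<O> = insert {K. K \<subseteq> cyl (patterns F Y)} ((\<lambda>w. {K. K \<inter> cyl {w} \<noteq> {}}) ` patterns F Y)"
  have "patterns F Y \<subseteq> F \<rightarrow>\<^sub>E B"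
    using subshift_extensional[OF Y] assms(3) by (fastforce simp: patterns_def PiE_iff)
  then have "finite (patterns F Y)"
    using assms(1,2) by (meson finite_PiE finite_subset)
  then have "finite \<O>" by (simp add: \<O>_def)
  moreover have "\<O> \<subseteq> \<S>" using op by (auto simp: \<O>_def \<S>_def)
  then have "openin (topology_generated_by \<S>) S" if "S \<in> \<O>" for S
    using that by (intro topology_generated_by_Basis) blast
  ultimately have "openin (topology_generated_by \<S>) (\<Inter>\<O>)"
    by (intro openin_Inter) (auto simp: \<O>_def)
  moreover have "pattern_nbhd G B F Y = \<Inter>\<O> \<inter> {K. closedin (full_shift G B) K \<and> K \<noteq> {}} \<inter> subshifts G B"
  proof -
    have "patterns F Z = patterns F Y \<longleftrightarrow> Z \<in> \<Inter>\<O>" if Z: "Z \<in> subshifts G B" for Z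
    proof -
      have "Z \<subseteq> cyl (patterns F Y) \<longleftrightarrow> patterns F Z \<subseteq> patterns F Y"
        using subshift_extensional[OF Z] by (auto simp: cyl_def patterns_def)
      moreover have "Z \<inter> cyl {w} \<noteq> {} \<longleftrightarrow> w \<in> patterns F Z" for w
      proof -
        have "Z \<inter> cyl {w} = {z \<in> Z. restrict z F = w}"
          using subshift_extensional[OF Z] by (auto simp: cyl_def)
        then show ?thesis by (auto simp: patterns_def)
      qed
      ultimately show ?thesis unfolding \<O>_def by auto
    qed
    then show ?thesis
      by (auto simp: pattern_nbhd_def subshifts_def)
  qed
  ultimately show ?thesis
    unfolding subshift_topology_def vietoris_topology_def \<S>_def[symmetric] openin_subtopology
    by (metis (no_types, lifting))
qed

text \<open>This lemma and the next one replace Hausdorff distances by patterns on finite windows.\<close>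

lemma hausdorff_dist_small_if_patterns_eq:
  assumes m: "mtopology_of m = full_shift G A" and "finite A" "\<epsilon> > 0"
  shows "\<exists>K. finite K \<and> K \<subseteq> carrier G \<and>
           (\<forall>X\<in>subshifts G A. \<forall>Y\<in>subshifts G A. patterns K X = patterns K Y \<longrightarrow> hausdorff_dist m X Y \<le> \<epsilon>)"
proof -
  interpret m: Metric_space "mspace m" "mdist m" by (rule Metric_space_mspace_mdist)
  obtain K where K: "finite K" "K \<subseteq> carrier G"
      "\<forall>x\<in>carrier G \<rightarrow>\<^sub>E A. \<forall>y\<in>carrier G \<rightarrow>\<^sub>E A. (\<forall>k\<in>K. x k = y k) \<longrightarrow> mdist m x y < \<epsilon>"
    using discrete_power_metric_small_if_agree[OF m[unfolded full_shift_def] assms(2,3)]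
    by (elim exE conjE)
  have "hausdorff_dist m X Y \<le> \<epsilon>"
    if X: "X \<in> subshifts G A" and Y: "Y \<in> subshifts G A" and eq: "patterns K X = patterns K Y" for X Y
  proof -
    have close: "(INF y\<in>Q. mdist m x y) \<le> \<epsilon>"
      if PQ: "P \<in> subshifts G A" "Q \<in> subshifts G A" "patterns K P = patterns K Q" "x \<in> P" for P Q x
    proof -
      obtain y where y: "y \<in> Q" "\<forall>k\<in>K. y k = x k"
        using patterns_eqD[OF PQ(3,4)] by blast
      have "mdist m x y < \<epsilon>"
        using K(3) y subshift_extensional[OF PQ(1,4)] subshift_extensional[OF PQ(2) y(1)] by simp
      then show ?thesis
        by (intro cINF_lower2[OF _ y(1)] bdd_belowI2[of _ 0]) simp_all
    qed
    have ne: "X \<noteq> {}" "Y \<noteq> {}" using X Y by (auto simp: subshifts_def)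
    have "(SUP x\<in>X. INF y\<in>Y. mdist m x y) \<le> \<epsilon>"
      using close[OF X Y eq] ne by (intro cSUP_least) auto
    moreover have "(SUP y\<in>Y. INF x\<in>X. mdist m x y) \<le> \<epsilon>"
      using close[OF Y X eq[symmetric]] ne by (intro cSUP_least) (auto simp: m.commute)
    ultimately show ?thesis by (simp add: hausdorff_dist_def)
  qed
  then show ?thesis using K(1,2) by blast
qed

lemma patterns_eq_if_hausdorff_dist_small:
  assumes m: "mtopology_of m = full_shift G A" and "finite A" "finite K" "K \<subseteq> carrier G"
  shows "\<exists>\<epsilon>>0. \<forall>X\<in>subshifts G A. \<forall>Y\<in>subshifts G A. hausdorff_dist m X Y \<le> \<epsilon> \<longrightarrow> patterns K X = patterns K Y"
proof -
  interpret m: Metric_space "mspace m" "mdist m" by (rule Metric_space_mspace_mdist)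
  obtain \<delta> where \<delta>: "\<delta> > 0"
      "\<forall>x\<in>carrier G \<rightarrow>\<^sub>E A. \<forall>y\<in>carrier G \<rightarrow>\<^sub>E A. mdist m x y < \<delta> \<longrightarrow> (\<forall>k\<in>K. x k = y k)"
    using discrete_power_metric_agree_if_small[OF m[unfolded full_shift_def] assms(2-4)]
    by (elim exE conjE)
  have ms: "mspace m = carrier G \<rightarrow>\<^sub>E A"
    using arg_cong[OF m, of topspace] by (simp add: full_shift_def)
  have "compact_space m.mtopology"
    using compact_space_discrete_power[OF assms(2), of "carrier G"] m
    by (simp add: mtopology_of_def full_shift_def)
  then have "compactin m.mtopology (mspace m)"
    by (simp add: compact_space_def)
  then have "m.mbounded (mspace m)"
    by (rule m.compactin_imp_mbounded)
  then obtain D where "\<forall>x\<in>mspace m. \<forall>y\<in>mspace m. mdist m x y \<le> D"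
    unfolding m.mbounded_alt by (elim conjE exE)
  then have D: "mdist m x y \<le> D" if "x \<in> carrier G \<rightarrow>\<^sub>E A" "y \<in> carrier G \<rightarrow>\<^sub>E A" for x y
    using that unfolding ms by simp
  have "patterns K X = patterns K Y"
    if X: "X \<in> subshifts G A" and Y: "Y \<in> subshifts G A" and h: "hausdorff_dist m X Y \<le> \<delta> / 2" for X Y
  proof -
    have sub: "patterns K P \<subseteq> patterns K Q"
      if P: "P \<in> subshifts G A" and Q: "Q \<in> subshifts G A" and le: "(SUP x\<in>P. INF y\<in>Q. mdist m x y) \<le> \<delta> / 2"
      for P Q
    proof -
      have "restrict x K \<in> patterns K Q" if x: "x \<in> P" for x
      proof -
        obtain y\<^sub>0 where y\<^sub>0: "y\<^sub>0 \<in> Q" using Q by (auto simp: subshifts_def)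
        have bb: "bdd_below (mdist m x' ` Q)" for x'
          by (rule bdd_belowI2[of _ 0]) simp
        have "bdd_above ((\<lambda>x. INF y\<in>Q. mdist m x y) ` P)"
        proof (rule bdd_aboveI2)
          fix x' assume "x' \<in> P"
          then have "mdist m x' y\<^sub>0 \<le> D"
            using D subshift_extensional[OF P] subshift_extensional[OF Q y\<^sub>0] by blast
          then show "(INF y\<in>Q. mdist m x' y) \<le> D"
            by (rule cINF_lower2[OF bb y\<^sub>0])
        qed
        then have "(INF y\<in>Q. mdist m x y) \<le> (SUP x\<in>P. INF y\<in>Q. mdist m x y)"
          using x by (rule cSUP_upper[rotated])
        then have "(INF y\<in>Q. mdist m x y) < \<delta>"
          using le \<delta>(1) by simp
        then obtain y where y: "y \<in> Q" "mdist m x y < \<delta>"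
          using cINF_less_iff[OF _ bb] y\<^sub>0 by blast
        then have "\<forall>k\<in>K. x k = y k"
          using \<delta>(2) subshift_extensional[OF P x] subshift_extensional[OF Q y(1)] by simp
        then show ?thesis
          unfolding patterns_iff using y(1) by (intro bexI[of _ y]) auto
      qed
      then show ?thesis by (auto simp: patterns_def)
    qed
    have "(SUP x\<in>X. INF y\<in>Y. mdist m x y) \<le> \<delta> / 2" "(SUP y\<in>Y. INF x\<in>X. mdist m x y) \<le> \<delta> / 2"
      using h by (simp_all add: hausdorff_dist_def)
    then show ?thesis
      using sub[OF X Y] sub[OF Y X] by (simp add: m.commute)
  qed
  then show ?thesis using \<delta>(1) by (intro exI[of _ "\<delta> / 2"]) simp
qed


section \<open>Density of stable actions\<close>

text \<open>The condition to which each of the three conditions of the theorem is shown to be equivalent.\<close>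

definition stable_dense :: bool where
  "stable_dense \<longleftrightarrow>
     (\<forall>p. labelling p \<longrightarrow> Act closure_of stable p = actions G)"

lemma stable_dense_iff_meets:
  "stable_dense \<longleftrightarrow>
     (\<forall>p. labelling p \<longrightarrow>
       (\<forall>\<alpha>\<in>actions G. \<forall>F n. finite F \<and> F \<subseteq> carrier G \<longrightarrow> coding_nhd \<alpha> F (prefix n) \<inter> stable p \<noteq> {}))"
proof -
  have "Act closure_of stable p = actions G \<longleftrightarrow>
      (\<forall>\<alpha>\<in>actions G. \<forall>F n. finite F \<and> F \<subseteq> carrier G \<longrightarrow> coding_nhd \<alpha> F (prefix n) \<inter> stable p \<noteq> {})"
    (is "?L \<longleftrightarrow> ?R") for p
  proof
    assume L: ?L
    show ?R
    proof (intro ballI allI impI)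
      fix \<alpha> F n assume \<alpha>: "\<alpha> \<in> actions G" and F: "finite F \<and> F \<subseteq> carrier G"
      have "openin Act (coding_nhd \<alpha> F (prefix n))"
        using F labelling_prefix by (intro openin_coding_nhd) auto
      moreover have "\<alpha> \<in> Act closure_of stable p" using L \<alpha> by simp
      ultimately have "\<exists>\<beta>. \<beta> \<in> stable p \<and> \<beta> \<in> coding_nhd \<alpha> F (prefix n)"
        using coding_nhd_refl[OF \<alpha>, of F "prefix n"] unfolding in_closure_of by meson
      then show "coding_nhd \<alpha> F (prefix n) \<inter> stable p \<noteq> {}" by blast
    qed
  next
    assume R: ?R
    have "\<alpha> \<in> Act closure_of stable p" if \<alpha>: "\<alpha> \<in> actions G" for \<alpha>
      unfolding in_closure_of
    proof (intro conjI allI impI)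
      show "\<alpha> \<in> topspace Act" using \<alpha> by simp
      fix T assume "\<alpha> \<in> T \<and> openin Act T"
      then obtain F n where F: "finite F" "F \<subseteq> carrier G" "coding_nhd \<alpha> F (prefix n) \<subseteq> T"
        using coding_nhd_basis by meson
      then have "coding_nhd \<alpha> F (prefix n) \<inter> stable p \<noteq> {}" using R \<alpha> by simp
      then show "\<exists>y. y \<in> stable p \<and> y \<in> T" using F(3) by blast
    qed
    then show ?L
      using closure_of_subset_topspace[of "Act"] by auto
  qed
  then show ?thesis unfolding stable_dense_def by simp
qed

text \<open>The fibres of \<open>\<lambda>\<alpha>. factor \<alpha> p\<close> are closed. If countably many of them cover a comeager set, then
  by Baire category their interiors are dense, and an interior point of a fibre is stable.\<close>

lemma stable_dense_if_countably_many_factors: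
  assumes "\<And>p :: cantor \<Rightarrow> nat. labelling p \<Longrightarrow>
             \<exists>S \<X>. comeager_in Act S \<and> countable \<X> \<and> (\<forall>\<alpha>\<in>S. factor \<alpha> p \<in> \<X>)"
  shows stable_dense
  unfolding stable_dense_def
proof (intro allI impI)
  fix p :: "cantor \<Rightarrow> nat" assume p: "labelling p"
  obtain S \<X> where S: "comeager_in Act S" "countable \<X>" "\<And>\<alpha>. \<alpha> \<in> S \<Longrightarrow> factor \<alpha> p \<in> \<X>"
    using assms[OF p] by blast
  define \<X>' where "\<X>' = \<X> \<inter> (\<lambda>\<alpha>. factor \<alpha> p) ` actions G"
  define \<E> where "\<E> = (\<lambda>X. {\<beta> \<in> actions G. factor \<beta> p = X}) ` \<X>'"
  have SA: "S \<subseteq> actions G" using S(1) by (simp add: comeager_in_def)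
  have "Act closure_of (\<Union>E\<in>\<E>. Act interior_of E) = topspace Act"
  proof (rule comeager_in_countable_closed_cover[OF completely_metrizable_action_topology S(1)])
    show "countable \<E>" unfolding \<E>_def \<X>'_def using S(2) by simp
    show "closedin Act E" if E: "E \<in> \<E>" for E
    proof -
      obtain X where X: "X \<in> \<X>'" "E = {\<beta> \<in> actions G. factor \<beta> p = X}"
        using E unfolding \<E>_def by blast
      have "X \<in> subshifts G (range p)"
        using X(1) factor_subshift[OF _ p order_refl] unfolding \<X>'_def by auto
      then show ?thesis unfolding X(2) by (rule closedin_factor_fibre[OF p])
    qed
    show "S \<subseteq> \<Union>\<E>"
    proof
      fix \<alpha> assume "\<alpha> \<in> S"
      then have "factor \<alpha> p \<in> \<X>'" "\<alpha> \<in> actions G" using S(3) SA by (auto simp: \<X>'_def)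
      then show "\<alpha> \<in> \<Union>\<E>" unfolding \<E>_def by blast
    qed
  qed
  moreover have "Act interior_of E \<subseteq> stable p" if E: "E \<in> \<E>" for E
  proof
    fix \<alpha> assume \<alpha>: "\<alpha> \<in> Act interior_of E"
    obtain X where X: "E = {\<beta> \<in> actions G. factor \<beta> p = X}"
      using E unfolding \<E>_def by blast
    have "factor \<beta> p = X" if "\<beta> \<in> Act interior_of E" for \<beta>
      using that interior_of_subset[of "Act" E] X by blast
    then show "\<alpha> \<in> stable p"
      using \<alpha> unfolding stable_def
      by (intro CollectI exI[of _ "Act interior_of E"]) simp
  qed
  then have "(\<Union>E\<in>\<E>. Act interior_of E) \<subseteq> stable p" by (rule UN_least)
  ultimately have "actions G \<subseteq> Act closure_of stable p"
    by (metis closure_of_mono topspace_action_topology)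
  then show "Act closure_of stable p = actions G"
    using closure_of_subset_topspace[of "Act"] by auto
qed

lemma comeager_stable:
  assumes stable_dense
  shows "comeager_in Act {\<alpha> \<in> actions G. \<forall>p. labelling p \<longrightarrow> \<alpha> \<in> stable p}"
proof -
  have "comeager_in Act
          (topspace Act \<inter> \<Inter>(stable ` {p. labelling p}))"
    using assms openin_stable countable_labelling
    by (intro comeager_in_Inter_open_dense) (auto simp: stable_dense_def)
  moreover have "topspace Act \<inter> \<Inter>(stable ` {p. labelling p}) =
      {\<alpha> \<in> actions G. \<forall>p. labelling p \<longrightarrow> \<alpha> \<in> stable p}"
    by auto
  ultimately show ?thesis by simp
qed

text \<open>Along a conjugacy class the factors given by \<open>p\<close> are the factors of one fixed action given by the
  labellings \<open>p \<circ> \<phi>\<close>, and there are only countably many labellings.\<close>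

lemma strong_topological_Rokhlin_imp_stable_dense:
  assumes "strong_topological_Rokhlin G"
  shows stable_dense
proof (rule stable_dense_if_countably_many_factors)
  fix p :: "cantor \<Rightarrow> nat" assume p: "labelling p"
  obtain \<alpha> where \<alpha>: "\<alpha> \<in> actions G"
      "comeager_in Act {conj_action G \<phi> \<alpha> | \<phi>. \<phi> \<in> carrier homeo_group}"
    using assms unfolding strong_topological_Rokhlin_def by blast
  have "factor (conj_action G \<phi> \<alpha>) p \<in> factor \<alpha> ` {q :: cantor \<Rightarrow> nat. labelling q}"
    if "\<phi> \<in> carrier homeo_group" for \<phi>
  proof -
    have "continuous_map cantor_space cantor_space \<phi>"
      using that by (auto simp: homeo_group_def dest: homeomorphic_imp_continuous_map)
    from labelling_compose[OF this p] show ?thesis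
      by (simp add: factor_conj_action[OF that] o_def)
  qed
  then show "\<exists>S \<X>. comeager_in Act S \<and> countable \<X> \<and> (\<forall>\<alpha>\<in>S. factor \<alpha> p \<in> \<X>)"
    using \<alpha>(2) countable_image[OF countable_labelling, of "factor \<alpha>"]
    by (intro exI[of _ "{conj_action G \<phi> \<alpha> | \<phi>. \<phi> \<in> carrier homeo_group}"]
        exI[of _ "factor \<alpha> ` {q :: cantor \<Rightarrow> nat. labelling q}"]) blast
qed


section \<open>Shadowing\<close>

lemma cantor_metric_small_if_agree:
  assumes "mtopology_of \<rho> = cantor_space" "\<epsilon> > 0"
  shows "\<exists>n. \<forall>x y. agree n x y \<longrightarrow> mdist \<rho> x y < \<epsilon>"
proof -
  obtain K :: "nat set" where K: "finite K"
      "\<forall>x\<in>UNIV \<rightarrow>\<^sub>E UNIV. \<forall>y\<in>UNIV \<rightarrow>\<^sub>E UNIV. (\<forall>k\<in>K. x k = y k) \<longrightarrow> mdist \<rho> x y < \<epsilon>"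
    using discrete_power_metric_small_if_agree[OF assms(1)[unfolded cantor_space_def] finite_class.finite_UNIV assms(2)]
    by (elim exE conjE)
  obtain n where "\<forall>k\<in>K. k < n"
    using finite_nat_subset_lessThan[OF K(1)] by blast
  then show ?thesis
    using K(2) by (intro exI[of _ n]) (simp add: agree_def PiE_UNIV_domain)
qed

lemma cantor_metric_agree_if_small:
  assumes "mtopology_of \<rho> = cantor_space"
  shows "\<exists>\<delta>>0. \<forall>x y. mdist \<rho> x y < \<delta> \<longrightarrow> agree n x y"
  using discrete_power_metric_agree_if_small[OF assms[unfolded cantor_space_def] finite_class.finite_UNIV
      finite_lessThan[of n]]
  by (simp add: agree_def PiE_UNIV_domain Ball_def)

text \<open>Shadowing with errors measured by labellings: an error is small if \<open>q\<close>, or \<open>p\<close>, does not see it.\<close>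

definition label_shadowing :: "('g \<Rightarrow> cantor \<Rightarrow> cantor) \<Rightarrow> bool" where
  "label_shadowing \<alpha> \<longleftrightarrow>
     (\<forall>p :: cantor \<Rightarrow> nat. labelling p \<longrightarrow>
        (\<exists>(q :: cantor \<Rightarrow> nat) S. labelling q \<and> finite S \<and> S \<subseteq> carrier G \<and>
           (\<forall>x. (\<forall>g\<in>carrier G. \<forall>s\<in>S. q (\<alpha> s (x g)) = q (x (s \<otimes> g))) \<longrightarrow>
                (\<exists>z. \<forall>g\<in>carrier G. p (x g) = p (\<alpha> g z)))))"

lemma has_shadowing_iff_label_shadowing:
  assumes \<rho>: "mtopology_of \<rho> = cantor_space"
  shows "has_shadowing G \<rho> \<alpha> \<longleftrightarrow> label_shadowing \<alpha>"
proof
  have ms: "mspace \<rho> = UNIV"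
    using arg_cong[OF \<rho>, of topspace] by simp
  {
    assume sh: "has_shadowing G \<rho> \<alpha>"
    show "label_shadowing \<alpha>"
      unfolding label_shadowing_def
    proof (intro allI impI)
      fix p :: "cantor \<Rightarrow> nat" assume "labelling p"
      then obtain n where n: "\<And>x y. agree n x y \<Longrightarrow> p x = p y"
        unfolding labelling_def by blast
      obtain \<epsilon> where \<epsilon>: "\<epsilon> > 0" "\<forall>x y. mdist \<rho> x y < \<epsilon> \<longrightarrow> agree n x y"
        using cantor_metric_agree_if_small[OF \<rho>, of n] by blast
      have "\<exists>\<delta>>0. \<exists>S. finite S \<and> S \<subseteq> carrier G \<and>
          (\<forall>x. pseudo_orbit G \<rho> \<alpha> \<delta> S x \<longrightarrow> (\<exists>z\<in>mspace \<rho>. \<forall>g\<in>carrier G. mdist \<rho> (x g) (\<alpha> g z) < \<epsilon>))"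
        using sh \<epsilon>(1) by (simp add: has_shadowing_def)
      then obtain \<delta> S where S: "\<delta> > 0" "finite S" "S \<subseteq> carrier G"
          "\<forall>x. pseudo_orbit G \<rho> \<alpha> \<delta> S x \<longrightarrow> (\<exists>z\<in>mspace \<rho>. \<forall>g\<in>carrier G. mdist \<rho> (x g) (\<alpha> g z) < \<epsilon>)"
        by (elim exE conjE)
      obtain m where m: "\<forall>x y. agree m x y \<longrightarrow> mdist \<rho> x y < \<delta>"
        using cantor_metric_small_if_agree[OF \<rho> S(1)] by blast
      have "\<exists>z. \<forall>g\<in>carrier G. p (x g) = p (\<alpha> g z)"
        if x: "\<forall>g\<in>carrier G. \<forall>s\<in>S. prefix m (\<alpha> s (x g)) = prefix m (x (s \<otimes> g))" for x
      proof -
        have "pseudo_orbit G \<rho> \<alpha> \<delta> S x"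
          using x m by (simp add: pseudo_orbit_def ms prefix_eq_iff)
        then obtain z where "\<forall>g\<in>carrier G. mdist \<rho> (x g) (\<alpha> g z) < \<epsilon>"
          using S(4) by blast
        then show ?thesis
          using n \<epsilon>(2) by (intro exI[of _ z]) simp
      qed
      then show "\<exists>(q :: cantor \<Rightarrow> nat) S. labelling q \<and> finite S \<and> S \<subseteq> carrier G \<and>
           (\<forall>x. (\<forall>g\<in>carrier G. \<forall>s\<in>S. q (\<alpha> s (x g)) = q (x (s \<otimes> g))) \<longrightarrow>
                (\<exists>z. \<forall>g\<in>carrier G. p (x g) = p (\<alpha> g z)))"
        using S(2,3) labelling_prefix[of m]
        by (intro exI[of _ "prefix m"] exI[of _ S]) simp
    qed
  next
    assume sh: "label_shadowing \<alpha>"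
    show "has_shadowing G \<rho> \<alpha>"
      unfolding has_shadowing_def
    proof (intro allI impI)
      fix \<epsilon> :: real assume "\<epsilon> > 0"
      then obtain n where n: "\<forall>x y. agree n x y \<longrightarrow> mdist \<rho> x y < \<epsilon>"
        using cantor_metric_small_if_agree[OF \<rho>] by blast
      obtain q :: "cantor \<Rightarrow> nat" and S where S: "labelling q" "finite S" "S \<subseteq> carrier G"
          "\<And>x. \<forall>g\<in>carrier G. \<forall>s\<in>S. q (\<alpha> s (x g)) = q (x (s \<otimes> g)) \<Longrightarrow>
             \<exists>z. \<forall>g\<in>carrier G. prefix n (x g) = prefix n (\<alpha> g z)"
        using sh labelling_prefix[of n] unfolding label_shadowing_def by metis
      obtain m where m: "\<And>x y. agree m x y \<Longrightarrow> q x = q y"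
        using S(1) unfolding labelling_def by blast
      obtain \<delta> where \<delta>: "\<delta> > 0" "\<forall>x y. mdist \<rho> x y < \<delta> \<longrightarrow> agree m x y"
        using cantor_metric_agree_if_small[OF \<rho>, of m] by blast
      have "\<exists>z\<in>mspace \<rho>. \<forall>g\<in>carrier G. mdist \<rho> (x g) (\<alpha> g z) < \<epsilon>"
        if x: "pseudo_orbit G \<rho> \<alpha> \<delta> S x" for x
      proof -
        have "\<forall>g\<in>carrier G. \<forall>s\<in>S. q (\<alpha> s (x g)) = q (x (s \<otimes> g))"
          using x m \<delta>(2) by (simp add: pseudo_orbit_def)
        then obtain z where "\<forall>g\<in>carrier G. prefix n (x g) = prefix n (\<alpha> g z)"
          using S(4) by blast
        then show ?thesis
          using n by (intro bexI[of _ z]) (simp_all add: ms prefix_eq_iff)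
      qed
      then show "\<exists>\<delta>>0. \<exists>S. finite S \<and> S \<subseteq> carrier G \<and>
          (\<forall>x. pseudo_orbit G \<rho> \<alpha> \<delta> S x \<longrightarrow> (\<exists>z\<in>mspace \<rho>. \<forall>g\<in>carrier G. mdist \<rho> (x g) (\<alpha> g z) < \<epsilon>))"
        using S(2,3) \<delta>(1) by (intro exI[of _ \<delta>] conjI exI[of _ S] allI impI)
    qed
  }
qed

text \<open>The subshift of finite type given by the allowed patterns \<open>M\<close> on \<open>F\<close>. For \<open>M = patterns F X\<close> it is the largest
  subshift with the same patterns on \<open>F\<close> as \<open>X\<close>.\<close>

definition finite_type :: "'g set \<Rightarrow> ('g \<Rightarrow> 'v) set \<Rightarrow> ('g \<Rightarrow> 'v) set" where
  "finite_type F M =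
     {y \<in> extensional (carrier G). \<forall>g\<in>carrier G. restrict (shift G (inv g) y) F \<in> M}"

lemma restrict_shift_inv:
  assumes "g \<in> carrier G" "F \<subseteq> carrier G"
  shows "restrict (shift G (inv g) y) F = restrict (\<lambda>f. y (g \<otimes> f)) F"
  using assms by (auto simp: shift_inv_apply fun_eq_iff)

lemma subset_finite_type:
  assumes X: "X \<in> subshifts G A"
  shows "X \<subseteq> finite_type F (patterns F X)"
proof
  fix x assume x: "x \<in> X"
  then show "x \<in> finite_type F (patterns F X)"
    using subshift_extensional[OF X x] subshift_shift[OF X x]
    by (simp add: finite_type_def PiE_iff patterns_def)
qed

lemma patterns_finite_type:
  assumes X: "X \<in> subshifts G A"
  shows "patterns F (finite_type F (patterns F X)) = patterns F X"
proof
  show "patterns F X \<subseteq> patterns F (finite_type F (patterns F X))"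
    using subset_finite_type[OF X, of F] by (auto simp: patterns_def)
  show "patterns F (finite_type F (patterns F X)) \<subseteq> patterns F X"
  proof
    fix w assume "w \<in> patterns F (finite_type F (patterns F X))"
    then obtain y where y: "y \<in> finite_type F (patterns F X)" "w = restrict y F"
      by (auto simp: patterns_def)
    have "restrict (shift G (inv \<one>) y) F \<in> patterns F X"
      using y(1) by (simp add: finite_type_def del: inv_one)
    moreover have "shift G (inv \<one>) y = y"
      using y(1) by (simp add: finite_type_def shift_one)
    ultimately show "w \<in> patterns F X" using y(2) by simp
  qed
qed

lemma finite_type_subshift:
  assumes X: "X \<in> subshifts G A" and F: "finite F" "F \<subseteq> carrier G" "\<one> \<in> F"
  shows "finite_type F (patterns F X) \<in> subshifts G A" (is "?Z \<in> _")
proof (rule subshiftI_closed_invariant)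
  have "y g \<in> A" if y: "y \<in> ?Z" and g: "g \<in> carrier G" for y g
  proof -
    have "restrict (\<lambda>f. y (g \<otimes> f)) F \<in> patterns F X"
      unfolding restrict_shift_inv[OF g F(2), symmetric] using y g by (simp add: finite_type_def)
    then obtain x where x: "x \<in> X" "\<forall>k\<in>F. x k = y (g \<otimes> k)"
      unfolding patterns_iff by blast
    then have "x \<one> = y g" using F(3) g by simp
    then show ?thesis
      using subshift_extensional[OF X x(1)] by (metis PiE_mem one_closed)
  qed
  then have eq: "?Z = local_rule A F (\<lambda>w. w \<in> patterns F X)"
    using F(2) by (auto simp: finite_type_def local_rule_def PiE_iff restrict_shift_inv simp del: restrict_apply)
  show "closedin (full_shift G A) ?Z"
    unfolding eq by (rule closedin_local_rule[OF F(1,2)])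
  show "shift G g z \<in> ?Z" if "g \<in> carrier G" "z \<in> ?Z" for g z
    using that(2) unfolding eq by (rule shift_local_rule[OF _ F(2) that(1)])
  show "?Z \<noteq> {}"
    using subset_finite_type[OF X, of F] X by (auto simp: subshifts_def)
qed

text \<open>A point of the subshift of finite type is locally a coding: around each \<open>inv g\<close> it agrees with the
  coding of some point \<open>x g\<close>. These points form a pseudo-orbit, and a point shadowing it has the image of the
  given point as its coding.\<close>

lemma factor_eq_image_finite_type:
  assumes \<alpha>: "\<alpha> \<in> actions G" and "label_shadowing \<alpha>" and p: "labelling p"
  shows "\<exists>t F. labelling t \<and> finite F \<and> F \<subseteq> carrier G \<and>
           factor \<alpha> p = letter_map pfst ` finite_type F (patterns F (factor \<alpha> t))"
proof -
  obtain q :: "cantor \<Rightarrow> nat" and S where S: "labelling q" "finite S" "S \<subseteq> carrier G"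
      "\<And>x. \<forall>g\<in>carrier G. \<forall>s\<in>S. q (\<alpha> s (x g)) = q (x (s \<otimes> g)) \<Longrightarrow>
         \<exists>z. \<forall>g\<in>carrier G. p (x g) = p (\<alpha> g z)"
    using assms(2) p unfolding label_shadowing_def by metis
  define t where "t = pair p q"
  define F where "F = insert \<one> ((\<lambda>s. inv s) ` S)"
  have F: "finite F" "F \<subseteq> carrier G" "\<one> \<in> F"
    using S(2,3) by (auto simp: F_def)
  have t: "labelling t"
    unfolding t_def by (rule labelling_pair[OF p S(1)])
  have fac: "factor \<alpha> p = letter_map pfst ` factor \<alpha> t"
    by (simp add: factor_letter_map t_def)
  have "letter_map pfst y \<in> factor \<alpha> p" if y: "y \<in> finite_type F (patterns F (factor \<alpha> t))" for y
  proof -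
    have "\<exists>x. \<forall>f\<in>F. coding \<alpha> t x f = y (inv g \<otimes> f)" if g: "g \<in> carrier G" for g
    proof -
      have "restrict (shift G (inv (inv g)) y) F \<in> patterns F (factor \<alpha> t)"
        using y g unfolding finite_type_def by blast
      then have "restrict (\<lambda>f. y (inv g \<otimes> f)) F \<in> patterns F (factor \<alpha> t)"
        unfolding restrict_shift_inv[OF inv_closed[OF g] F(2)] .
      then show ?thesis
        unfolding patterns_iff factor_def by blast
    qed
    then obtain x where x: "\<And>g f. g \<in> carrier G \<Longrightarrow> f \<in> F \<Longrightarrow> coding \<alpha> t (x g) f = y (inv g \<otimes> f)"
      by metis
    have tx: "t (x g) = y (inv g)" if "g \<in> carrier G" for g
      using x[OF that F(3)] that by (simp add: coding_one[OF \<alpha>])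
    have "q (\<alpha> s (x g)) = q (x (s \<otimes> g))" if g: "g \<in> carrier G" and s: "s \<in> S" for g s
    proof -
      have sc: "s \<in> carrier G" using s S(3) by blast
      have "t (\<alpha> s (x g)) = coding \<alpha> t (x g) (inv s)"
        using sc by (simp add: coding_def)
      also have "\<dots> = y (inv g \<otimes> inv s)"
        using s by (intro x[OF g]) (simp add: F_def)
      also have "\<dots> = t (x (s \<otimes> g))"
        using tx[of "s \<otimes> g"] sc g by (simp add: inv_mult_group)
      finally have "psnd (t (\<alpha> s (x g))) = psnd (t (x (s \<otimes> g)))" by simp
      then show ?thesis by (simp add: t_def)
    qed
    then obtain z where z: "\<forall>g\<in>carrier G. p (x g) = p (\<alpha> g z)"
      using S(4) by blast
    have "letter_map pfst y = coding \<alpha> p z"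
    proof
      fix g
      have "pfst (y g) = p (\<alpha> (inv g) z)" if "g \<in> carrier G"
      proof -
        have "y g = t (x (inv g))"
          using tx[OF inv_closed[OF that]] that by simp
        then show ?thesis
          using z that by (simp add: t_def)
      qed
      then show "letter_map pfst y g = coding \<alpha> p z g"
        by (simp add: letter_map_def coding_def)
    qed
    then show ?thesis by (simp add: factor_def)
  qed
  moreover have "factor \<alpha> t \<subseteq> finite_type F (patterns F (factor \<alpha> t))"
    by (rule subset_finite_type[OF factor_subshift[OF \<alpha> t order_refl]])
  ultimately have "factor \<alpha> p = letter_map pfst ` finite_type F (patterns F (factor \<alpha> t))"
    unfolding fac by blast
  then show ?thesis using t F(1,2) by blast
qed

text \<open>The countable index set of the Baire category arguments: windows together with a possible set of
  patterns on them.\<close>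

definition pattern_data :: "('g set \<times> ('g \<Rightarrow> nat) set) set" where
  "pattern_data = (SIGMA F:{F. finite F \<and> F \<subseteq> carrier G}. {M. finite M \<and> M \<subseteq> F \<rightarrow>\<^sub>E UNIV})"

lemma countable_pattern_data: "countable pattern_data"
  unfolding pattern_data_def
  by (intro countable_SIGMA countable_Collect_finite_subset countable_carrier countable_PiE) auto

lemma pattern_data_patterns:
  assumes "X \<in> subshifts G A" "finite A" "finite F" "F \<subseteq> carrier G"
  shows "(F, patterns F X) \<in> pattern_data"
proof -
  have "patterns F X \<subseteq> F \<rightarrow>\<^sub>E A"
    using subshift_extensional[OF assms(1)] assms(4) by (fastforce simp: patterns_def PiE_iff)
  then have "finite (patterns F X)"
    using assms(2,3) by (meson finite_PiE finite_subset)
  moreover have "patterns F X \<subseteq> F \<rightarrow>\<^sub>E UNIV"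
    by (auto simp: patterns_def)
  ultimately show ?thesis
    using assms(3,4) by (simp add: pattern_data_def)
qed

text \<open>An action with shadowing has its factor given by \<open>p\<close> determined by a window and a finite set of
  patterns, so only countably many subshifts occur.\<close>

lemma shadowing_generic_imp_stable_dense:
  assumes \<rho>: "mtopology_of \<rho> = cantor_space" and sh: "shadowing_generic G \<rho>"
  shows stable_dense
proof (rule stable_dense_if_countably_many_factors)
  fix p :: "cantor \<Rightarrow> nat" assume p: "labelling p"
  define \<X> where "\<X> = (\<lambda>(F, M). letter_map pfst ` finite_type F M) ` pattern_data"
  have "factor \<alpha> p \<in> \<X>" if \<alpha>: "\<alpha> \<in> actions G" "has_shadowing G \<rho> \<alpha>" for \<alpha>
  proof -
    have "label_shadowing \<alpha>"
      using \<alpha>(2) has_shadowing_iff_label_shadowing[OF \<rho>] by blast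
    then obtain t F where t: "labelling t" "finite F" "F \<subseteq> carrier G"
        "factor \<alpha> p = letter_map pfst ` finite_type F (patterns F (factor \<alpha> t))"
      using factor_eq_image_finite_type[OF \<alpha>(1) _ p] by blast
    have "(F, patterns F (factor \<alpha> t)) \<in> pattern_data"
      by (rule pattern_data_patterns[OF factor_subshift[OF \<alpha>(1) t(1) order_refl]
            finite_range_labelling[OF t(1)] t(2,3)])
    then show ?thesis unfolding \<X>_def t(4) by (rule rev_image_eqI) simp
  qed
  moreover have "countable \<X>" unfolding \<X>_def using countable_pattern_data by simp
  ultimately show "\<exists>S \<X>. comeager_in Act S \<and> countable \<X> \<and> (\<forall>\<alpha>\<in>S. factor \<alpha> p \<in> \<X>)"
    using sh unfolding shadowing_generic_def
    by (intro exI[of _ "{\<alpha> \<in> actions G. has_shadowing G \<rho> \<alpha>}"] exI[of _ \<X>]) simp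
qed

text \<open>A pseudo-orbit for \<open>q\<close>, read off by \<open>q\<close>, is a point of the subshift of finite type with the patterns of
  \<open>factor \<alpha> q\<close>. That subshift is one of those to which the stability witness applies, so the image of
  the point is the coding of some \<open>z\<close>, which shadows.\<close>

lemma stable_imp_label_shadowing:
  assumes \<alpha>: "\<alpha> \<in> actions G" and st: "\<And>p. labelling p \<Longrightarrow> \<alpha> \<in> stable p"
  shows "label_shadowing \<alpha>"
  unfolding label_shadowing_def
proof (intro allI impI)
  fix p :: "cantor \<Rightarrow> nat" assume p: "labelling p"
  obtain q F where q: "labelling q" and F: "finite F" "F \<subseteq> carrier G" "\<one> \<in> F"
    and pq: "\<forall>x. pfst (q x) = p x"
    and wit: "\<forall>B Z. finite B \<and> Z \<in> subshifts G B \<and> patterns F Z = patterns F (factor \<alpha> q) \<longrightarrow>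
                  letter_map pfst ` Z = factor \<alpha> p"
    using stable_witness[OF st[OF p] \<alpha> p] by (elim exE conjE)
  define Z where "Z = finite_type F (patterns F (factor \<alpha> q))"
  have fac: "factor \<alpha> q \<in> subshifts G (range q)"
    by (rule factor_subshift[OF \<alpha> q order_refl])
  have "letter_map pfst ` Z = factor \<alpha> p"
    using wit finite_range_labelling[OF q] finite_type_subshift[OF fac F]
      patterns_finite_type[OF fac] unfolding Z_def by blast
  have "\<exists>z. \<forall>g\<in>carrier G. p (x g) = p (\<alpha> g z)"
    if x: "\<forall>g\<in>carrier G. \<forall>s\<in>(\<lambda>f. inv f) ` F. q (\<alpha> s (x g)) = q (x (s \<otimes> g))" for x
  proof -
    define y where "y = (\<lambda>g\<in>carrier G. q (x (inv g)))"
    have "restrict (shift G (inv g) y) F \<in> patterns F (factor \<alpha> q)" if g: "g \<in> carrier G" for g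
    proof -
      have "coding \<alpha> q (x (inv g)) f = y (g \<otimes> f)" if f: "f \<in> F" for f
      proof -
        have fc: "f \<in> carrier G" using f F(2) by blast
        then have "coding \<alpha> q (x (inv g)) f = q (\<alpha> (inv f) (x (inv g)))"
          by (simp add: coding_def)
        also have "\<dots> = q (x (inv f \<otimes> inv g))"
          using x f g by simp
        also have "\<dots> = y (g \<otimes> f)"
          using fc g by (simp add: y_def inv_mult_group)
        finally show ?thesis .
      qed
      then show ?thesis
        unfolding restrict_shift_inv[OF g F(2)] patterns_iff factor_def by auto
    qed
    then have "y \<in> Z" by (simp add: Z_def finite_type_def y_def)
    then have "letter_map pfst y \<in> factor \<alpha> p"
      using \<open>letter_map pfst ` Z = factor \<alpha> p\<close> by blast
    then obtain z where z: "letter_map pfst y = coding \<alpha> p z" unfolding factor_def by blast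
    have "p (x g) = p (\<alpha> g z)" if g: "g \<in> carrier G" for g
      using fun_cong[OF z, of "inv g"] g pq by (simp add: letter_map_def coding_def y_def)
    then show ?thesis by blast
  qed
  moreover have "finite ((\<lambda>f. inv f) ` F)" "(\<lambda>f. inv f) ` F \<subseteq> carrier G"
    using F by auto
  ultimately show "\<exists>(q :: cantor \<Rightarrow> nat) S. labelling q \<and> finite S \<and> S \<subseteq> carrier G \<and>
           (\<forall>x. (\<forall>g\<in>carrier G. \<forall>s\<in>S. q (\<alpha> s (x g)) = q (x (s \<otimes> g))) \<longrightarrow>
                (\<exists>z. \<forall>g\<in>carrier G. p (x g) = p (\<alpha> g z)))"
    using q by (intro exI[of _ q] exI[of _ "(\<lambda>f. inv f) ` F"]) simp
qed

lemma stable_dense_imp_shadowing_generic: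
  assumes \<rho>: "mtopology_of \<rho> = cantor_space" and stable_dense
  shows "shadowing_generic G \<rho>"
  unfolding shadowing_generic_def
proof (rule comeager_in_mono[OF comeager_stable[OF assms(2)]])
  show "{\<alpha> \<in> actions G. \<forall>p. labelling p \<longrightarrow> \<alpha> \<in> stable p} \<subseteq> {\<alpha> \<in> actions G. has_shadowing G \<rho> \<alpha>}"
    using stable_imp_label_shadowing has_shadowing_iff_label_shadowing[OF \<rho>] by auto
qed auto


section \<open>Projectively isolated subshifts\<close>

lemma block_map_apply:
  assumes "g \<in> carrier G" "F \<subseteq> carrier G"
  shows "block_map G F \<phi>\<^sub>0 y g = \<phi>\<^sub>0 (restrict (\<lambda>f. y (g \<otimes> f)) F)"
  using assms by (simp add: block_map_def restrict_shift_inv)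

text \<open>The witness of stability is a pattern neighbourhood of \<open>factor \<alpha> q\<close> whose members all project
  onto \<open>factor \<alpha> p\<close>. This is projective isolation, with the letter map \<open>pfst\<close> as block map.\<close>

lemma stable_factor_projectively_isolated:
  assumes \<alpha>: "\<alpha> \<in> actions G" and p: "labelling p" and st: "\<alpha> \<in> stable p"
    and A: "range p \<subseteq> A"
  shows "projectively_isolated G A (factor \<alpha> p)"
proof -
  obtain q F where q: "labelling q" and F: "finite F" "F \<subseteq> carrier G" "\<one> \<in> F"
    and pq: "\<forall>x. pfst (q x) = p x"
    and wit: "\<forall>B Z. finite B \<and> Z \<in> subshifts G B \<and> patterns F Z = patterns F (factor \<alpha> q) \<longrightarrow>
                  letter_map pfst ` Z = factor \<alpha> p"
    using stable_witness[OF st \<alpha> p] by (elim exE conjE)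
  define B where "B = range q"
  define Y where "Y = factor \<alpha> q"
  define \<phi>\<^sub>0 where "\<phi>\<^sub>0 = (\<lambda>w :: 'g \<Rightarrow> nat. pfst (w \<one>))"
  have B: "finite B" unfolding B_def by (rule finite_range_labelling[OF q])
  have Y: "Y \<in> subshifts G B" unfolding Y_def B_def by (rule factor_subshift[OF \<alpha> q order_refl])
  have bm: "block_map G F \<phi>\<^sub>0 = letter_map pfst"
    using F(3) by (auto simp: fun_eq_iff letter_map_def block_map_apply[OF _ F(2)] \<phi>\<^sub>0_def)
      (simp add: block_map_def)
  have im: "letter_map pfst ` Y = factor \<alpha> p"
    unfolding Y_def factor_letter_map using pq by simp
  have inA: "pfst (y g) \<in> A" if y: "y \<in> Y" and g: "g \<in> carrier G" for y g
  proof -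
    obtain b where "y g = q b"
      using subshift_extensional[OF Y y] g unfolding B_def by auto
    then show ?thesis using pq A by auto
  qed
  have "continuous_map (subtopology (full_shift G B) Y) (full_shift G A) (letter_map pfst)"
    unfolding full_shift_def continuous_map_componentwise
  proof (intro conjI ballI)
    fix g assume g: "g \<in> carrier G"
    have "continuous_map (subtopology (full_shift G B) Y) (discrete_topology B) (\<lambda>y. y g)"
      unfolding full_shift_def
      using g by (intro continuous_map_from_subtopology continuous_map_product_projection)
    then have "openin (subtopology (full_shift G B) Y) {y \<in> topspace (subtopology (full_shift G B) Y). y g \<in> B \<inter> pfst -` U}" for U
      by (rule openin_continuous_map_preimage) simp
    moreover have "{y \<in> topspace (subtopology (full_shift G B) Y). y g \<in> B \<inter> pfst -` U} =
        {y \<in> topspace (subtopology (full_shift G B) Y). letter_map pfst y g \<in> U}" for U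
      using g by (auto simp: letter_map_def full_shift_def)
    ultimately have "openin (subtopology (full_shift G B) Y)
        {y \<in> topspace (subtopology (full_shift G B) Y). letter_map pfst y g \<in> U}" for U
      by simp
    moreover have "letter_map pfst y g \<in> A" if "y \<in> topspace (subtopology (full_shift G B) Y)" for y
      using that inA[of y g] g by (simp add: letter_map_def)
    ultimately show "continuous_map (subtopology (product_topology (\<lambda>_. discrete_topology B) (carrier G)) Y)
          (discrete_topology A) (\<lambda>y. letter_map pfst y g)"
      unfolding continuous_map full_shift_def[symmetric] by auto
  qed (auto simp: letter_map_def)
  then have cont: "continuous_map (subtopology (full_shift G B) Y) (subtopology (full_shift G A) (factor \<alpha> p))
      (block_map G F \<phi>\<^sub>0)"
    unfolding bm using im by (auto simp: continuous_map_in_subtopology)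
  have equi: "block_map G F \<phi>\<^sub>0 (shift G g y) = shift G g (block_map G F \<phi>\<^sub>0 y)" if "g \<in> carrier G" for g y
    unfolding bm using that by (auto simp: letter_map_def shift_def fun_eq_iff)
  have "pattern_nbhd G B F Y \<subseteq> {Z \<in> pattern_nbhd G B F Y. block_map G F \<phi>\<^sub>0 ` Z = factor \<alpha> p}"
    unfolding bm pattern_nbhd_def using wit B by (auto simp: Y_def)
  moreover have "Y \<in> pattern_nbhd G B F Y" using Y by (simp add: pattern_nbhd_def)
  ultimately have ex: "\<exists>U. openin (subshift_topology G B) U \<and> Y \<in> U \<and>
      U \<subseteq> {Z \<in> pattern_nbhd G B F Y. block_map G F \<phi>\<^sub>0 ` Z = factor \<alpha> p}"
    using openin_pattern_nbhd[OF B F(1,2) Y] by (intro exI[of _ "pattern_nbhd G B F Y"] conjI)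
  have "\<phi>\<^sub>0 \<in> patterns F Y \<rightarrow> A"
    using inA F(3) by (auto simp: patterns_def \<phi>\<^sub>0_def)
  with B Y F cont equi ex factor_subshift[OF \<alpha> p A] show ?thesis
    unfolding projectively_isolated_def
    by (intro conjI exI[of _ B] exI[of _ Y] exI[of _ F] exI[of _ \<phi>\<^sub>0]) simp_all
qed

text \<open>Realise \<open>X\<close> as a factor and perturb the action to a stable one.\<close>

lemma stable_dense_imp_projectively_isolated_dense:
  assumes d: "\<And>A. finite A \<Longrightarrow> card A \<ge> 2 \<Longrightarrow> mtopology_of (d A) = full_shift G A" and stable_dense
  shows "projectively_isolated_dense G d"
  unfolding projectively_isolated_dense_def
proof (intro allI impI ballI)
  fix A :: "nat set" and X and \<epsilon> :: real
  assume A: "finite A \<and> 2 \<le> card A" and X: "X \<in> subshifts G A" and "\<epsilon> > 0"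
  obtain K where K: "finite K" "K \<subseteq> carrier G"
      "\<forall>X\<in>subshifts G A. \<forall>Y\<in>subshifts G A. patterns K X = patterns K Y \<longrightarrow> hausdorff_dist (d A) X Y \<le> \<epsilon>"
    using hausdorff_dist_small_if_patterns_eq[OF d _ \<open>\<epsilon> > 0\<close>, of A] A by auto
  obtain \<alpha> p where \<alpha>: "\<alpha> \<in> actions G" and p: "labelling p" and fac: "factor \<alpha> p = X"
    using subshift_is_factor[OF _ X] A by blast
  have pA: "range p \<subseteq> A"
  proof
    fix a assume "a \<in> range p"
    then obtain x where "a = coding \<alpha> p x \<one>" using coding_one[OF \<alpha>, of p] by auto
    moreover have "coding \<alpha> p x \<in> X" unfolding fac[symmetric] by (simp add: factor_def)
    ultimately show "a \<in> A" using subshift_extensional[OF X] by (metis PiE_mem one_closed)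
  qed
  have "\<alpha> \<in> Act closure_of stable p"
    using assms(2) p \<alpha> by (simp add: stable_dense_def)
  then have "\<exists>\<beta>. \<beta> \<in> stable p \<and> \<beta> \<in> coding_nhd \<alpha> K p"
    using openin_coding_nhd[OF K(1,2) p, of \<alpha>] coding_nhd_refl[OF \<alpha>, of K p]
    unfolding in_closure_of by meson
  then obtain \<beta> where \<beta>: "\<beta> \<in> stable p" "\<beta> \<in> coding_nhd \<alpha> K p" by blast
  then have \<beta>a: "\<beta> \<in> actions G" by (simp add: coding_nhd_def)
  have "patterns K X = patterns K (factor \<beta> p)"
    using coding_nhd_patterns[OF \<beta>(2)] fac by simp
  then have "hausdorff_dist (d A) X (factor \<beta> p) \<le> \<epsilon>"
    using K(3) X factor_subshift[OF \<beta>a p pA] by blast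
  then show "\<exists>X'. projectively_isolated G A X' \<and> hausdorff_dist (d A) X X' \<le> \<epsilon>"
    using stable_factor_projectively_isolated[OF \<beta>a p \<beta>(1) pA] by blast
qed


definition block_graph :: "'g set \<Rightarrow> (('g \<Rightarrow> nat) \<Rightarrow> nat) \<Rightarrow> ('g \<Rightarrow> nat) \<Rightarrow> 'g \<Rightarrow> nat" where
  "block_graph F \<phi>\<^sub>0 y = (\<lambda>g\<in>carrier G. prod_encode (block_map G F \<phi>\<^sub>0 y g, y g))"

lemma letter_map_pfst_block_graph: "letter_map pfst (block_graph F \<phi>\<^sub>0 y) = block_map G F \<phi>\<^sub>0 y"
  by (auto simp: letter_map_def block_graph_def block_map_def fun_eq_iff)

lemma letter_map_psnd_block_graph:
  "y \<in> extensional (carrier G) \<Longrightarrow> letter_map psnd (block_graph F \<phi>\<^sub>0 y) = y"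
  by (auto simp: letter_map_def block_graph_def extensional_def fun_eq_iff)

lemma block_graph_subshift:
  assumes Y: "Y \<in> subshifts G B" and F: "finite F" "F \<subseteq> carrier G" and \<phi>\<^sub>0: "\<phi>\<^sub>0 \<in> patterns F Y \<rightarrow> A"
  shows "block_graph F \<phi>\<^sub>0 ` Y \<in> subshifts G (prod_encode ` (A \<times> B))" (is "?Z \<in> subshifts G ?C")
proof (rule subshift_from_constraints[OF _ _ Y _ Y])
  let ?P = "\<lambda>w :: 'g \<Rightarrow> nat. pfst (w \<one>) = \<phi>\<^sub>0 (restrict (\<lambda>f. psnd (w f)) F)"
  have rule_iff: "?P (restrict (\<lambda>f. z (g \<otimes> f)) (insert \<one> F)) \<longleftrightarrow> pfst (z g) = block_map G F \<phi>\<^sub>0 (letter_map psnd z) g"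
    if g: "g \<in> carrier G" for z g
  proof -
    have "restrict (\<lambda>f. psnd (restrict (\<lambda>f. z (g \<otimes> f)) (insert \<one> F) f)) F =
        restrict (\<lambda>f. letter_map psnd z (g \<otimes> f)) F"
      using F(2) g by (auto simp: fun_eq_iff letter_map_def)
    then show ?thesis using g by (simp add: block_map_apply[OF g F(2)])
  qed
  show "z \<in> ?Z \<longleftrightarrow> z \<in> local_rule ?C (insert \<one> F) ?P \<and> letter_map psnd z \<in> Y \<and> letter_map psnd z \<in> Y" for z
  proof
    assume "z \<in> ?Z"
    then obtain y where y: "y \<in> Y" "z = block_graph F \<phi>\<^sub>0 y" by blast
    have yB: "y \<in> carrier G \<rightarrow>\<^sub>E B" by (rule subshift_extensional[OF Y y(1)])
    then have zy: "letter_map psnd z = y"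
      unfolding y(2) by (intro letter_map_psnd_block_graph) (simp add: PiE_iff)
    have "block_map G F \<phi>\<^sub>0 y g \<in> A" if g: "g \<in> carrier G" for g
    proof -
      have "restrict (shift G (inv g) y) F \<in> patterns F Y"
        using subshift_shift[OF Y y(1) inv_closed[OF g]] by (simp add: patterns_def)
      then show ?thesis using \<phi>\<^sub>0 g by (auto simp: block_map_def)
    qed
    then have "z \<in> carrier G \<rightarrow>\<^sub>E ?C"
      using yB by (auto simp: y(2) block_graph_def PiE_iff)
    moreover have "pfst (z g) = block_map G F \<phi>\<^sub>0 y g" if "g \<in> carrier G" for g
      using that by (simp add: y(2) block_graph_def)
    ultimately show "z \<in> local_rule ?C (insert \<one> F) ?P \<and> letter_map psnd z \<in> Y \<and> letter_map psnd z \<in> Y"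
      using y(1) unfolding local_rule_def by (simp add: rule_iff zy del: restrict_apply)
  next
    assume z: "z \<in> local_rule ?C (insert \<one> F) ?P \<and> letter_map psnd z \<in> Y \<and> letter_map psnd z \<in> Y"
    then have zC: "z \<in> carrier G \<rightarrow>\<^sub>E ?C"
      and rule: "\<And>g. g \<in> carrier G \<Longrightarrow> pfst (z g) = block_map G F \<phi>\<^sub>0 (letter_map psnd z) g"
      unfolding local_rule_def by (simp_all add: rule_iff del: restrict_apply)
    have "z g = block_graph F \<phi>\<^sub>0 (letter_map psnd z) g" for g
    proof (cases "g \<in> carrier G")
      case True
      then have "letter_map psnd z g = psnd (z g)"
        by (simp add: letter_map_def)
      then show ?thesis
        using True rule[OF True] prod_encode_pfst_psnd[of "z g"] by (simp add: block_graph_def)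
    next
      case False
      then show ?thesis using zC by (auto simp: block_graph_def PiE_iff extensional_def)
    qed
    then have "z = block_graph F \<phi>\<^sub>0 (letter_map psnd z)" by (rule ext)
    then show "z \<in> ?Z" using z by blast
  qed
  show "?Z \<noteq> {}" using Y by (auto simp: subshifts_def)
qed (use F in auto)

text \<open>For \<open>\<gamma>\<close> close to \<open>\<beta>\<close> on both windows, \<open>F'\<close> ensures that \<open>factor \<gamma> r\<close> still lies in the isolating
  neighbourhood and hence maps onto \<open>X\<close>, and \<open>F\<close> ensures that the block map still computes the labelling \<open>t\<close>
  from \<open>r\<close>. So \<open>factor \<gamma> t\<close> remains equal to \<open>X\<close>.\<close>

lemma stable_if_factor_locally_isolated:
  assumes \<beta>: "\<beta> \<in> actions G" and r: "labelling r" and B: "range r \<subseteq> B"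
    and F: "finite F" "F \<subseteq> carrier G" and F': "finite F'" "F' \<subseteq> carrier G"
    and iso: "\<And>Z. Z \<in> pattern_nbhd G B F' (factor \<beta> r) \<Longrightarrow> block_map G F \<phi>\<^sub>0 ` Z = X"
    and t: "\<And>x. t x = block_map G F \<phi>\<^sub>0 (coding \<beta> r x) \<one>"
  shows "\<beta> \<in> stable (\<lambda>x. f (t x))"
proof -
  define V where "V = coding_nhd \<beta> (F \<union> F') r"
  have "factor \<gamma> t = X" if \<gamma>V: "\<gamma> \<in> V" for \<gamma>
  proof -
    have \<gamma>: "\<gamma> \<in> actions G" using \<gamma>V by (simp add: V_def coding_nhd_def)
    have "patterns F' (factor \<gamma> r) = patterns F' (factor \<beta> r)"
      using patterns_mono[OF coding_nhd_patterns[OF \<gamma>V[unfolded V_def]], of F'] by simp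
    then have "factor \<gamma> r \<in> pattern_nbhd G B F' (factor \<beta> r)"
      using factor_subshift[OF \<gamma> r B] by (simp add: pattern_nbhd_def)
    then have X: "block_map G F \<phi>\<^sub>0 ` factor \<gamma> r = X" by (rule iso)
    have "block_map G F \<phi>\<^sub>0 (coding \<gamma> r x) = coding \<gamma> t x" for x
    proof
      fix g
      show "block_map G F \<phi>\<^sub>0 (coding \<gamma> r x) g = coding \<gamma> t x g"
      proof (cases "g \<in> carrier G")
        case g: True
        define x' where "x' = \<gamma> (inv g) x"
        have "restrict (shift G (inv g) (coding \<gamma> r x)) F = restrict (coding \<gamma> r x') F"
          unfolding x'_def coding_shift[OF \<gamma> inv_closed[OF g]] ..
        also have "\<dots> = restrict (coding \<beta> r x') F"
          using \<gamma>V by (auto simp: V_def coding_nhd_def fun_eq_iff)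
        also have "\<dots> = restrict (\<lambda>f. coding \<beta> r x' (\<one> \<otimes> f)) F"
          using F(2) by (auto simp: fun_eq_iff subsetD)
        finally have "block_map G F \<phi>\<^sub>0 (coding \<gamma> r x) g = block_map G F \<phi>\<^sub>0 (coding \<beta> r x') \<one>"
          unfolding block_map_apply[OF one_closed F(2)] using g by (simp add: block_map_def)
        then have "block_map G F \<phi>\<^sub>0 (coding \<gamma> r x) g = t x'"
          by (simp only: t)
        then show ?thesis
          using g by (simp add: x'_def coding_def)
      next
        case False
        then show ?thesis by (simp add: block_map_def coding_def)
      qed
    qed
    then show ?thesis using X by (simp add: factor_def image_image)
  qed
  then have "factor \<gamma> (\<lambda>x. f (t x)) = letter_map f ` X" if "\<gamma> \<in> V" for \<gamma>
    using that by (simp add: factor_letter_map[symmetric])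
  moreover have "openin Act V" "\<beta> \<in> V"
    unfolding V_def using F F' r coding_nhd_refl[OF \<beta>] by (auto intro!: openin_coding_nhd)
  ultimately show ?thesis
    unfolding stable_def by (intro CollectI exI[of _ V]) simp
qed

text \<open>Approximate \<open>factor \<alpha> t\<close> by a projectively isolated \<open>X'\<close>, the image of \<open>Y\<close> under a block map.
  Realising the graph of the block map over \<open>Y\<close>, rather than \<open>X'\<close> alone, gives an action near \<open>\<alpha>\<close> that
  has both \<open>X'\<close> and the isolating \<open>Y\<close> as factors.\<close>

lemma projectively_isolated_dense_imp_stable_dense:
  assumes d: "\<And>A. finite A \<Longrightarrow> card A \<ge> 2 \<Longrightarrow> mtopology_of (d A) = full_shift G A"
    and pi: "projectively_isolated_dense G d"
  shows stable_dense
  unfolding stable_dense_iff_meets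
proof (intro allI impI ballI)
  fix p :: "cantor \<Rightarrow> nat" and \<alpha> F\<^sub>0 and n :: nat
  assume p: "labelling p" and \<alpha>: "\<alpha> \<in> actions G" and F\<^sub>0: "finite F\<^sub>0 \<and> F\<^sub>0 \<subseteq> carrier G"
  define t where "t = pair p (prefix n)"
  define K where "K = insert \<one> F\<^sub>0"
  \<comment> \<open>\<open>0\<close> and \<open>1\<close> only provide the two letters that an alphabet must have.\<close>
  define A where "A = range t \<union> {0, 1}"
  have t: "labelling t"
    unfolding t_def by (intro labelling_pair p labelling_prefix)
  have K: "finite K" "K \<subseteq> carrier G" "\<one> \<in> K" using F\<^sub>0 by (auto simp: K_def)
  have A: "finite A" "2 \<le> card A"
  proof -
    show "finite A" using finite_range_labelling[OF t] by (simp add: A_def)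
    then have "card {0, 1 :: nat} \<le> card A" by (rule card_mono) (simp add: A_def)
    then show "2 \<le> card A" by simp
  qed
  have X: "factor \<alpha> t \<in> subshifts G A"
    by (rule factor_subshift[OF \<alpha> t]) (auto simp: A_def)
  obtain \<epsilon> where \<epsilon>: "\<epsilon> > 0"
      "\<forall>X\<in>subshifts G A. \<forall>Y\<in>subshifts G A. hausdorff_dist (d A) X Y \<le> \<epsilon> \<longrightarrow> patterns K X = patterns K Y"
    using patterns_eq_if_hausdorff_dist_small[OF d[OF A] A(1) K(1,2)] by (elim exE conjE)
  have "\<exists>X'. projectively_isolated G A X' \<and> hausdorff_dist (d A) (factor \<alpha> t) X' \<le> \<epsilon>"
    using pi A X \<epsilon>(1) unfolding projectively_isolated_dense_def by simp
  then obtain X' where X': "projectively_isolated G A X'" "hausdorff_dist (d A) (factor \<alpha> t) X' \<le> \<epsilon>"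
    by (elim exE conjE)
  have pat: "patterns K (factor \<alpha> t) = patterns K X'"
    using \<epsilon>(2) X X' by (simp add: projectively_isolated_def)
  obtain B :: "nat set" and Y F \<phi>\<^sub>0 U where Y: "finite B" "Y \<in> subshifts G B"
    and F: "finite F" "F \<subseteq> carrier G" and \<phi>\<^sub>0: "\<phi>\<^sub>0 \<in> patterns F Y \<rightarrow> A"
    and U: "openin (subshift_topology G B) U" "Y \<in> U"
      "U \<subseteq> {Z \<in> pattern_nbhd G B F Y. block_map G F \<phi>\<^sub>0 ` Z = X'}"
    using X'(1) unfolding projectively_isolated_def by (elim exE conjE)
  obtain F' where F': "finite F'" "F' \<subseteq> carrier G" "pattern_nbhd G B F' Y \<subseteq> U"
    using pattern_nbhd_basis[OF Y(1) U(1,2)] by (elim exE conjE)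
  define Z where "Z = block_graph F \<phi>\<^sub>0 ` Y"
  have Z: "Z \<in> subshifts G (prod_encode ` (A \<times> B))"
    unfolding Z_def by (rule block_graph_subshift[OF Y(2) F \<phi>\<^sub>0])
  have "letter_map pfst ` Z = X'"
    using U(2,3) by (auto simp: Z_def image_image letter_map_pfst_block_graph)
  then have "patterns K (letter_map pfst ` Z) = patterns K (factor \<alpha> t)"
    using pat by simp
  then obtain \<beta> q where \<beta>: "\<beta> \<in> coding_nhd \<alpha> K t" and q: "labelling q"
      "factor \<beta> q = Z" "\<forall>x. pfst (q x) = t x"
    using realization[OF \<alpha> t K _ Z, of pfst] A(1) Y(1) by auto
  have \<beta>a: "\<beta> \<in> actions G" using \<beta> by (simp add: coding_nhd_def)
  define r where "r = (\<lambda>x. psnd (q x))"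
  have r: "labelling r" unfolding r_def by (rule labelling_map[OF q(1)])
  have graph: "coding \<beta> q x = block_graph F \<phi>\<^sub>0 (coding \<beta> r x)" "coding \<beta> r x \<in> Y" for x
  proof -
    have "coding \<beta> q x \<in> Z" unfolding q(2)[symmetric] by (simp add: factor_def)
    then obtain y where y: "y \<in> Y" "coding \<beta> q x = block_graph F \<phi>\<^sub>0 y" unfolding Z_def by blast
    have "coding \<beta> r x = letter_map psnd (coding \<beta> q x)"
      by (simp add: coding_letter_map r_def)
    also have "\<dots> = y"
      using letter_map_psnd_block_graph subshift_extensional[OF Y(2) y(1)] by (simp add: y(2) PiE_iff)
    finally show "coding \<beta> q x = block_graph F \<phi>\<^sub>0 (coding \<beta> r x)" "coding \<beta> r x \<in> Y"
      using y by simp_all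
  qed
  have Yr: "factor \<beta> r = Y"
  proof -
    have "factor \<beta> r = letter_map psnd ` Z"
      by (simp add: q(2)[symmetric] factor_letter_map r_def)
    also have "\<dots> = (\<lambda>y. y) ` Y"
      unfolding Z_def image_image
    proof (rule image_cong[OF refl])
      fix y assume "y \<in> Y"
      then show "letter_map psnd (block_graph F \<phi>\<^sub>0 y) = y"
        using letter_map_psnd_block_graph subshift_extensional[OF Y(2), of y] by (simp add: PiE_iff)
    qed
    finally show ?thesis by simp
  qed
  have "t x = block_map G F \<phi>\<^sub>0 (coding \<beta> r x) \<one>" for x
  proof -
    have "t x = pfst (coding \<beta> q x \<one>)" using q(3) by (simp add: coding_one[OF \<beta>a])
    then show ?thesis by (simp add: graph(1) block_graph_def)
  qed
  moreover have "range r \<subseteq> B"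
  proof
    fix b assume "b \<in> range r"
    then obtain x where "b = coding \<beta> r x \<one>" using coding_one[OF \<beta>a, of r] by auto
    then show "b \<in> B" using subshift_extensional[OF Y(2) graph(2)] by (metis PiE_mem one_closed)
  qed
  moreover have "block_map G F \<phi>\<^sub>0 ` Z = X'" if "Z \<in> pattern_nbhd G B F' (factor \<beta> r)" for Z
    using that F'(3) U(3) unfolding Yr by blast
  ultimately have "\<beta> \<in> stable (\<lambda>x. pfst (t x))"
    by (intro stable_if_factor_locally_isolated[OF \<beta>a r _ F F'(1,2)])
  then have "\<beta> \<in> stable p" by (simp add: t_def)
  moreover have "coding_nhd \<alpha> K t \<subseteq> coding_nhd \<alpha> F\<^sub>0 (prefix n)"
    by (rule coding_nhd_coarsen[of _ _ psnd]) (auto simp: K_def t_def)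
  ultimately show "coding_nhd \<alpha> F\<^sub>0 (prefix n) \<inter> stable p \<noteq> {}"
    using \<beta> by blast
qed


section \<open>Back and forth between generic actions\<close>

text \<open>\<open>p\<close> is refined twice, hence the double \<open>pfst\<close>: first by the labelling to be matched in the back and
  forth construction, then by the witness of stability of the result.\<close>

definition extendable :: "(cantor \<Rightarrow> nat) \<Rightarrow> 'g set \<Rightarrow> ('g \<Rightarrow> nat) set \<Rightarrow> ('g \<Rightarrow> cantor \<Rightarrow> cantor) set" where
  "extendable p E M = {\<alpha> \<in> actions G. \<exists>s. labelling s \<and> (\<forall>x. pfst (pfst (s x)) = p x) \<and>
                                        patterns E (factor \<alpha> s) = M}"

lemma openin_extendable:
  assumes "finite E" "E \<subseteq> carrier G"
  shows "openin Act (extendable p E M)"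
proof (subst openin_subopen, rule ballI)
  fix \<alpha> assume \<alpha>: "\<alpha> \<in> extendable p E M"
  then obtain s where s: "labelling s" "\<forall>x. pfst (pfst (s x)) = p x" "patterns E (factor \<alpha> s) = M"
    unfolding extendable_def by blast
  have "coding_nhd \<alpha> E s \<subseteq> extendable p E M"
  proof
    fix \<beta> assume \<beta>: "\<beta> \<in> coding_nhd \<alpha> E s"
    then show "\<beta> \<in> extendable p E M"
      using s coding_nhd_patterns[OF \<beta>] unfolding extendable_def coding_nhd_def
      by (intro CollectI conjI exI[of _ s]) simp_all
  qed
  then show "\<exists>T. openin Act T \<and> \<alpha> \<in> T \<and> T \<subseteq> extendable p E M"
    using openin_coding_nhd[OF assms s(1), of \<alpha>] coding_nhd_refl[of \<alpha> E s] \<alpha>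
    by (intro exI[of _ "coding_nhd \<alpha> E s"]) (simp add: extendable_def)
qed

definition fibre_product :: "(nat \<Rightarrow> nat) \<Rightarrow> (nat \<Rightarrow> nat) \<Rightarrow> ('g \<Rightarrow> nat) set \<Rightarrow> ('g \<Rightarrow> nat) set \<Rightarrow> ('g \<Rightarrow> nat) set" where
  "fibre_product a b T Y =
     {z \<in> extensional (carrier G). letter_map pfst z \<in> T \<and> letter_map psnd z \<in> Y \<and>
        (\<forall>g\<in>carrier G. a (pfst (z g)) = b (psnd (z g)))}"

lemma fibre_product_projections:
  assumes T: "T \<in> subshifts G A" and Y: "Y \<in> subshifts G D"
    and eq: "letter_map a ` T = letter_map b ` Y"
  shows "letter_map pfst ` fibre_product a b T Y = T" "letter_map psnd ` fibre_product a b T Y = Y"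
proof -
  have join: "\<exists>z\<in>fibre_product a b T Y. letter_map pfst z = \<tau> \<and> letter_map psnd z = y"
    if \<tau>y: "\<tau> \<in> T" "y \<in> Y" "letter_map a \<tau> = letter_map b y" for \<tau> y
  proof -
    define z where "z = (\<lambda>g\<in>carrier G. prod_encode (\<tau> g, y g))"
    have ab: "a (\<tau> g) = b (y g)" if "g \<in> carrier G" for g
      using fun_cong[OF \<tau>y(3), of g] that by (simp add: letter_map_def)
    have z1: "letter_map pfst z = \<tau>"
      using subshift_extensional[OF T \<tau>y(1)] by (auto simp: z_def letter_map_def extensional_def fun_eq_iff PiE_iff)
    have z2: "letter_map psnd z = y"
      using subshift_extensional[OF Y \<tau>y(2)] by (auto simp: z_def letter_map_def extensional_def fun_eq_iff PiE_iff)
    have "z \<in> fibre_product a b T Y"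
      unfolding fibre_product_def using z1 z2 \<tau>y(1,2) ab by (simp add: z_def)
    then show ?thesis using z1 z2 by blast
  qed
  show "letter_map pfst ` fibre_product a b T Y = T"
  proof
    show "letter_map pfst ` fibre_product a b T Y \<subseteq> T"
      by (auto simp: fibre_product_def)
    show "T \<subseteq> letter_map pfst ` fibre_product a b T Y"
    proof
      fix \<tau> assume \<tau>: "\<tau> \<in> T"
      then obtain y where y: "y \<in> Y" "letter_map a \<tau> = letter_map b y" using eq by blast
      show "\<tau> \<in> letter_map pfst ` fibre_product a b T Y" using join[OF \<tau> y] by blast
    qed
  qed
  show "letter_map psnd ` fibre_product a b T Y = Y"
  proof
    show "letter_map psnd ` fibre_product a b T Y \<subseteq> Y"
      by (auto simp: fibre_product_def)
    show "Y \<subseteq> letter_map psnd ` fibre_product a b T Y"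
    proof
      fix y assume y: "y \<in> Y"
      then have "letter_map b y \<in> letter_map a ` T" using eq by blast
      then obtain \<tau> where \<tau>: "\<tau> \<in> T" "letter_map a \<tau> = letter_map b y" by (metis imageE)
      show "y \<in> letter_map psnd ` fibre_product a b T Y" using join[OF \<tau>(1) y \<tau>(2)] by blast
    qed
  qed
qed

lemma fibre_product_subshift:
  assumes T: "T \<in> subshifts G A" and Y: "Y \<in> subshifts G D"
    and eq: "letter_map a ` T = letter_map b ` Y"
  shows "fibre_product a b T Y \<in> subshifts G (prod_encode ` (A \<times> D))" (is "?Z \<in> subshifts G ?C")
proof (rule subshift_from_constraints[OF _ _ T _ Y])
  have "z \<in> carrier G \<rightarrow>\<^sub>E ?C"
    if z: "z \<in> extensional (carrier G)" "letter_map pfst z \<in> T" "letter_map psnd z \<in> Y" for z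
  proof (rule PiE_I)
    fix g assume g: "g \<in> carrier G"
    have "letter_map pfst z g \<in> A" "letter_map psnd z g \<in> D"
      using g subshift_extensional[OF T z(2)] subshift_extensional[OF Y z(3)] by blast+
    then have "pfst (z g) \<in> A" "psnd (z g) \<in> D"
      using g by (simp_all add: letter_map_def)
    then show "z g \<in> ?C"
      by (intro image_eqI[of _ _ "(pfst (z g), psnd (z g))"]) (simp_all add: prod_encode_pfst_psnd)
  qed (use z in \<open>simp add: extensional_def\<close>)
  then show "z \<in> ?Z \<longleftrightarrow> z \<in> local_rule ?C {\<one>} (\<lambda>w. a (pfst (w \<one>)) = b (psnd (w \<one>))) \<and>
      letter_map pfst z \<in> T \<and> letter_map psnd z \<in> Y" for z
    by (auto simp: fibre_product_def local_rule_def PiE_iff)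
  show "?Z \<noteq> {}"
    using fibre_product_projections(1)[OF assms] T by (auto simp: subshifts_def)
qed auto

text \<open>If \<open>Y\<close> lies over \<open>factor \<alpha> p\<close>, then so does the factor \<open>factor \<alpha> t\<close> that describes a given
  neighbourhood of \<open>\<alpha>\<close>. The fibre product of the two projects onto both. An action realising it is in the
  neighbourhood and has \<open>Y\<close> as a factor over \<open>p\<close>.\<close>

lemma in_closure_of_extendable:
  assumes \<alpha>: "\<alpha> \<in> actions G" and p: "labelling p"
    and Y: "finite D" "Y \<in> subshifts G D" and eq: "letter_map (\<lambda>c. pfst (pfst c)) ` Y = factor \<alpha> p"
  shows "\<alpha> \<in> Act closure_of extendable p E (patterns E Y)"
  unfolding in_closure_of
proof (intro conjI allI impI)
  show "\<alpha> \<in> topspace Act" using \<alpha> by simp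
  fix U assume U: "\<alpha> \<in> U \<and> openin Act U"
  then obtain F\<^sub>0 n where F\<^sub>0: "finite F\<^sub>0" "F\<^sub>0 \<subseteq> carrier G" "coding_nhd \<alpha> F\<^sub>0 (prefix n) \<subseteq> U"
    using coding_nhd_basis by meson
  define t where "t = pair p (prefix n)"
  define K where "K = insert \<one> F\<^sub>0"
  have t: "labelling t"
    unfolding t_def by (intro labelling_pair p labelling_prefix)
  have K: "finite K" "K \<subseteq> carrier G" "\<one> \<in> K" using F\<^sub>0 by (auto simp: K_def)
  have T: "factor \<alpha> t \<in> subshifts G (range t)" by (rule factor_subshift[OF \<alpha> t order_refl])
  define Z where "Z = fibre_product pfst (\<lambda>c. pfst (pfst c)) (factor \<alpha> t) Y"
  have eq': "letter_map pfst ` factor \<alpha> t = letter_map (\<lambda>c. pfst (pfst c)) ` Y"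
    unfolding eq factor_letter_map by (simp add: t_def)
  have Z: "Z \<in> subshifts G (prod_encode ` (range t \<times> D))"
    unfolding Z_def by (rule fibre_product_subshift[OF T Y(2) eq'])
  have proj: "letter_map pfst ` Z = factor \<alpha> t" "letter_map psnd ` Z = Y"
    unfolding Z_def by (rule fibre_product_projections[OF T Y(2) eq'])+
  obtain \<beta> q where \<beta>: "\<beta> \<in> coding_nhd \<alpha> K t" and q: "labelling q"
      "factor \<beta> q = Z" "\<forall>x. pfst (q x) = t x"
    using realization[OF \<alpha> t K _ Z, of pfst] proj(1) finite_range_labelling[OF t] Y(1) by auto
  have \<beta>a: "\<beta> \<in> actions G" using \<beta> by (simp add: coding_nhd_def)
  define s where "s = (\<lambda>x. psnd (q x))"
  have "labelling s" unfolding s_def by (rule labelling_map[OF q(1)])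
  moreover have "factor \<beta> s = Y"
    using proj(2) unfolding q(2)[symmetric] factor_letter_map by (simp add: s_def)
  moreover have "pfst (pfst (s x)) = p x" for x
  proof -
    have "coding \<beta> q x \<in> Z" unfolding q(2)[symmetric] by (simp add: factor_def)
    then have "pfst (pfst (coding \<beta> q x \<one>)) = pfst (pfst (psnd (coding \<beta> q x \<one>)))"
      by (simp add: Z_def fibre_product_def)
    then show ?thesis
      using q(3) by (simp add: coding_one[OF \<beta>a] s_def t_def)
  qed
  ultimately have "\<beta> \<in> extendable p E (patterns E Y)"
    using \<beta>a unfolding extendable_def by (intro CollectI conjI exI[of _ s]) simp_all
  moreover have "coding_nhd \<alpha> K t \<subseteq> coding_nhd \<alpha> F\<^sub>0 (prefix n)"
    by (rule coding_nhd_coarsen[of _ _ psnd]) (auto simp: K_def t_def)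
  ultimately show "\<exists>\<beta>. \<beta> \<in> extendable p E (patterns E Y) \<and> \<beta> \<in> U"
    using \<beta> F\<^sub>0(3) by blast
qed

text \<open>The second condition excludes the boundaries of the open sets \<^const>\<open>extendable\<close>: a generic action
  extends a labelling as soon as actions arbitrarily close to it do.\<close>

definition generic_actions :: "('g \<Rightarrow> cantor \<Rightarrow> cantor) set" where
  "generic_actions =
     {\<alpha> \<in> actions G. \<forall>p. labelling p \<longrightarrow>
        \<alpha> \<in> stable p \<and>
        (\<forall>(E, M)\<in>pattern_data. \<alpha> \<in> Act closure_of extendable p E M \<longrightarrow> \<alpha> \<in> extendable p E M)}"

lemma open_dense_complement_of_boundary:
  assumes "openin X O'"
  shows "openin X (topspace X - (X closure_of O' - O'))"
    and "X closure_of (topspace X - (X closure_of O' - O')) = topspace X"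
proof -
  have "closedin X (X closure_of O' - O')"
    using assms by (simp add: closedin_diff)
  then show "openin X (topspace X - (X closure_of O' - O'))"
    by (simp add: openin_diff)
  have "X interior_of (X closure_of O' - O') = {}"
  proof (rule equals0I)
    fix x assume x: "x \<in> X interior_of (X closure_of O' - O')"
    then have "x \<in> X closure_of O'"
      using interior_of_subset[of X "X closure_of O' - O'"] by blast
    then obtain y where "y \<in> O'" "y \<in> X interior_of (X closure_of O' - O')"
      using x openin_interior_of[of X "X closure_of O' - O'"] unfolding in_closure_of by meson
    then show False
      using interior_of_subset[of X "X closure_of O' - O'"] by blast
  qed
  then show "X closure_of (topspace X - (X closure_of O' - O')) = topspace X"
    by (simp add: closure_of_complement)
qed

lemma comeager_generic_actions:
  assumes stable_dense
  shows "comeager_in Act generic_actions"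
proof -
  define P where "P = {p :: cantor \<Rightarrow> nat. labelling p}"
  define bd where "bd = (\<lambda>(p, E, M). actions G - (Act closure_of extendable p E M - extendable p E M))"
  define \<D> where "\<D> = stable ` P \<union> bd ` (P \<times> pattern_data)"
  have "comeager_in Act (topspace Act \<inter> \<Inter>\<D>)"
  proof (rule comeager_in_Inter_open_dense)
    show "countable \<D>"
      unfolding \<D>_def P_def using countable_labelling countable_pattern_data by simp
    fix W assume "W \<in> \<D>"
    then consider p where "p \<in> P" "W = stable p"
      | p E M where "(E, M) \<in> pattern_data" "W = bd (p, E, M)"
      unfolding \<D>_def by auto
    then show "openin Act W \<and> Act closure_of W = topspace Act"
    proof cases
      case 1
      then show ?thesis using assms openin_stable by (simp add: stable_dense_def P_def)
    next
      case 2
      then have "openin Act (extendable p E M)"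
        by (intro openin_extendable) (auto simp: pattern_data_def)
      from open_dense_complement_of_boundary[OF this] show ?thesis
        unfolding 2(2) bd_def by simp
    qed
  qed
  then show ?thesis
  proof (rule comeager_in_mono)
    show "topspace Act \<inter> \<Inter>\<D> \<subseteq> generic_actions"
    proof
      fix \<alpha> assume \<alpha>: "\<alpha> \<in> topspace Act \<inter> \<Inter>\<D>"
      have "\<alpha> \<in> stable p" if "labelling p" for p
        using \<alpha> that unfolding \<D>_def P_def by blast
      moreover have "\<alpha> \<in> extendable p E M"
        if "labelling p" "(E, M) \<in> pattern_data" "\<alpha> \<in> Act closure_of extendable p E M" for p E M
      proof -
        have "bd (p, E, M) \<in> \<D>" using that(1,2) unfolding \<D>_def P_def by blast
        then have "\<alpha> \<in> bd (p, E, M)" using \<alpha> by blast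
        then show ?thesis using that(3) by (simp add: bd_def)
      qed
      ultimately show "\<alpha> \<in> generic_actions"
        using \<alpha> by (auto simp: generic_actions_def)
    qed
  qed (auto simp: generic_actions_def)
qed

text \<open>Choose a witness \<open>s\<close> of stability for the refinement \<open>r\<close> of \<open>p\<close>. Since \<open>\<beta>\<close> is generic and
  \<open>factor \<alpha> s\<close> lies over \<open>factor \<beta> p'\<close>, some \<open>s'\<close> over \<open>p'\<close> has the patterns of \<open>factor \<alpha> s\<close> on the window of the
  witness. Agreement on that window is only approximate for \<open>s'\<close>, but by stability it is exact for the
  labelling \<open>r'\<close> below it, and so the construction can go on.\<close>

lemma generic_forth:
  assumes \<alpha>: "\<alpha> \<in> generic_actions" and \<beta>: "\<beta> \<in> generic_actions"
    and p: "labelling p" "labelling p'" "factor \<alpha> p = factor \<beta> p'"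
    and r\<^sub>0: "labelling r\<^sub>0"
  shows "\<exists>r r'. labelling r \<and> labelling r' \<and> factor \<alpha> r = factor \<beta> r' \<and>
           (\<forall>x. pfst (r x) = p x) \<and> (\<forall>x. pfst (r' x) = p' x) \<and> (\<forall>x. psnd (r x) = r\<^sub>0 x)"
proof -
  have \<alpha>a: "\<alpha> \<in> actions G" and \<beta>a: "\<beta> \<in> actions G"
    using \<alpha> \<beta> by (auto simp: generic_actions_def)
  define r where "r = pair p r\<^sub>0"
  have r: "labelling r" unfolding r_def by (rule labelling_pair[OF p(1) r\<^sub>0])
  have "\<alpha> \<in> stable r" using \<alpha> r by (auto simp: generic_actions_def)
  then obtain s E where s: "labelling s" and E: "finite E" "E \<subseteq> carrier G" "\<one> \<in> E"
    and sr: "\<forall>x. pfst (s x) = r x"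
    and wit: "\<forall>B Z. finite B \<and> Z \<in> subshifts G B \<and> patterns E Z = patterns E (factor \<alpha> s) \<longrightarrow>
                  letter_map pfst ` Z = factor \<alpha> r"
    using stable_witness[OF _ \<alpha>a r] by meson
  define Y where "Y = factor \<alpha> s"
  have Y: "Y \<in> subshifts G (range s)" unfolding Y_def by (rule factor_subshift[OF \<alpha>a s order_refl])
  have fin: "finite (range s)" by (rule finite_range_labelling[OF s])
  have "letter_map (\<lambda>c. pfst (pfst c)) ` Y = factor \<beta> p'"
    unfolding Y_def factor_letter_map p(3)[symmetric] using sr by (simp add: r_def)
  then have "\<beta> \<in> Act closure_of extendable p' E (patterns E Y)"
    by (rule in_closure_of_extendable[OF \<beta>a p(2) fin Y])
  moreover have "(E, patterns E Y) \<in> pattern_data"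
    by (rule pattern_data_patterns[OF Y fin E(1,2)])
  ultimately have "\<beta> \<in> extendable p' E (patterns E Y)"
    using \<beta> p(2) unfolding generic_actions_def by blast
  then obtain s' where s': "labelling s'" "\<forall>x. pfst (pfst (s' x)) = p' x"
      "patterns E (factor \<beta> s') = patterns E Y"
    unfolding extendable_def by blast
  define r' where "r' = (\<lambda>x. pfst (s' x))"
  have "letter_map pfst ` factor \<beta> s' = factor \<alpha> r"
    using wit finite_range_labelling[OF s'(1)] factor_subshift[OF \<beta>a s'(1) order_refl] s'(3)
    unfolding Y_def by meson
  then have "factor \<alpha> r = factor \<beta> r'"
    by (simp add: factor_letter_map r'_def)
  moreover have "labelling r'"
    unfolding r'_def by (rule labelling_map[OF s'(1)])
  ultimately show ?thesis
    using r s'(2) by (intro exI[of _ r] exI[of _ r']) (simp add: r_def r'_def)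
qed

text \<open>The points with the required coding at level \<open>n\<close> form a decreasing sequence of nonempty closed sets.\<close>

lemma matching_point_exists:
  assumes \<beta>: "\<beta> \<in> actions G"
    and p': "\<And>n. labelling (p' n)"
    and fac: "\<And>n. factor \<alpha> (p n) = factor \<beta> (p' n)"
    and tower: "\<And>n x. p n x = f (p (Suc n) x)" "\<And>n x. p' n x = f (p' (Suc n) x)"
  shows "\<exists>y. \<forall>n. coding \<beta> (p' n) y = coding \<alpha> (p n) x"
proof -
  define C where "C = (\<lambda>n. {y. coding \<beta> (p' n) y = coding \<alpha> (p n) x})"
  have closed: "closedin cantor_space (C n)" for n
    unfolding closedin_cantor_iff
  proof (intro allI impI)
    fix y assume app: "\<forall>m. \<exists>y'\<in>C n. agree m y y'"
    have "coding \<beta> (p' n) y g = coding \<alpha> (p n) x g" for g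
    proof -
      obtain m where m: "\<And>y y'. agree m y y' \<Longrightarrow> coding \<beta> (p' n) y g = coding \<beta> (p' n) y' g"
        using labelling_coding[OF \<beta> p', of n g] unfolding labelling_def by blast
      obtain y' where "y' \<in> C n" "agree m y y'" using app by blast
      then show ?thesis using m by (simp add: C_def)
    qed
    then show "y \<in> C n" by (auto simp: C_def)
  qed
  have ne: "C n \<noteq> {}" for n
  proof -
    have "coding \<alpha> (p n) x \<in> factor \<beta> (p' n)"
      using fac[of n] by (auto simp: factor_def)
    then show ?thesis by (auto simp: factor_def C_def)
  qed
  have dec: "C (Suc n) \<subseteq> C n" for n
  proof
    fix y assume "y \<in> C (Suc n)"
    then have "letter_map f (coding \<beta> (p' (Suc n)) y) = letter_map f (coding \<alpha> (p (Suc n)) x)"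
      by (simp add: C_def)
    then show "y \<in> C n"
      by (simp add: coding_letter_map C_def tower[symmetric])
  qed
  have "(\<Inter>n. C n) \<noteq> {}"
    by (rule compact_space_imp_nest[OF compact_space_cantor closed ne decseq_SucI[of C, OF dec]])
  then show ?thesis by (auto simp: C_def)
qed

text \<open>Both actions are inverse limits of the same tower of factors, because the labellings separate
  points. Matching points with equal codings is the conjugacy.\<close>

lemma conjugate_if_towers_match:
  assumes \<alpha>: "\<alpha> \<in> actions G" and \<beta>: "\<beta> \<in> actions G"
    and fd: "\<And>n. labelling (p n)" "\<And>n. labelling (p' n)"
    and fac: "\<And>n. factor \<alpha> (p n) = factor \<beta> (p' n)"
    and tower: "\<And>n x. p n x = f (p (Suc n) x)" "\<And>n x. p' n x = f (p' (Suc n) x)"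
    and sep: "\<And>n x y. p (Suc n) x = p (Suc n) y \<Longrightarrow> agree n x y"
      "\<And>n x y. p' (Suc n) x = p' (Suc n) y \<Longrightarrow> agree n x y"
  shows "\<exists>\<phi>\<in>carrier homeo_group. conj_action G \<phi> \<alpha> = \<beta>"
proof -
  define match where "match = (\<lambda>x y. \<forall>n. coding \<beta> (p' n) y = coding \<alpha> (p n) x)"
  have match_p: "p' n y = p n x" if "match x y" for n x y
    using that coding_one[OF \<alpha>, of "p n" x] coding_one[OF \<beta>, of "p' n" y] by (simp add: match_def)
  have "\<exists>y. match x y" for x
    unfolding match_def
    by (rule matching_point_exists[where p = p and p' = p' and f = f, OF \<beta> fd(2) fac tower])
  then obtain \<phi> where \<phi>: "\<And>x. match x (\<phi> x)" by metis
  have "\<exists>x. match x y" for y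
    using matching_point_exists[where p = p' and p' = p and f = f, OF \<alpha> fd(1) fac[symmetric] tower(2,1), of y]
    unfolding match_def by metis
  then obtain \<psi> where \<psi>: "\<And>y. match (\<psi> y) y" by metis
  have uniq: "y = y'" if "match x y" "match x y'" for x y y'
    by (rule eq_if_agree, rule sep(2)) (simp add: match_p[OF that(1)] match_p[OF that(2)])
  have uniq': "x = x'" if "match x y" "match x' y" for x x' y
    by (rule eq_if_agree, rule sep(1)) (simp add: match_p[OF that(1), symmetric] match_p[OF that(2), symmetric])
  have cont: "continuous_map cantor_space cantor_space \<phi>"
    unfolding continuous_map_into_cantor_iff continuous_map_discrete_iff_labelling
  proof
    fix k
    obtain m where m: "\<And>x y. agree m x y \<Longrightarrow> p (Suc (Suc k)) x = p (Suc (Suc k)) y"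
      using fd(1) unfolding labelling_def by blast
    have "\<phi> x k = \<phi> y k" if "agree m x y" for x y
      using sep(2)[of "Suc k" "\<phi> x" "\<phi> y"] m[OF that] by (simp add: match_p[OF \<phi>] agree_def)
    then show "labelling (\<lambda>x. \<phi> x k)" unfolding labelling_def by blast
  qed
  have "inj \<phi>" by (rule injI) (metis uniq' \<phi>)
  moreover have "surj \<phi>" by (rule surjI[of _ \<psi>]) (metis uniq \<phi> \<psi>)
  ultimately have "homeomorphic_map cantor_space cantor_space \<phi>"
    using cont compact_space_cantor Hausdorff_space_cantor
    by (intro continuous_imp_homeomorphic_map) auto
  then have \<phi>c: "\<phi> \<in> carrier homeo_group" by (simp add: homeo_group_def)
  have equi: "\<phi> (\<alpha> g x) = \<beta> g (\<phi> x)" if "g \<in> carrier G" for g x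
  proof (rule uniq[OF \<phi>])
    show "match (\<alpha> g x) (\<beta> g (\<phi> x))"
      using \<phi>[of x] by (simp add: match_def coding_shift[OF \<alpha> that] coding_shift[OF \<beta> that])
  qed
  have "conj_action G \<phi> \<alpha> = \<beta>"
  proof
    fix g
    show "conj_action G \<phi> \<alpha> g = \<beta> g"
    proof (cases "g \<in> carrier G")
      case True
      then show ?thesis
        using homeomorphism_bij(2)[OF \<phi>c] by (auto simp: conj_action_def equi)
    next
      case False
      then show ?thesis
        using \<beta> by (auto simp: conj_action_def actions_iff extensional_def)
    qed
  qed
  then show ?thesis using \<phi>c by blast
qed

text \<open>Back and forth, starting from the constant labelling, for which all actions have the same factor.
  One step refines the labellings so that the first \<open>n\<close> bits are visible on both sides.\<close>

lemma generic_actions_conjugate: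
  assumes \<alpha>: "\<alpha> \<in> generic_actions" and \<beta>: "\<beta> \<in> generic_actions"
  shows "\<exists>\<phi>\<in>carrier homeo_group. conj_action G \<phi> \<alpha> = \<beta>"
proof -
  have \<alpha>a: "\<alpha> \<in> actions G" and \<beta>a: "\<beta> \<in> actions G"
    using \<alpha> \<beta> by (auto simp: generic_actions_def)
  define R where "R = (\<lambda>(p :: cantor \<Rightarrow> nat, p' :: cantor \<Rightarrow> nat).
      labelling p \<and> labelling p' \<and> factor \<alpha> p = factor \<beta> p')"
  define S where "S = (\<lambda>n (p :: cantor \<Rightarrow> nat, p' :: cantor \<Rightarrow> nat) (u :: cantor \<Rightarrow> nat, u' :: cantor \<Rightarrow> nat).
      (\<forall>x. p x = pfst (pfst (u x))) \<and> (\<forall>x. p' x = pfst (pfst (u' x))) \<and>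
      (\<forall>x y. u x = u y \<longrightarrow> agree n x y) \<and> (\<forall>x y. u' x = u' y \<longrightarrow> agree n x y))"
  have "\<exists>P. \<forall>n. R (P n) \<and> S n (P n) (P (Suc n))"
  proof (rule dependent_nat_choice)
    have "factor \<alpha> (\<lambda>_. 0 :: nat) = factor \<beta> (\<lambda>_. 0)"
      by (simp add: factor_def coding_def)
    then have "R (\<lambda>_. 0, \<lambda>_. 0)"
      by (simp add: R_def labelling_def)
    then show "\<exists>P. R P" by blast
  next
    fix P n assume P: "R P"
    obtain p p' where pp: "P = (p, p')" by (cases P)
    obtain r r' where r: "labelling r" "labelling r'" "factor \<alpha> r = factor \<beta> r'"
        "\<forall>x. pfst (r x) = p x" "\<forall>x. pfst (r' x) = p' x" "\<forall>x. psnd (r x) = prefix n x"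
      using generic_forth[OF \<alpha> \<beta> _ _ _ labelling_prefix[of n], of p p'] P
      by (auto simp: R_def pp)
    obtain u' u where u: "labelling u'" "labelling u" "factor \<beta> u' = factor \<alpha> u"
        "\<forall>x. pfst (u' x) = r' x" "\<forall>x. pfst (u x) = r x" "\<forall>x. psnd (u' x) = prefix n x"
      using generic_forth[OF \<beta> \<alpha> r(2,1) r(3)[symmetric] labelling_prefix[of n]] by (elim exE conjE)
    have "agree n x y" if "u x = u y" for x y
    proof -
      have "prefix n x = prefix n y" using that r(6) u(5) by metis
      then show ?thesis by (simp add: prefix_eq_iff)
    qed
    moreover have "agree n x y" if "u' x = u' y" for x y
    proof -
      have "prefix n x = prefix n y" using that u(6) by metis
      then show ?thesis by (simp add: prefix_eq_iff)
    qed
    ultimately have "R (u, u') \<and> S n P (u, u')"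
      using u r by (simp add: R_def S_def pp)
    then show "\<exists>Q. R Q \<and> S n P Q" by blast
  qed
  then obtain P where P: "\<And>n. R (P n)" "\<And>n. S n (P n) (P (Suc n))" by blast
  define p p' where "p = (\<lambda>n. fst (P n))" and "p' = (\<lambda>n. snd (P n))"
  have "labelling (p n)" "labelling (p' n)" "factor \<alpha> (p n) = factor \<beta> (p' n)" for n
    using P(1)[of n] by (simp_all add: R_def p_def p'_def case_prod_beta')
  moreover have "p n x = pfst (pfst (p (Suc n) x))" "p' n x = pfst (pfst (p' (Suc n) x))" for n x
    using P(2)[of n] by (simp_all add: S_def p_def p'_def case_prod_beta')
  moreover have "p (Suc n) x = p (Suc n) y \<Longrightarrow> agree n x y" "p' (Suc n) x = p' (Suc n) y \<Longrightarrow> agree n x y" for n x y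
    using P(2)[of n] by (simp_all add: S_def p_def p'_def case_prod_beta')
  ultimately show ?thesis
    by (rule conjugate_if_towers_match[OF \<alpha>a \<beta>a, where f = "\<lambda>c. pfst (pfst c)"])
qed

lemma stable_dense_imp_strong_topological_Rokhlin:
  assumes stable_dense
  shows "strong_topological_Rokhlin G"
proof -
  have com: "comeager_in Act generic_actions"
    by (rule comeager_generic_actions[OF assms])
  have "(\<lambda>g\<in>carrier G. \<lambda>x. x) \<in> actions G"
    by (simp add: actions_iff)
  \<comment> \<open>Otherwise the empty family would cover it, and by Baire category there would be no actions at all.\<close>
  then have "generic_actions \<noteq> {}"
    using comeager_in_countable_closed_cover[OF completely_metrizable_action_topology com, of "{}"] by auto
  then obtain \<alpha> where \<alpha>: "\<alpha> \<in> generic_actions" by blast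
  then have \<alpha>a: "\<alpha> \<in> actions G" by (simp add: generic_actions_def)
  have "comeager_in Act {conj_action G \<phi> \<alpha> | \<phi>. \<phi> \<in> carrier homeo_group}"
  proof (rule comeager_in_mono[OF com])
    show "generic_actions \<subseteq> {conj_action G \<phi> \<alpha> | \<phi>. \<phi> \<in> carrier homeo_group}"
    proof
      fix \<beta> assume "\<beta> \<in> generic_actions"
      then obtain \<phi> where "\<phi> \<in> carrier homeo_group" "conj_action G \<phi> \<alpha> = \<beta>"
        using generic_actions_conjugate[OF \<alpha>] by blast
      then show "\<beta> \<in> {conj_action G \<phi> \<alpha> | \<phi>. \<phi> \<in> carrier homeo_group}" by blast
    qed
    show "{conj_action G \<phi> \<alpha> | \<phi>. \<phi> \<in> carrier homeo_group} \<subseteq> topspace Act"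
      using conj_action_in_actions[OF _ \<alpha>a] by auto
  qed
  then show ?thesis
    unfolding strong_topological_Rokhlin_def using \<alpha>a by blast
qed

end

section \<open>Equivalence of the three conditions\<close>

theorem theorem1:
  fixes G :: "('g, 'b) monoid_scheme"
    and \<rho> :: "cantor metric"
    and d :: "nat set \<Rightarrow> ('g \<Rightarrow> nat) metric"
  assumes "group G" and "countable (carrier G)"
    and "mtopology_of \<rho> = cantor_space"
    and "\<And>A. finite A \<Longrightarrow> card A \<ge> 2 \<Longrightarrow> mtopology_of (d A) = full_shift G A"
  shows "(finitely_generated_group G \<longrightarrow>
            (strong_topological_Rokhlin G \<longleftrightarrow> projectively_isolated_dense G d) \<and>
            (projectively_isolated_dense G d \<longleftrightarrow> shadowing_generic G \<rho>)) \<and>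
         (strong_topological_Rokhlin G \<longleftrightarrow> projectively_isolated_dense G d) \<and>
         (shadowing_generic G \<rho> \<longrightarrow>
            strong_topological_Rokhlin G \<and> projectively_isolated_dense G d)"
proof -
  interpret countable_group G
    using assms(1,2) by (simp add: countable_group_def countable_group_axioms_def)
  have "strong_topological_Rokhlin G \<longleftrightarrow> stable_dense"
    using strong_topological_Rokhlin_imp_stable_dense stable_dense_imp_strong_topological_Rokhlin by blast
  moreover have "projectively_isolated_dense G d \<longleftrightarrow> stable_dense"
    using projectively_isolated_dense_imp_stable_dense[of d]
      stable_dense_imp_projectively_isolated_dense[of d] assms(4) by blast
  moreover have "shadowing_generic G \<rho> \<longleftrightarrow> stable_dense"
    using shadowing_generic_imp_stable_dense[OF assms(3)]
      stable_dense_imp_shadowing_generic[OF assms(3)] by blast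
  ultimately show ?thesis by simp
qed

end
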